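(* Let $d>0$, $\alpha\in\mathbb{R}$, let $V_0:\mathbb{R}\to\mathbb{R}$ be continuous, even and $d$-periodic, and let $L=-\partial_x^2+V(x)$ with $V(x)=V_0(x)$ for $x<0$ and $V(x)=V_0(x)+\alpha$ for $x\ge 0$. Suppose $|\alpha|>s_2-s_1$. (i) If $V_0$ is strictly increasing on $[0,\frac d2]$, then: for $\alpha>0$ there is a unique eigenvalue of $L$ in $G_1\cap(G_0+\alpha)$, and for $\alpha<0$ there is a unique eigenvalue of $L$ in $G_0\cap(G_1+\alpha)$. (ii) If $V_0$ is strictly decreasing on $[0,\frac d2]$, then: for $\alpha>0$ there is no eigenvalue of $L$ in $G_1\cap(G_0+\alpha)$, and for $\alpha<0$ there is no eigenvalue of $L$ in $G_0\cap(G_1+\alpha)$.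
   Context: The operator $L$ acts in $L^2(\mathbb{R})$ with domain $H^2(\mathbb{R})$. The operator $L_0=-\partial_x^2+V_0$ on $\mathbb{R}$ has spectrum $\sigma(L_0)=\bigcup_{n\ge1}[s_{2n-1},s_{2n}]$ with $s_{2n-1}<s_{2n}\le s_{2n+1}$; the $s_j$ are the band edges, i.e. $s_1$ is the lowest $d$-periodic eigenvalue, $s_2\le s_3$ are the two lowest $d$-antiperiodic eigenvalues, $s_4\le s_5$ are the next two $d$-periodic eigenvalues, and so on alternately. The spectral gaps of $L_0$ are $G_0=(-\infty,s_1)$ and $G_n=(s_{2n},s_{2n+1})$, $n\ge1$; in particular $G_1=(s_2,s_3)$. For a set $G\subset\mathbb{R}$, $G+\alpha=\{\lambda+\alpha:\lambda\in G\}$. *)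

theory Defs
  imports "HOL-Analysis.Analysis" "HOL-Library.Function_Algebras"
begin

definition square_integrable :: "(real \<Rightarrow> complex) \<Rightarrow> bool" where
  "square_integrable u \<longleftrightarrow>
     u \<in> borel_measurable lborel \<and> integrable lborel (\<lambda>x. (norm (u x))\<^sup>2)"

definition test_function :: "(real \<Rightarrow> real) \<Rightarrow> bool" where
  "test_function \<phi> \<longleftrightarrow>
     (\<forall>k x. (deriv ^^ k) \<phi> field_differentiable at x) \<and> compact (closure {x. \<phi> x \<noteq> 0})"

definition weak_derivative :: "(real \<Rightarrow> complex) \<Rightarrow> (real \<Rightarrow> complex) \<Rightarrow> bool" where
  "weak_derivative u v \<longleftrightarrow>
     (\<forall>\<phi>. test_function \<phi> \<longrightarrow>
        (LINT x|lborel. u x * of_real (deriv \<phi> x)) = - (LINT x|lborel. v x * of_real (\<phi> x)))"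

text \<open>
  \<open>sobolev_H2 u u2\<close>: \<open>u\<close> represents an element of \<open>H\<^sup>2(\<real>)\<close>, and \<open>u2\<close> represents its second
  weak derivative. Elements of \<open>L\<^sup>2(\<real>)\<close> are given by Borel representatives, so equality of such
  elements is equality almost everywhere.
\<close>

definition sobolev_H2 :: "(real \<Rightarrow> complex) \<Rightarrow> (real \<Rightarrow> complex) \<Rightarrow> bool" where
  "sobolev_H2 u u2 \<longleftrightarrow> square_integrable u \<and> square_integrable u2 \<and>
     (\<exists>u1. square_integrable u1 \<and> weak_derivative u u1 \<and> weak_derivative u1 u2)"

text \<open>
  Eigenvalues of \<open>- \<partial>\<^sub>x\<^sup>2 + V\<close> in \<open>L\<^sup>2(\<real>)\<close> with domain \<open>H\<^sup>2(\<real>)\<close>. Only real candidates are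
  considered, since the operator is self-adjoint for real bounded \<open>V\<close>.
\<close>

definition schroedinger_eigenvalue :: "(real \<Rightarrow> real) \<Rightarrow> real \<Rightarrow> bool" where
  "schroedinger_eigenvalue V l \<longleftrightarrow>
     (\<exists>u u2. sobolev_H2 u u2 \<and> \<not> (AE x in lborel. u x = 0) \<and>
        (AE x in lborel. - u2 x + of_real (V x) * u x = of_real l * u x))"

definition interface_potential :: "(real \<Rightarrow> real) \<Rightarrow> real \<Rightarrow> real \<Rightarrow> real" where
  "interface_potential V0 \<alpha> x = (if x < 0 then V0 x else V0 x + \<alpha>)"

text \<open>
  Solutions of \<open>- u'' + V u = \<mu> u\<close> with \<open>u(x + d) = \<sigma> u(x)\<close>; \<open>\<sigma> = 1\<close> is the \<open>d\<close>-periodic and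
  \<open>\<sigma> = - 1\<close> the \<open>d\<close>-antiperiodic eigenvalue problem.
\<close>

definition hill_eigenspace ::
    "real \<Rightarrow> (real \<Rightarrow> real) \<Rightarrow> complex \<Rightarrow> real \<Rightarrow> (real \<Rightarrow> complex) set" where
  "hill_eigenspace d V \<sigma> \<mu> = {u. \<exists>u1. \<forall>x.
      (u has_vector_derivative u1 x) (at x) \<and>
      (u1 has_vector_derivative (of_real (V x) - of_real \<mu>) * u x) (at x) \<and>
      u (x + d) = \<sigma> * u x}"

definition fun_scale :: "complex \<Rightarrow> (real \<Rightarrow> complex) \<Rightarrow> real \<Rightarrow> complex" where
  "fun_scale c u = (\<lambda>x. c * u x)"

lemma vector_space_fun_scale: "vector_space fun_scale"
  by unfold_locales (auto simp: fun_scale_def fun_eq_iff algebra_simps)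

definition hill_multiplicity ::
    "real \<Rightarrow> (real \<Rightarrow> real) \<Rightarrow> complex \<Rightarrow> real \<Rightarrow> nat" where
  "hill_multiplicity d V \<sigma> \<mu> = vector_space.dim fun_scale (hill_eigenspace d V \<sigma> \<mu>)"

definition hill_eigenvalues ::
    "real \<Rightarrow> (real \<Rightarrow> real) \<Rightarrow> complex \<Rightarrow> real set" where
  "hill_eigenvalues d V \<sigma> = {\<mu>. \<exists>u\<in>hill_eigenspace d V \<sigma> \<mu>. \<exists>x. u x \<noteq> 0}"

text \<open>
  The \<open>k\<close>-th eigenvalue (\<open>k \<ge> 1\<close>) in nondecreasing order, repeated according to multiplicity:
  the least \<open>\<lambda>\<close> such that at least \<open>k\<close> eigenvalues, counted with multiplicity, are \<open>\<le> \<lambda>\<close>.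
\<close>

definition nth_hill_eigenvalue ::
    "real \<Rightarrow> (real \<Rightarrow> real) \<Rightarrow> complex \<Rightarrow> nat \<Rightarrow> real" where
  "nth_hill_eigenvalue d V \<sigma> k =
     Inf {l. k \<le> (\<Sum>\<mu> \<in> hill_eigenvalues d V \<sigma> \<inter> {..l}. hill_multiplicity d V \<sigma> \<mu>)}"

text \<open>
  With \<open>p\<^sub>k\<close> and \<open>a\<^sub>k\<close> the \<open>k\<close>-th periodic and antiperiodic eigenvalue, the band edges
  \<open>s\<^sub>1, s\<^sub>2, s\<^sub>3, \<dots>\<close> are \<open>p\<^sub>1, a\<^sub>1, a\<^sub>2, p\<^sub>2, p\<^sub>3, a\<^sub>3, a\<^sub>4, p\<^sub>4, p\<^sub>5, \<dots>\<close>.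
\<close>

definition band_edge :: "real \<Rightarrow> (real \<Rightarrow> real) \<Rightarrow> nat \<Rightarrow> real" where
  "band_edge d V j =
     nth_hill_eigenvalue d V (if even (j div 2) then 1 else - 1) ((j + 1) div 2)"

definition spectral_gap :: "real \<Rightarrow> (real \<Rightarrow> real) \<Rightarrow> nat \<Rightarrow> real set" where
  "spectral_gap d V n =
     (if n = 0 then {..<band_edge d V 1}
      else {band_edge d V (2 * n)<..<band_edge d V (2 * n + 1)})"

definition shift_set :: "real set \<Rightarrow> real \<Rightarrow> real set" where
  "shift_set G \<alpha> = {l + \<alpha> | l. l \<in> G}"

end

theory Submission
  imports Defs
begin

text \<open>
  On the right half line an eigenfunction solves Hill's equation for the energy \<open>l - \<alpha>\<close>, on the left
  half line for \<open>l\<close>, and it must decay at both ends. If \<open>l\<close> and \<open>l - \<alpha>\<close> lie in gaps, the decaying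
  solution on each side is unique up to a factor, so an eigenvalue is an energy at which the two
  logarithmic derivatives at \<open>0\<close> agree. Since \<open>V0\<close> is even, the left one is the negative of a right
  one: with \<open>m (l)\<close> the slope at \<open>0\<close> of the solution that decays on the right, the condition is
  \<open>m (l - \<alpha>) = - m (l)\<close> (\<open>schroedinger_eigenvalue_iff_matching\<close>).

  Let \<open>h = d / 2\<close> and let \<open>neu\<close>, \<open>dir\<close> be the even and the odd fundamental solution. By evenness the
  Floquet condition can be read off at \<open>\<plusminus> h\<close>. It gives \<open>m\<^sup>2 = neu neu' / (dir dir')\<close> at \<open>h\<close>, and decay
  selects the sign of \<open>m\<close> by \<open>m neu dir < 0\<close>. Likewise the band edges become eigenvalues on \<open>[0, h]\<close>:
  \<open>s\<^sub>1\<close> is the lowest zero of \<open>neu' V l h\<close>, and \<open>s\<^sub>2, s\<^sub>3\<close> are the lowest zeros \<open>a\<close> of \<open>neu V l h\<close> and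
  \<open>b\<close> of \<open>dir' V l h\<close>, in an order that depends on \<open>V0\<close>. Reflecting \<open>[0, h]\<close> exchanges \<open>neu\<close> and \<open>dir'\<close>
  at \<open>h\<close>, and thereby \<open>a\<close> and \<open>b\<close> (\<open>flip_transfer\<close>).

  A strictly increasing \<open>V0\<close> favours the solution that is concentrated near \<open>0\<close>, that is \<open>a < b\<close>
  (\<open>ND_less_DN\<close>). Then \<open>m > 0\<close> in the first gap and \<open>m < 0\<close> below the spectrum, and the matching
  condition says that \<open>m\<^sup>2\<close> takes the same value at the two energies. By Sturm comparison both
  \<open>neu / dir\<close> and \<open>neu' / dir'\<close> decrease in \<open>l\<close> (\<open>boundary_quotients_decreasing\<close>), so \<open>m\<^sup>2\<close> increases in
  the first gap, where both are negative, and decreases below the spectrum, where both are positive;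
  this gives uniqueness. Existence follows from the intermediate value theorem, since \<open>m\<^sup>2\<close> vanishes
  at \<open>s\<^sub>1\<close> and \<open>s\<^sub>2\<close> and has a pole at \<open>s\<^sub>3\<close> (\<open>unique_matching_energy\<close>). If \<open>V0\<close> is strictly decreasing,
  reflection gives \<open>b < a\<close>; now \<open>m < 0\<close> in both gaps and the condition cannot hold.

  Eigenfunctions are given as \<open>H\<^sup>2\<close> functions with weak derivatives. The lemma of du Bois-Reymond and
  Fubini's theorem show that they are classical solutions on both sides of \<open>0\<close> with a common value
  and slope at \<open>0\<close> (\<open>schroedinger_eigenvalue_imp_classical\<close>). That such a solution is proportional to
  the decaying one follows from their Wronskian, which is both constant and integrable on the half
  line.
\<close>

section \<open>Hill's equation on the line\<close>

lemma continuous_imp_antiderivative: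
  fixes f :: "real \<Rightarrow> real"
  assumes "continuous_on UNIV f"
  shows "\<exists>F. F 0 = 0 \<and> (\<forall>x. (F has_real_derivative f x) (at x))"
proof -
  have "\<exists>F. \<forall>x::real. -\<infinity> < ereal x \<longrightarrow> ereal x < \<infinity> \<longrightarrow> (F has_vector_derivative f x) (at x)"
    by (rule einterval_antiderivative)
      (use assms in \<open>auto simp: continuous_on_eq_continuous_at\<close>)
  then obtain F where "\<And>x. (F has_vector_derivative f x) (at x)"
    by auto
  then have "((\<lambda>x. F x - F 0) has_real_derivative f x) (at x)" for x
    by (auto intro!: derivative_eq_intros simp: has_real_derivative_iff_has_vector_derivative)
  then show ?thesis
    by (intro exI[of _ "\<lambda>x. F x - F 0"]) auto
qed

lemma continuous_on_Icc_bounded: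
  fixes f :: "real \<Rightarrow> real"
  assumes "continuous_on {a..b} f"
  obtains K where "\<And>x. x \<in> {a..b} \<Longrightarrow> \<bar>f x\<bar> \<le> K"
proof -
  have "bounded (f ` {a..b})"
    by (intro compact_imp_bounded compact_continuous_image assms) auto
  then obtain K where "\<forall>u\<in>f ` {a..b}. norm u \<le> K"
    unfolding bounded_iff by blast
  then show ?thesis by (intro that[of K]) auto
qed

lemma nonneg_derivative_mono:
  fixes f :: "real \<Rightarrow> real"
  assumes "a \<le> b" "\<And>x. a \<le> x \<Longrightarrow> x \<le> b \<Longrightarrow> (f has_real_derivative f' x) (at x)"
    and "\<And>x. a \<le> x \<Longrightarrow> x \<le> b \<Longrightarrow> 0 \<le> f' x"
  shows "f a \<le> f b"
  using DERIV_nonneg_imp_nondecreasing[of a b f] assms by blast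

lemma DERIV_imp_has_integral:
  fixes F :: "real \<Rightarrow> real"
  assumes "a \<le> b" "\<And>x. (F has_real_derivative f x) (at x)"
  shows "(f has_integral F b - F a) {a..b}"
  using fundamental_theorem_of_calculus[OF assms(1), of F f] assms(2)
  by (auto simp: has_real_derivative_iff_has_vector_derivative intro: has_vector_derivative_at_within)

lemma antiderivative_power_bound_nonneg:
  fixes F f :: "real \<Rightarrow> real"
  assumes "F 0 = 0" "\<And>x. (F has_real_derivative f x) (at x)"
    and "\<And>t. 0 \<le> t \<Longrightarrow> t \<le> T \<Longrightarrow> \<bar>f t\<bar> \<le> c * t ^ n" "0 \<le> x" "x \<le> T"
  shows "\<bar>F x\<bar> \<le> c * x ^ Suc n / Suc n"
proof -
  define G where "G t = c / Suc n * t ^ Suc n" for t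
  have G: "(G has_real_derivative c * t ^ n) (at t)" for t
    unfolding G_def[abs_def]
    using DERIV_cmult[OF DERIV_pow[of "Suc n" t], of "c / Suc n"] by (simp del: of_nat_Suc)
  have "\<bar>f t\<bar> \<le> c * t ^ n" if "0 \<le> t" "t \<le> x" for t
    using assms(3)[of t] assms(5) that by simp
  then have "0 \<le> c * t ^ n - f t" "0 \<le> c * t ^ n + f t" if "0 \<le> t" "t \<le> x" for t
    using that by (smt (verit))+
  then have "G 0 - F 0 \<le> G x - F x" "G 0 + F 0 \<le> G x + F x"
    using nonneg_derivative_mono[OF assms(4) DERIV_diff[OF G assms(2)]]
      nonneg_derivative_mono[OF assms(4) DERIV_add[OF G assms(2)]] by blast+
  then show ?thesis
    using assms(1) by (simp add: G_def abs_le_iff)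
qed

lemma antiderivative_power_bound:
  fixes F f :: "real \<Rightarrow> real"
  assumes "F 0 = 0" "\<And>x. (F has_real_derivative f x) (at x)"
    and "\<And>t. \<bar>t\<bar> \<le> T \<Longrightarrow> \<bar>f t\<bar> \<le> c * \<bar>t\<bar> ^ n" "\<bar>x\<bar> \<le> T"
  shows "\<bar>F x\<bar> \<le> c * \<bar>x\<bar> ^ Suc n / Suc n"
proof (cases "0 \<le> x")
  case True
  have "\<bar>f t\<bar> \<le> c * t ^ n" if "0 \<le> t" "t \<le> T" for t
    using assms(3)[of t] that by simp
  from antiderivative_power_bound_nonneg[OF assms(1,2) this] True assms(4) show ?thesis
    by simp
next
  case False
  have "((\<lambda>t. F (- t)) has_real_derivative - f (- t)) (at t)" for t
    using assms(2)[of "- t"] by (simp add: DERIV_mirror)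
  moreover have "\<bar>- f (- t)\<bar> \<le> c * t ^ n" if "0 \<le> t" "t \<le> T" for t
    using assms(3)[of "- t"] that by simp
  ultimately show ?thesis
    using antiderivative_power_bound_nonneg[of "\<lambda>t. F (- t)" "\<lambda>t. - f (- t)" T c n "- x"]
      False assms(1,4) by simp
qed

text \<open>
  A real solution of \<open>- y'' + V y = l y\<close> is carried together with its derivative \<open>p\<close>, so that
  the equation is a first order system.
\<close>

definition hill_solution ::
    "(real \<Rightarrow> real) \<Rightarrow> real \<Rightarrow> (real \<Rightarrow> real) \<Rightarrow> (real \<Rightarrow> real) \<Rightarrow> bool" where
  "hill_solution V l y p \<longleftrightarrow> (\<forall>x. (y has_real_derivative p x) (at x) \<and>
     (p has_real_derivative (V x - l) * y x) (at x))"

text \<open>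
  The Picard iterates of the first order system are dominated on \<open>[- T, T]\<close> by the terms of
  \<open>exp (K T)\<close>, where \<open>K\<close> bounds the coefficients; hence their sum may be differentiated term by
  term.
\<close>

lemma hill_solution_exists:
  assumes V: "continuous_on UNIV V"
  shows "\<exists>y p. hill_solution V l y p \<and> y 0 = A \<and> p 0 = B"
proof -
  define q where "q x = V x - l" for x
  have q: "continuous_on UNIV q"
    unfolding q_def by (intro continuous_intros V)
  have "\<exists>J. \<forall>f. continuous_on UNIV f \<longrightarrow>
      J f 0 = 0 \<and> (\<forall>x::real. (J f has_real_derivative f x) (at x))"
    using continuous_imp_antiderivative by metis
  then obtain J :: "(real \<Rightarrow> real) \<Rightarrow> real \<Rightarrow> real" where J:
    "\<And>f. continuous_on UNIV f \<Longrightarrow> J f 0 = 0"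
    "\<And>f x. continuous_on UNIV f \<Longrightarrow> (J f has_real_derivative f x) (at x)"
    by auto
  have contJ: "continuous_on UNIV (J f)" if "continuous_on UNIV f" for f
    by (rule DERIV_continuous_on[of _ _ f]) (use J(2)[OF that] in auto)
  define Z where "Z = rec_nat ((\<lambda>_::real. A), (\<lambda>_::real. B))
    (\<lambda>n yp. (J (snd yp), J (\<lambda>x. q x * fst yp x)))"
  define y where "y n = fst (Z n)" for n
  define p where "p n = snd (Z n)" for n
  have y0: "y 0 = (\<lambda>_. A)" and p0: "p 0 = (\<lambda>_. B)"
    and yS: "y (Suc n) = J (p n)" and pS: "p (Suc n) = J (\<lambda>x. q x * y n x)" for n
    by (auto simp: Z_def y_def p_def)
  have cont: "continuous_on UNIV (y n) \<and> continuous_on UNIV (p n)" for n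
  proof (induction n)
    case (Suc n)
    then have "continuous_on UNIV (\<lambda>x. q x * y n x)"
      by (intro continuous_intros q) auto
    with Suc show ?case
      unfolding yS pS by (simp add: contJ)
  qed (auto simp: y0 p0)
  have cq: "continuous_on UNIV (\<lambda>x. q x * y n x)" for n
    using cont q by (auto intro!: continuous_intros)
  have yd: "(y (Suc n) has_real_derivative p n x) (at x)"
    and pd: "(p (Suc n) has_real_derivative q x * y n x) (at x)"
    and yz: "y (Suc n) 0 = 0" and pz: "p (Suc n) 0 = 0" for n x
    unfolding yS pS using cont[of n] J(2)[OF cq[of n]] J(1)[OF cq[of n]] by (simp_all add: J)
  define Y where "Y x = A + (\<Sum>n. y (Suc n) x)" for x
  define P where "P x = B + (\<Sum>n. p (Suc n) x)" for x
  have "(Y has_real_derivative P x) (at x) \<and> (P has_real_derivative q x * Y x) (at x)" for x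
  proof -
    define T where "T = \<bar>x\<bar> + 1"
    obtain K0 where K0: "\<And>t. t \<in> {- T..T} \<Longrightarrow> \<bar>q t\<bar> \<le> K0"
      using continuous_on_Icc_bounded[OF continuous_on_subset[OF q]] by blast
    define K where "K = max 1 K0"
    have K: "1 \<le> K" "\<And>t. \<bar>t\<bar> \<le> T \<Longrightarrow> \<bar>q t\<bar> \<le> K"
    proof -
      show "\<bar>q t\<bar> \<le> K" if "\<bar>t\<bar> \<le> T" for t
        using K0[of t] that unfolding K_def by (simp add: abs_le_iff) linarith
    qed (simp add: K_def)
    define M where "M = \<bar>A\<bar> + \<bar>B\<bar>"
    have bound: "\<forall>t. \<bar>t\<bar> \<le> T \<longrightarrow> \<bar>y n t\<bar> \<le> M * K ^ n / fact n * \<bar>t\<bar> ^ n \<and>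
        \<bar>p n t\<bar> \<le> M * K ^ n / fact n * \<bar>t\<bar> ^ n" for n
    proof (induction n)
      case 0
      then show ?case by (auto simp: y0 p0 M_def)
    next
      case (Suc n)
      let ?c = "M * K ^ Suc n / fact n"
      have M0: "0 \<le> M" by (simp add: M_def)
      have "M * K ^ n / fact n * \<bar>t\<bar> ^ n \<le> ?c * \<bar>t\<bar> ^ n" for t
      proof -
        have "M * K ^ n * 1 \<le> M * K ^ n * K"
          using K M0 by (intro mult_left_mono) auto
        then show ?thesis
          by (intro mult_right_mono divide_right_mono) (auto simp: ac_simps)
      qed
      then have 1: "\<bar>p n t\<bar> \<le> ?c * \<bar>t\<bar> ^ n" if "\<bar>t\<bar> \<le> T" for t
        using Suc that by (meson order_trans)
      have 2: "\<bar>q t * y n t\<bar> \<le> ?c * \<bar>t\<bar> ^ n" if "\<bar>t\<bar> \<le> T" for t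
      proof -
        have "\<bar>q t\<bar> * \<bar>y n t\<bar> \<le> K * (M * K ^ n / fact n * \<bar>t\<bar> ^ n)"
          using Suc that K by (intro mult_mono) auto
        then show ?thesis by (simp add: abs_mult ac_simps)
      qed
      have eq: "?c * \<bar>t\<bar> ^ Suc n / Suc n = M * K ^ Suc n / fact (Suc n) * \<bar>t\<bar> ^ Suc n" for t :: real
        by (simp add: field_simps)
      show ?case
        using antiderivative_power_bound[OF yz yd 1, of T] antiderivative_power_bound[OF pz pd 2, of T]
        unfolding eq by blast
    qed
    define m where "m n = K * M * ((K * T) ^ n / fact n)" for n
    have "summable (\<lambda>n. inverse (fact n) * (K * T) ^ n)"
      by (rule summable_exp)
    then have sm: "summable m"
      unfolding m_def by (intro summable_mult) (simp add: field_simps)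
    have m: "M * K ^ n / fact n * \<bar>t\<bar> ^ n * K \<le> m n" if "\<bar>t\<bar> \<le> T" for t n
    proof -
      have "M * K ^ n / fact n * \<bar>t\<bar> ^ n * K \<le> M * K ^ n / fact n * T ^ n * K"
        using that K by (intro mult_right_mono mult_left_mono power_mono) (auto simp: M_def)
      also have "\<dots> = m n" by (simp add: m_def power_mult_distrib)
      finally show ?thesis .
    qed
    have bK: "\<bar>u\<bar> \<le> m n" if "\<bar>u\<bar> \<le> M * K ^ n / fact n * \<bar>t\<bar> ^ n" "\<bar>t\<bar> \<le> T" for u t n
    proof -
      have "\<bar>u\<bar> * 1 \<le> M * K ^ n / fact n * \<bar>t\<bar> ^ n * K"
        using that K by (intro mult_mono) auto
      with m[OF that(2), of n] show ?thesis by simp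
    qed
    have bp: "norm (p n t) \<le> m n" "norm (y n t) \<le> m n" if "t \<in> {- T..T}" for n t
    proof -
      have t: "\<bar>t\<bar> \<le> T" using that by (simp add: abs_le_iff)
      show "norm (p n t) \<le> m n" "norm (y n t) \<le> m n"
        using bK[of "p n t" n t] bK[of "y n t" n t] bound[of n] t by auto
    qed
    have bq: "norm (q t * y n t) \<le> m n" if "t \<in> {- T..T}" for n t
    proof -
      have t: "\<bar>t\<bar> \<le> T" using that by (simp add: abs_le_iff)
      have "\<bar>q t\<bar> * \<bar>y n t\<bar> \<le> K * (M * K ^ n / fact n * \<bar>t\<bar> ^ n)"
        using bound[of n] t K by (intro mult_mono) auto
      with m[OF t, of n] show ?thesis by (simp add: abs_mult ac_simps)
    qed
    have xT: "x \<in> {- T..T}" "x \<in> interior {- T..T}"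
      by (auto simp: T_def)
    have T0: "0 \<le> T" by (simp add: T_def)
    have sy: "summable (\<lambda>n. y n x)" and sp: "summable (\<lambda>n. p n x)"
      by (rule summable_comparison_test'[OF sm], rule bp, rule xT)+
    have "uniformly_convergent_on {- T..T} (\<lambda>n x. \<Sum>i<n. p i x)"
      by (rule Weierstrass_m_test'[OF bp(1) sm])
    moreover have "(y (Suc n) has_real_derivative p n t) (at t within {- T..T})" for n t
      by (rule DERIV_subset[OF yd]) simp
    ultimately have "((\<lambda>x. \<Sum>n. y (Suc n) x) has_real_derivative (\<Sum>n. p n x)) (at x)"
      using has_field_derivative_series'(2)[of "{- T..T}" "\<lambda>n. y (Suc n)" "\<lambda>n x. p n x" 0 x] T0 xT(2) yz
      by simp
    then have 1: "(Y has_real_derivative (\<Sum>n. p n x)) (at x)"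
      unfolding Y_def[abs_def] by (auto intro!: derivative_eq_intros)
    have "uniformly_convergent_on {- T..T} (\<lambda>n x. \<Sum>i<n. q x * y i x)"
      by (rule Weierstrass_m_test'[OF bq sm])
    moreover have "(p (Suc n) has_real_derivative q t * y n t) (at t within {- T..T})" for n t
      by (rule DERIV_subset[OF pd]) simp
    ultimately have "((\<lambda>x. \<Sum>n. p (Suc n) x) has_real_derivative (\<Sum>n. q x * y n x)) (at x)"
      using has_field_derivative_series'(2)[of "{- T..T}" "\<lambda>n. p (Suc n)" "\<lambda>n x. q x * y n x" 0 x] T0 xT(2) pz
      by simp
    then have 2: "(P has_real_derivative (\<Sum>n. q x * y n x)) (at x)"
      unfolding P_def[abs_def] by (auto intro!: derivative_eq_intros)
    have "(\<Sum>n. p (Suc n) x) = (\<Sum>n. p n x) - p 0 x" "(\<Sum>n. y (Suc n) x) = (\<Sum>n. y n x) - y 0 x"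
      by (rule suminf_split_head[OF sp], rule suminf_split_head[OF sy])
    then have "(\<Sum>n. p n x) = P x" "(\<Sum>n. y n x) = Y x"
      unfolding P_def Y_def by (simp_all only: y0 p0 algebra_simps)
    then show ?thesis
      using 1 2 unfolding suminf_mult[OF sy] by simp
  qed
  moreover have "Y 0 = A" "P 0 = B"
    by (auto simp: Y_def P_def yz pz)
  ultimately have "hill_solution V l Y P \<and> Y 0 = A \<and> P 0 = B"
    unfolding hill_solution_def q_def[symmetric] by simp
  then show ?thesis by blast
qed

text \<open>
  The fundamental system at \<open>0\<close>: \<open>neu\<close> satisfies the Neumann condition there and \<open>dir\<close> the
  Dirichlet condition. For \<open>V = 0\<close> and \<open>l = \<omega>\<^sup>2\<close> they are \<open>cos (\<omega> x)\<close> and \<open>sin (\<omega> x) / \<omega>\<close>.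
\<close>

definition neu_pair :: "(real \<Rightarrow> real) \<Rightarrow> real \<Rightarrow> (real \<Rightarrow> real) \<times> (real \<Rightarrow> real)" where
  "neu_pair V l = (SOME yp. hill_solution V l (fst yp) (snd yp) \<and> fst yp 0 = 1 \<and> snd yp 0 = 0)"

definition dir_pair :: "(real \<Rightarrow> real) \<Rightarrow> real \<Rightarrow> (real \<Rightarrow> real) \<times> (real \<Rightarrow> real)" where
  "dir_pair V l = (SOME yp. hill_solution V l (fst yp) (snd yp) \<and> fst yp 0 = 0 \<and> snd yp 0 = 1)"

definition neu :: "(real \<Rightarrow> real) \<Rightarrow> real \<Rightarrow> real \<Rightarrow> real" where
  "neu V l = fst (neu_pair V l)"

definition neu' :: "(real \<Rightarrow> real) \<Rightarrow> real \<Rightarrow> real \<Rightarrow> real" where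
  "neu' V l = snd (neu_pair V l)"

definition dir :: "(real \<Rightarrow> real) \<Rightarrow> real \<Rightarrow> real \<Rightarrow> real" where
  "dir V l = fst (dir_pair V l)"

definition dir' :: "(real \<Rightarrow> real) \<Rightarrow> real \<Rightarrow> real \<Rightarrow> real" where
  "dir' V l = snd (dir_pair V l)"

lemma neu:
  assumes "continuous_on UNIV V"
  shows "hill_solution V l (neu V l) (neu' V l)" "neu V l 0 = 1" "neu' V l 0 = 0"
proof -
  obtain y p where "hill_solution V l y p \<and> y 0 = 1 \<and> p 0 = 0"
    using hill_solution_exists[OF assms] by blast
  then have "\<exists>yp. hill_solution V l (fst yp) (snd yp) \<and> fst yp 0 = 1 \<and> snd yp 0 = 0"
    by (intro exI[of _ "(y, p)"]) simp
  from someI_ex[OF this]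
  show "hill_solution V l (neu V l) (neu' V l)" "neu V l 0 = 1" "neu' V l 0 = 0"
    by (auto simp: neu_def neu'_def neu_pair_def)
qed

lemma dir:
  assumes "continuous_on UNIV V"
  shows "hill_solution V l (dir V l) (dir' V l)" "dir V l 0 = 0" "dir' V l 0 = 1"
proof -
  obtain y p where "hill_solution V l y p \<and> y 0 = 0 \<and> p 0 = 1"
    using hill_solution_exists[OF assms] by blast
  then have "\<exists>yp. hill_solution V l (fst yp) (snd yp) \<and> fst yp 0 = 0 \<and> snd yp 0 = 1"
    by (intro exI[of _ "(y, p)"]) simp
  from someI_ex[OF this]
  show "hill_solution V l (dir V l) (dir' V l)" "dir V l 0 = 0" "dir' V l 0 = 1"
    by (auto simp: dir_def dir'_def dir_pair_def)
qed

lemma hill_solution_DERIV: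
  assumes "hill_solution V l y p"
  shows "(y has_real_derivative p x) (at x)" "(p has_real_derivative (V x - l) * y x) (at x)"
  using assms by (auto simp: hill_solution_def)

lemma hill_solution_continuous:
  assumes "hill_solution V l y p"
  shows "continuous_on S y" "continuous_on S p"
  by (rule DERIV_continuous_on, rule DERIV_subset[OF _ subset_UNIV],
      rule hill_solution_DERIV[OF assms])+

lemma wronskian_DERIV:
  assumes "hill_solution V l y p" "hill_solution V m z r"
  shows "((\<lambda>x. p x * z x - y x * r x) has_real_derivative (m - l) * y x * z x) (at x)"
  by (rule derivative_eq_intros hill_solution_DERIV[OF assms(1)] hill_solution_DERIV[OF assms(2)] refl)+
    (simp add: algebra_simps)

lemma wronskian_const:
  assumes "hill_solution V l y p" "hill_solution V l z r"
  shows "p x * z x - y x * r x = p 0 * z 0 - y 0 * r 0"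
proof -
  have "((\<lambda>x. p x * z x - y x * r x) has_real_derivative 0) (at t)" for t
    using wronskian_DERIV[OF assms, of t] by simp
  then show ?thesis
    using DERIV_isconst_all[of "\<lambda>x. p x * z x - y x * r x" x 0] by blast
qed

lemma neu_dir_wronskian:
  assumes "continuous_on UNIV V"
  shows "neu V l x * dir' V l x - neu' V l x * dir V l x = 1"
  using wronskian_const[OF neu(1)[OF assms, of l] dir(1)[OF assms], of x]
  by (simp add: neu(2,3)[OF assms] dir(2,3)[OF assms] algebra_simps)

lemma hill_solution_expand:
  assumes V: "continuous_on UNIV V" and y: "hill_solution V l y p"
  shows "y x = y 0 * neu V l x + p 0 * dir V l x" "p x = y 0 * neu' V l x + p 0 * dir' V l x"
proof -
  have 1: "p x * neu V l x - y x * neu' V l x = p 0"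
    using wronskian_const[OF y neu(1)[OF V], of x] by (simp add: neu(2,3)[OF V])
  have 2: "p x * dir V l x - y x * dir' V l x = - y 0"
    using wronskian_const[OF y dir(1)[OF V], of x] by (simp add: dir(2,3)[OF V])
  note 3 = neu_dir_wronskian[OF V, of l x]
  show "y x = y 0 * neu V l x + p 0 * dir V l x" "p x = y 0 * neu' V l x + p 0 * dir' V l x"
    using 1 2 3 by (auto simp: algebra_simps) (algebra+)?
qed

lemma hill_solution_slope:
  assumes "continuous_on UNIV V"
  shows "hill_solution V l (\<lambda>x. neu V l x + m * dir V l x) (\<lambda>x. neu' V l x + m * dir' V l x)"
  unfolding hill_solution_def
  by (auto intro!: derivative_eq_intros hill_solution_DERIV[OF neu(1)[OF assms]]
      hill_solution_DERIV[OF dir(1)[OF assms]] simp: algebra_simps)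

lemma hill_solution_unique:
  assumes V: "continuous_on UNIV V" and "hill_solution V l y p" "hill_solution V l z r"
    and "y x0 = z x0" "p x0 = r x0"
  shows "y x = z x" "p x = r x"
proof -
  let ?u = "\<lambda>x. y x - z x" and ?v = "\<lambda>x. p x - r x"
  have s: "hill_solution V l ?u ?v"
    unfolding hill_solution_def
    using hill_solution_DERIV[OF assms(2)] hill_solution_DERIV[OF assms(3)]
    by (auto intro!: derivative_eq_intros simp: algebra_simps)
  have "?v x0 * neu V l x0 - ?u x0 * neu' V l x0 = ?v 0"
    using wronskian_const[OF s neu(1)[OF V], of x0] by (simp add: neu(2,3)[OF V])
  moreover have "?v x0 * dir V l x0 - ?u x0 * dir' V l x0 = - ?u 0"
    using wronskian_const[OF s dir(1)[OF V], of x0] by (simp add: dir(2,3)[OF V])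
  ultimately have "?u 0 = 0" "?v 0 = 0" using assms(4,5) by auto
  then have "?u x = 0" "?v x = 0"
    using hill_solution_expand[OF V s, of x] by (metis mult_zero_left add_0)+
  then show "y x = z x" "p x = r x" by auto
qed

lemma hill_solution_flip:
  assumes "hill_solution V l y p"
  shows "hill_solution (\<lambda>x. V (h - x)) l (\<lambda>x. y (h - x)) (\<lambda>x. - p (h - x))"
proof -
  have h: "((\<lambda>x. h - x) has_real_derivative -1) (at x)" for x
    by (auto intro!: derivative_eq_intros)
  have "((\<lambda>x. y (h - x)) has_real_derivative - p (h - x)) (at x)"
    "((\<lambda>x. p (h - x)) has_real_derivative - ((V (h - x) - l) * y (h - x))) (at x)" for x
    using DERIV_chain2[where g = "\<lambda>x. h - x", OF hill_solution_DERIV(1)[OF assms] h]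
      DERIV_chain2[where g = "\<lambda>x. h - x", OF hill_solution_DERIV(2)[OF assms] h]
    by auto
  then show ?thesis
    unfolding hill_solution_def by (auto intro!: derivative_eq_intros)
qed

lemma flip_continuous:
  fixes V :: "real \<Rightarrow> real" and h :: real
  assumes "continuous_on UNIV V"
  shows "continuous_on UNIV (\<lambda>x. V (h - x))"
  by (intro continuous_on_compose2[OF assms] continuous_intros) auto

text \<open>
  Reflecting the interval \<open>[0, h]\<close> inverts the transfer matrix from \<open>0\<close> to \<open>h\<close> and reverses the
  sign of the derivatives; since its determinant is \<open>1\<close>, this swaps the two diagonal entries.
\<close>

lemma flip_transfer:
  fixes V :: "real \<Rightarrow> real" and h :: real
  assumes V: "continuous_on UNIV V"
  defines "U \<equiv> \<lambda>x. V (h - x)"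
  shows "neu U l h = dir' V l h" "neu' U l h = neu' V l h"
    "dir U l h = dir V l h" "dir' U l h = neu V l h"
proof -
  have U: "continuous_on UNIV U"
    unfolding U_def by (rule flip_continuous[OF V])
  note 1 = hill_solution_expand[OF U hill_solution_flip[OF neu(1)[OF V], of h l, folded U_def], of h]
  note 2 = hill_solution_expand[OF U hill_solution_flip[OF dir(1)[OF V], of h l, folded U_def], of h]
  note 3 = neu_dir_wronskian[OF V, of l h]
  have e: "1 = neu V l h * neu U l h - neu' V l h * dir U l h"
    "0 = neu V l h * neu' U l h - neu' V l h * dir' U l h"
    "0 = dir V l h * neu U l h - dir' V l h * dir U l h"
    "-1 = dir V l h * neu' U l h - dir' V l h * dir' U l h"
    using 1 2 by (auto simp: neu(2,3)[OF V] dir(2,3)[OF V])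
  show "neu U l h = dir' V l h" "dir U l h = dir V l h"
    using e(1,3) 3 by algebra+
  show "neu' U l h = neu' V l h" "dir' U l h = neu V l h"
    using e(2,4) 3 by algebra+
qed

text \<open>
  Dependence on the spectral parameter. The difference \<open>z\<close> of two solutions with the same initial
  data solves the equation for \<open>l\<close> with the forcing term \<open>(l0 - l) y0\<close>, so the energy
  \<open>z\<^sup>2 + z'\<^sup>2\<close> grows at most exponentially from a source of order \<open>(l - l0)\<^sup>2\<close>.
\<close>

lemma hill_solution_lipschitz:
  fixes V :: "real \<Rightarrow> real"
  assumes V: "continuous_on UNIV V" and T: "0 \<le> T"
    and y: "\<And>l. hill_solution V l (y l) (p l)" "\<And>l. y l 0 = A" "\<And>l. p l 0 = B"
  shows "\<exists>L. \<forall>l x. \<bar>l - l0\<bar> \<le> 1 \<longrightarrow> x \<in> {0..T} \<longrightarrow>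
    \<bar>y l x - y l0 x\<bar> \<le> L * \<bar>l - l0\<bar> \<and> \<bar>p l x - p l0 x\<bar> \<le> L * \<bar>l - l0\<bar>"
proof -
  obtain K where K: "\<And>x. x \<in> {0..T} \<Longrightarrow> \<bar>V x\<bar> \<le> K"
    using continuous_on_Icc_bounded[OF continuous_on_subset[OF V]] by blast
  obtain M where M: "\<And>x. x \<in> {0..T} \<Longrightarrow> \<bar>y l0 x\<bar> \<le> M"
    using continuous_on_Icc_bounded[OF hill_solution_continuous(1)[OF y(1)]] by blast
  \<comment> \<open>\<open>k - 1\<close> dominates \<open>1 + V - l\<close> whenever \<open>\<bar>l - l0\<bar> \<le> 1\<close>\<close>
  define k where "k = K + \<bar>l0\<bar> + 3"
  define L where "L = sqrt (exp (k * T) * (M\<^sup>2 * T))"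
  have "\<bar>y l x - y l0 x\<bar> \<le> L * \<bar>l - l0\<bar> \<and> \<bar>p l x - p l0 x\<bar> \<le> L * \<bar>l - l0\<bar>"
    if l: "\<bar>l - l0\<bar> \<le> 1" and x: "x \<in> {0..T}" for l x
  proof -
    define z where "z t = y l t - y l0 t" for t
    define r where "r t = p l t - p l0 t" for t
    have dz: "(z has_real_derivative r t) (at t)"
      and dr: "(r has_real_derivative (V t - l) * z t + (l0 - l) * y l0 t) (at t)" for t
      unfolding z_def[abs_def] r_def[abs_def]
      by (auto intro!: derivative_eq_intros hill_solution_DERIV[OF y(1)] simp: algebra_simps)
    define E where "E t = (z t)\<^sup>2 + (r t)\<^sup>2" for t
    define E' where "E' t = 2 * z t * r t + 2 * r t * ((V t - l) * z t + (l0 - l) * y l0 t)" for t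
    have dE: "(E has_real_derivative E' t) (at t)" for t
      unfolding E_def[abs_def] E'_def
      by (rule derivative_eq_intros dz dr refl)+ (simp add: power2_eq_square)
    have E': "E' t \<le> k * E t + (l - l0)\<^sup>2 * M\<^sup>2" if t: "t \<in> {0..T}" for t
    proof -
      have zr: "\<bar>2 * z t * r t\<bar> \<le> E t"
        unfolding E_def using sum_squares_bound[of "z t" "r t"] sum_squares_bound[of "- z t" "r t"]
        by (simp add: abs_le_iff)
      have "\<bar>1 + V t - l\<bar> \<le> k - 1"
        using K[OF t] l unfolding k_def by linarith
      then have "\<bar>2 * z t * r t\<bar> * \<bar>1 + V t - l\<bar> \<le> E t * (k - 1)"
        using zr by (intro mult_mono) (simp_all add: E_def)
      then have 1: "(2 * z t * r t) * (1 + V t - l) \<le> k * E t - E t"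
        by (simp only: abs_mult[symmetric] abs_le_iff) (simp add: algebra_simps)
      have 2: "2 * r t * ((l0 - l) * y l0 t) \<le> (r t)\<^sup>2 + ((l0 - l) * y l0 t)\<^sup>2"
        by (rule sum_squares_bound)
      have "(y l0 t)\<^sup>2 \<le> M\<^sup>2"
        using M[OF t] by (rule abs_le_square_iff[THEN iffD1, OF order_trans]) simp
      then have 3: "((l0 - l) * y l0 t)\<^sup>2 \<le> (l - l0)\<^sup>2 * M\<^sup>2"
        unfolding power_mult_distrib power2_commute[of l0 l] by (intro mult_left_mono) simp_all
      have 4: "(r t)\<^sup>2 \<le> E t" by (simp add: E_def)
      have "E' t = (2 * z t * r t) * (1 + V t - l) + 2 * r t * ((l0 - l) * y l0 t)"
        unfolding E'_def by (simp add: algebra_simps)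
      with 1 2 3 4 show ?thesis by linarith
    qed
    \<comment> \<open>the integrating factor of \<open>E' \<le> k E + (l - l0)\<^sup>2 M\<^sup>2\<close>\<close>
    define F where "F t = (l - l0)\<^sup>2 * M\<^sup>2 * t - exp (- (k * t)) * E t" for t
    have k0: "0 \<le> k"
      using K[of 0] T unfolding k_def by (simp add: abs_le_iff)
    have "F 0 \<le> F x"
    proof (rule nonneg_derivative_mono[where f = F
          and f' = "\<lambda>t. (l - l0)\<^sup>2 * M\<^sup>2 - exp (- (k * t)) * (E' t - k * E t)"])
      fix t assume t: "0 \<le> t" "t \<le> x"
      show "(F has_real_derivative (l - l0)\<^sup>2 * M\<^sup>2 - exp (- (k * t)) * (E' t - k * E t)) (at t)"
        unfolding F_def[abs_def]
        by (rule derivative_eq_intros dE refl)+ (simp add: algebra_simps)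
      have "exp (- (k * t)) * (E' t - k * E t) \<le> exp (- (k * t)) * ((l - l0)\<^sup>2 * M\<^sup>2)"
        using E'[of t] t x by (intro mult_left_mono) auto
      also have "\<dots> \<le> 1 * ((l - l0)\<^sup>2 * M\<^sup>2)"
        using k0 t by (intro mult_right_mono) auto
      finally have "exp (- (k * t)) * (E' t - k * E t) \<le> (l - l0)\<^sup>2 * M\<^sup>2" by simp
      then show "0 \<le> (l - l0)\<^sup>2 * M\<^sup>2 - exp (- (k * t)) * (E' t - k * E t)" by simp
    qed (use x in auto)
    moreover have "F 0 = 0" by (simp add: F_def E_def z_def r_def y)
    ultimately have "exp (- (k * x)) * E x \<le> (l - l0)\<^sup>2 * M\<^sup>2 * x" by (simp add: F_def)
    then have "exp (k * x) * (exp (- (k * x)) * E x) \<le> exp (k * x) * ((l - l0)\<^sup>2 * M\<^sup>2 * x)"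
      by (intro mult_left_mono) simp_all
    then have "E x \<le> exp (k * x) * ((l - l0)\<^sup>2 * M\<^sup>2 * x)"
      by (simp add: mult.assoc[symmetric] exp_minus)
    also have "\<dots> \<le> exp (k * T) * ((l - l0)\<^sup>2 * M\<^sup>2 * T)"
      using x k0 by (intro mult_mono) (auto intro!: mult_left_mono)
    also have "\<dots> = exp (k * T) * (M\<^sup>2 * T) * (l - l0)\<^sup>2"
      by (simp only: ac_simps)
    finally have "sqrt (E x) \<le> sqrt (exp (k * T) * (M\<^sup>2 * T) * (l - l0)\<^sup>2)"
      by (rule real_sqrt_le_mono)
    also have "\<dots> = L * \<bar>l - l0\<bar>"
      by (simp add: L_def real_sqrt_mult)
    finally have "sqrt (E x) \<le> L * \<bar>l - l0\<bar>" .
    moreover have "\<bar>z x\<bar> \<le> sqrt (E x)" "\<bar>r x\<bar> \<le> sqrt (E x)"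
      unfolding E_def by (simp_all add: real_le_rsqrt)
    ultimately show ?thesis unfolding z_def r_def by auto
  qed
  then show ?thesis by blast
qed

lemma lipschitz_imp_isCont:
  fixes f :: "real \<Rightarrow> real"
  assumes "\<And>l. \<bar>l - l0\<bar> \<le> 1 \<Longrightarrow> \<bar>f l - f l0\<bar> \<le> L * \<bar>l - l0\<bar>"
  shows "isCont f l0"
proof -
  have "((\<lambda>l. f l - f l0) \<longlongrightarrow> 0) (at l0)"
  proof (rule Lim_null_comparison)
    show "\<forall>\<^sub>F l in at l0. norm (f l - f l0) \<le> L * \<bar>l - l0\<bar>"
      unfolding eventually_at by (rule exI[of _ 1]) (use assms in \<open>auto simp: dist_real_def\<close>)
    have "((\<lambda>l. L * \<bar>l - l0\<bar>) \<longlongrightarrow> L * \<bar>l0 - l0\<bar>) (at l0)"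
      by (intro tendsto_intros)
    then show "((\<lambda>l. L * \<bar>l - l0\<bar>) \<longlongrightarrow> 0) (at l0)" by simp
  qed
  then show ?thesis
    unfolding isCont_def using LIM_zero_cancel by blast
qed

lemma isCont_in_parameter:
  assumes V: "continuous_on UNIV V" and x: "0 \<le> x"
  shows "isCont (\<lambda>l. neu V l x) l0" "isCont (\<lambda>l. neu' V l x) l0"
    "isCont (\<lambda>l. dir V l x) l0" "isCont (\<lambda>l. dir' V l x) l0"
proof -
  obtain L1 where "\<And>l. \<bar>l - l0\<bar> \<le> 1 \<Longrightarrow> \<bar>neu V l x - neu V l0 x\<bar> \<le> L1 * \<bar>l - l0\<bar>"
    "\<And>l. \<bar>l - l0\<bar> \<le> 1 \<Longrightarrow> \<bar>neu' V l x - neu' V l0 x\<bar> \<le> L1 * \<bar>l - l0\<bar>"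
    using hill_solution_lipschitz[where y = "neu V" and p = "neu' V", OF V x neu[OF V], of l0] x
    by (metis atLeastAtMost_iff order_refl)
  then show "isCont (\<lambda>l. neu V l x) l0" "isCont (\<lambda>l. neu' V l x) l0"
    by (auto intro!: lipschitz_imp_isCont)
  obtain L2 where "\<And>l. \<bar>l - l0\<bar> \<le> 1 \<Longrightarrow> \<bar>dir V l x - dir V l0 x\<bar> \<le> L2 * \<bar>l - l0\<bar>"
    "\<And>l. \<bar>l - l0\<bar> \<le> 1 \<Longrightarrow> \<bar>dir' V l x - dir' V l0 x\<bar> \<le> L2 * \<bar>l - l0\<bar>"
    using hill_solution_lipschitz[where y = "dir V" and p = "dir' V", OF V x dir[OF V], of l0] x
    by (metis atLeastAtMost_iff order_refl)
  then show "isCont (\<lambda>l. dir V l x) l0" "isCont (\<lambda>l. dir' V l x) l0"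
    by (auto intro!: lipschitz_imp_isCont)
qed

section \<open>Sturm comparison on a half period\<close>

lemma first_zero:
  fixes f :: "real \<Rightarrow> real"
  assumes f: "continuous_on {0..h} f" and "0 < f 0" and x: "x \<in> {0..h}" "f x \<le> 0"
  obtains z where "0 < z" "z \<le> h" "f z = 0" "\<And>t. 0 \<le> t \<Longrightarrow> t < z \<Longrightarrow> 0 < f t"
proof -
  define Z where "Z = {t \<in> {0..h}. f t \<le> 0}"
  have "closed Z"
    unfolding Z_def by (intro continuous_on_closed_Collect_le f continuous_intros)
  moreover have "Z \<noteq> {}" and bdd: "bdd_below Z"
    using x unfolding Z_def by (auto intro: bdd_belowI[of _ 0])
  ultimately have z: "Inf Z \<in> Z"
    by (intro closed_contains_Inf)
  have least: "Inf Z \<le> t" if "t \<in> Z" for t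
    using cInf_lower[OF that bdd] .
  have zh: "0 \<le> Inf Z" "Inf Z \<le> h" "f (Inf Z) \<le> 0"
    using z by (simp_all add: Z_def)
  have "continuous_on {0..Inf Z} f"
    by (rule continuous_on_subset[OF f]) (use zh in auto)
  from IVT2'[of f "Inf Z" 0 0, OF zh(3) _ zh(1) this] \<open>0 < f 0\<close>
  obtain t where t: "0 \<le> t" "t \<le> Inf Z" "f t = 0" by auto
  then have "t \<in> Z" using zh by (simp add: Z_def)
  with least t have f0: "f (Inf Z) = 0" by force
  then have "Inf Z \<noteq> 0" using \<open>0 < f 0\<close> by auto
  moreover have "0 < f t" if "0 \<le> t" "t < Inf Z" for t
    using least[of t] that zh unfolding Z_def by force
  ultimately show ?thesis
    using that[of "Inf Z"] zh f0 by simp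
qed

lemma nonneg_at_right_end:
  fixes f :: "real \<Rightarrow> real"
  assumes "continuous_on {0..h} f" "0 < h" "\<And>t. 0 \<le> t \<Longrightarrow> t < h \<Longrightarrow> 0 < f t"
  shows "0 \<le> f h"
  by (rule continuous_ge_on_Ioo[of 0 h f 0 h]) (use assms in \<open>auto intro: less_imp_le\<close>)

lemma hill_solution_derivative_neg_at_zero:
  assumes V: "continuous_on UNIV V" and y: "hill_solution V l y p"
    and z: "0 < z" "y z = 0" "\<And>t. 0 \<le> t \<Longrightarrow> t < z \<Longrightarrow> 0 < y t"
  shows "p z < 0"
proof (rule ccontr)
  assume "\<not> p z < 0"
  moreover have "p z \<noteq> 0"
  proof
    assume "p z = 0"
    moreover have "hill_solution V l (\<lambda>_. 0) (\<lambda>_. 0)"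
      by (simp add: hill_solution_def)
    ultimately have "y 0 = 0"
      using hill_solution_unique(1)[OF V y, of "\<lambda>_. 0" "\<lambda>_. 0" z 0] z(2) by simp
    with z(3)[of 0] z(1) show False by simp
  qed
  ultimately have "0 < p z" by simp
  from DERIV_pos_inc_left[OF hill_solution_DERIV(1)[OF y] this]
  obtain d where d: "0 < d" "\<And>k. 0 < k \<Longrightarrow> k < d \<Longrightarrow> y (z - k) < y z" by auto
  have "y (z - min (d / 2) (z / 2)) < y z"
    using d(1) z(1) by (intro d(2)) (auto simp: min_def)
  moreover have "0 < y (z - min (d / 2) (z / 2))"
    using d(1) z(1) by (intro z(3)) (auto simp: min_def)
  ultimately show False using z(2) by simp
qed

lemma neu_first_zero:
  assumes V: "continuous_on UNIV V" and x: "x \<in> {0..h}" "neu V l x \<le> 0"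
  obtains z where "0 < z" "z \<le> h" "neu V l z = 0" "\<And>t. 0 \<le> t \<Longrightarrow> t < z \<Longrightarrow> 0 < neu V l t"
    "neu' V l z < 0"
proof -
  from first_zero[OF hill_solution_continuous(1)[OF neu(1)[OF V]] _ x] neu(2)[OF V]
  obtain z where z: "0 < z" "z \<le> h" "neu V l z = 0" "\<And>t. 0 \<le> t \<Longrightarrow> t < z \<Longrightarrow> 0 < neu V l t"
    by auto
  show thesis
    by (rule that[OF z hill_solution_derivative_neg_at_zero[OF V neu(1)[OF V] z(1,3,4)]])
qed

text \<open>
  Sturm comparison in its integrated form: as long as both solutions are positive, proportional
  data at \<open>0\<close> lead to the larger logarithmic derivative at \<open>h\<close> for the smaller spectral parameter.
\<close>

lemma wronskian_pos:
  assumes "hill_solution V l y p" "hill_solution V m z r" "l < m" "0 < h"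
    and "p 0 * z 0 = y 0 * r 0"
    and "\<And>t. 0 < t \<Longrightarrow> t < h \<Longrightarrow> 0 < y t" "\<And>t. 0 < t \<Longrightarrow> t < h \<Longrightarrow> 0 < z t"
  shows "y h * r h < p h * z h"
proof -
  have "p 0 * z 0 - y 0 * r 0 < p h * z h - y h * r h"
  proof (rule DERIV_pos_imp_increasing_open[OF \<open>0 < h\<close>])
    fix t assume t: "0 < t" "t < h"
    have "0 < (m - l) * y t * z t"
      using assms(3) assms(6,7)[OF t] by simp
    then show "\<exists>w. ((\<lambda>x. p x * z x - y x * r x) has_real_derivative w) (at t) \<and> 0 < w"
      using wronskian_DERIV[OF assms(1,2)] by blast
  next
    show "continuous_on {0..h} (\<lambda>x. p x * z x - y x * r x)"
      by (intro continuous_intros hill_solution_continuous[OF assms(1)]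
          hill_solution_continuous[OF assms(2)])
  qed
  then show ?thesis using assms(5) by simp
qed

lemma neu_pos_of_less:
  assumes V: "continuous_on UNIV V" and "l < m" "0 < h"
    and pos: "\<And>t. 0 \<le> t \<Longrightarrow> t < h \<Longrightarrow> 0 < neu V m t"
    and x: "x \<in> {0..h}"
  shows "0 < neu V l x"
proof (rule ccontr)
  assume "\<not> 0 < neu V l x"
  then have "neu V l x \<le> 0" by simp
  from neu_first_zero[OF V x this]
  obtain z where z: "0 < z" "z \<le> h" "neu V l z = 0" "\<And>t. 0 \<le> t \<Longrightarrow> t < z \<Longrightarrow> 0 < neu V l t"
    "neu' V l z < 0" by blast
  have "neu V l z * neu' V m z < neu' V l z * neu V m z"
    by (rule wronskian_pos[OF neu(1)[OF V] neu(1)[OF V] \<open>l < m\<close> z(1)])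
      (use neu(2,3)[OF V] z(2) in \<open>auto intro: z(4) pos\<close>)
  moreover note z(5)
  moreover have "0 \<le> neu V m z"
    using nonneg_at_right_end[OF hill_solution_continuous(1)[OF neu(1)[OF V, of m]] z(1)] pos z(2)
    by force
  ultimately show False using z(3) by (simp add: mult_nonpos_nonneg leD)
qed

text \<open>
  Reduction of order: \<open>(dir / neu)' = 1 / neu\<^sup>2\<close>.
\<close>

lemma dir_pos_of_neu_pos:
  assumes V: "continuous_on UNIV V" and "0 < x"
    and pos: "\<And>t. 0 \<le> t \<Longrightarrow> t < x \<Longrightarrow> 0 < neu V l t"
  shows "0 < dir V l x"
proof (cases "0 < neu V l x")
  case True
  have pos': "0 < neu V l t" if "0 \<le> t" "t \<le> x" for t
    using pos[of t] True that by (cases "t = x") auto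
  have "dir V l 0 / neu V l 0 < dir V l x / neu V l x"
  proof (rule DERIV_pos_imp_increasing_open[OF \<open>0 < x\<close>])
    fix t assume t: "0 < t" "t < x"
    have "((\<lambda>x. dir V l x / neu V l x) has_real_derivative
        (dir' V l t * neu V l t - dir V l t * neu' V l t) / (neu V l t * neu V l t)) (at t)"
      using pos'[of t] t
      by (intro DERIV_divide hill_solution_DERIV(1)[OF dir(1)[OF V]]
          hill_solution_DERIV(1)[OF neu(1)[OF V]]) auto
    moreover have "dir' V l t * neu V l t - dir V l t * neu' V l t = 1"
      using neu_dir_wronskian[OF V, of l t] by (simp add: algebra_simps)
    ultimately show "\<exists>w. ((\<lambda>x. dir V l x / neu V l x) has_real_derivative w) (at t) \<and> 0 < w"
      using pos'[of t] t by (intro exI[of _ "1 / (neu V l t * neu V l t)"]) simp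
  next
    show "continuous_on {0..x} (\<lambda>x. dir V l x / neu V l x)"
      using pos' by (intro continuous_intros hill_solution_continuous[OF dir(1)[OF V]]
          hill_solution_continuous[OF neu(1)[OF V]]) force
  qed
  then show ?thesis using True by (simp add: dir(2)[OF V] zero_less_divide_iff)
next
  case False
  then have z: "neu V l x = 0"
    using nonneg_at_right_end[OF hill_solution_continuous(1)[OF neu(1)[OF V, of l]] \<open>0 < x\<close> pos]
    by simp
  have "neu' V l x < 0"
    by (rule hill_solution_derivative_neg_at_zero[OF V neu(1)[OF V] \<open>0 < x\<close> z pos])
  moreover have "neu' V l x * dir V l x = - 1"
    using neu_dir_wronskian[OF V, of l x] z by simp
  ultimately show ?thesis
    by (metis less_eq_real_def linorder_not_less mult_nonpos_nonpos neg_0_le_iff_le not_one_le_zero)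
qed

text \<open>
  The lowest eigenvalues on \<open>[0, h]\<close> with a Neumann condition at \<open>0\<close> and a Dirichlet, respectively
  Neumann, condition at \<open>h\<close>, characterized by the positivity of the ground state.
\<close>

definition lowest_ND :: "(real \<Rightarrow> real) \<Rightarrow> real \<Rightarrow> real \<Rightarrow> bool" where
  "lowest_ND V h a \<longleftrightarrow> (\<forall>x. 0 \<le> x \<longrightarrow> x < h \<longrightarrow> 0 < neu V a x) \<and> neu V a h = 0"

definition lowest_NN :: "(real \<Rightarrow> real) \<Rightarrow> real \<Rightarrow> real \<Rightarrow> bool" where
  "lowest_NN V h c \<longleftrightarrow> (\<forall>x\<in>{0..h}. 0 < neu V c x) \<and> neu' V c h = 0"

lemma neu_pos_below_potential:
  assumes V: "continuous_on UNIV V" and low: "\<And>t. t \<in> {0..h} \<Longrightarrow> l \<le> V t" and x: "x \<in> {0..h}"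
  shows "0 < neu V l x" "0 \<le> neu' V l x"
proof -
  have up: "0 \<le> neu' V l z" if "z \<in> {0..h}" "\<And>t. 0 \<le> t \<Longrightarrow> t < z \<Longrightarrow> 0 < neu V l t" for z
  proof -
    have "neu' V l 0 \<le> neu' V l z"
    proof (rule DERIV_nonneg_imp_increasing_open[where f = "neu' V l"])
      fix t assume t: "0 < t" "t < z"
      have "0 \<le> (V t - l) * neu V l t"
        using low[of t] that(2)[of t] that(1) t by simp
      then show "\<exists>w. (neu' V l has_real_derivative w) (at t) \<and> 0 \<le> w"
        using hill_solution_DERIV(2)[OF neu(1)[OF V]] by blast
    qed (use that hill_solution_continuous[OF neu(1)[OF V]] in auto)
    then show ?thesis by (simp add: neu(3)[OF V])
  qed
  have pos: "0 < neu V l x" if x: "x \<in> {0..h}" for x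
  proof (rule ccontr)
    assume "\<not> 0 < neu V l x"
    then have "neu V l x \<le> 0" by simp
    from neu_first_zero[OF V x this]
    obtain z where z: "0 < z" "z \<le> h" "neu V l z = 0" "\<And>t. 0 \<le> t \<Longrightarrow> t < z \<Longrightarrow> 0 < neu V l t"
      "neu' V l z < 0" by blast
    have "0 \<le> neu' V l z" using z(1,2,4) by (intro up) auto
    with z(5) show False by simp
  qed
  show "0 < neu V l x" using pos[OF x] .
  show "0 \<le> neu' V l x" using x by (intro up) (auto intro: pos)
qed

text \<open>
  Comparison with \<open>cos (\<pi> x / (2 h))\<close>, which vanishes at \<open>h\<close>.
\<close>

lemma neu_not_pos_above_potential:
  assumes V: "continuous_on UNIV V" and "0 < h"
    and up: "\<And>t. t \<in> {0..h} \<Longrightarrow> V t + (pi / (2 * h))\<^sup>2 \<le> l"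
  shows "\<exists>x\<in>{0..h}. neu V l x \<le> 0"
proof (rule ccontr)
  assume "\<not> ?thesis"
  then have pos: "0 < neu V l x" if "x \<in> {0..h}" for x using that by force
  define k where "k = pi / (2 * h)"
  have k: "0 < k" "k * h = pi / 2" using \<open>0 < h\<close> by (simp_all add: k_def)
  define W where "W x = - (neu' V l x * cos (k * x) + neu V l x * (k * sin (k * x)))" for x
  have "W 0 \<le> W h"
  proof (rule nonneg_derivative_mono[where f = W and f' = "\<lambda>x. - ((V x - l + k\<^sup>2) * neu V l x * cos (k * x))"])
    fix t assume t: "0 \<le> t" "t \<le> h"
    show "(W has_real_derivative - ((V t - l + k\<^sup>2) * neu V l t * cos (k * t))) (at t)"
      unfolding W_def[abs_def]
      by (rule derivative_eq_intros hill_solution_DERIV[OF neu(1)[OF V]] refl)+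
        (simp add: algebra_simps power2_eq_square)
    have "k * t \<le> k * h" using t k by (intro mult_left_mono) auto
    then have "0 \<le> cos (k * t)"
      using t k by (intro cos_ge_zero) (auto intro: order_trans[of _ 0])
    moreover have "V t - l + k\<^sup>2 \<le> 0" using up[of t] t by (simp add: k_def)
    ultimately show "0 \<le> - ((V t - l + k\<^sup>2) * neu V l t * cos (k * t))"
      using pos[of t] t by (simp add: mult_nonpos_nonneg)
  qed (use \<open>0 < h\<close> in simp)
  then have "neu V l h * k \<le> 0"
    by (simp add: W_def neu(3)[OF V] k(2))
  moreover have "0 < neu V l h * k"
    using pos[of h] \<open>0 < h\<close> k(1) by simp
  ultimately show False by simp
qed

text \<open>
  The eigenvalue is the supremum of all \<open>l\<close> for which \<open>neu V l\<close> is positive on \<open>[0, h]\<close>. At the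
  supremum \<open>neu\<close> is still nonnegative, but it cannot be positive on all of \<open>[0, h]\<close>, because
  positivity on a compact interval survives a small increase of \<open>l\<close>. Its zeros are simple, so the
  only place left for one is \<open>h\<close>.
\<close>

lemma lowest_ND_exists:
  assumes V: "continuous_on UNIV V" and h: "0 < h"
  shows "\<exists>a. lowest_ND V h a"
proof -
  obtain K where K: "\<And>x. x \<in> {0..h} \<Longrightarrow> \<bar>V x\<bar> \<le> K"
    using continuous_on_Icc_bounded[OF continuous_on_subset[OF V]] by blast
  define S where "S = {l. \<forall>x\<in>{0..h}. 0 < neu V l x}"
  have "- K \<le> V t" if "t \<in> {0..h}" for t using K[OF that] by simp
  then have ne: "S \<noteq> {}"
    using neu_pos_below_potential(1)[OF V, of h "- K"] unfolding S_def by blast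
  have bdd: "bdd_above S"
  proof (rule bdd_aboveI)
    fix l assume "l \<in> S"
    show "l \<le> K + (pi / (2 * h))\<^sup>2"
    proof (rule ccontr)
      assume l: "\<not> l \<le> K + (pi / (2 * h))\<^sup>2"
      have "V t + (pi / (2 * h))\<^sup>2 \<le> l" if "t \<in> {0..h}" for t using K[OF that] l by simp
      from neu_not_pos_above_potential[OF V h this] \<open>l \<in> S\<close> show False
        unfolding S_def by force
    qed
  qed
  define a where "a = Sup S"
  have below: "0 < neu V l x" if "l < a" "x \<in> {0..h}" for l x
  proof -
    obtain m where "m \<in> S" "l < m"
      using less_cSupD[OF ne] \<open>l < a\<close> unfolding a_def by blast
    then show ?thesis
      using neu_pos_of_less[OF V \<open>l < m\<close> h] that(2) unfolding S_def by simp
  qed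
  have nonneg: "0 \<le> neu V a x" if x: "x \<in> {0..h}" for x
  proof (rule tendsto_lowerbound)
    show "((\<lambda>l. neu V l x) \<longlongrightarrow> neu V a x) (at_left a)"
      using isCont_in_parameter(1)[OF V, of x a] x
      by (auto simp: isCont_def intro: tendsto_within_subset)
    show "\<forall>\<^sub>F l in at_left a. 0 \<le> neu V l x"
      unfolding eventually_at_left_field
      by (rule exI[of _ "a - 1"]) (use below x in \<open>auto intro: less_imp_le\<close>)
  qed simp
  have "\<exists>x\<in>{0..h}. neu V a x \<le> 0"
  proof (rule ccontr)
    assume "\<not> ?thesis"
    then have pos: "0 < neu V a x" if "x \<in> {0..h}" for x using that by force
    obtain x0 where x0: "x0 \<in> {0..h}" "\<And>x. x \<in> {0..h} \<Longrightarrow> neu V a x0 \<le> neu V a x"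
      using continuous_attains_inf[of "{0..h}" "neu V a"] hill_solution_continuous(1)[OF neu(1)[OF V]] h
      by auto
    obtain L where L: "\<And>l x. \<bar>l - a\<bar> \<le> 1 \<Longrightarrow> x \<in> {0..h} \<Longrightarrow> \<bar>neu V l x - neu V a x\<bar> \<le> L * \<bar>l - a\<bar>"
      using hill_solution_lipschitz[where y = "neu V" and p = "neu' V" and ?l0.0 = a and T = h,
          OF V less_imp_le[OF h] neu[OF V]] by blast
    define e where "e = min 1 (neu V a x0 / (2 * (\<bar>L\<bar> + 1)))"
    have e: "0 < e" "e \<le> 1" "e \<le> neu V a x0 / (2 * (\<bar>L\<bar> + 1))"
      using pos[OF x0(1)] by (auto simp: e_def)
    have "0 < neu V (a + e) x" if x: "x \<in> {0..h}" for x
    proof -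
      have "\<bar>neu V (a + e) x - neu V a x\<bar> \<le> L * e"
        using L[of "a + e" x] e x by simp
      also have "\<dots> \<le> (\<bar>L\<bar> + 1) * e"
        using e(1) by (intro mult_right_mono) auto
      also have "\<dots> \<le> (\<bar>L\<bar> + 1) * (neu V a x0 / (2 * (\<bar>L\<bar> + 1)))"
        using e(3) by (intro mult_left_mono) auto
      also have "\<dots> = neu V a x0 / 2"
      proof -
        have "\<bar>L\<bar> + 1 \<noteq> 0" using abs_ge_zero[of L] by linarith
        then show ?thesis by (simp add: field_simps)
      qed
      finally show ?thesis using x0(2)[OF x] pos[OF x0(1)] by linarith
    qed
    then have "a + e \<in> S" by (simp add: S_def)
    then have "a + e \<le> a" unfolding a_def by (intro cSup_upper bdd)
    with e(1) show False by simp
  qed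
  then obtain x where x: "x \<in> {0..h}" "neu V a x \<le> 0" by blast
  from neu_first_zero[OF V x]
  obtain z where z: "0 < z" "z \<le> h" "neu V a z = 0" "\<And>t. 0 \<le> t \<Longrightarrow> t < z \<Longrightarrow> 0 < neu V a t"
    "neu' V a z < 0" by blast
  have "z = h"
  proof (rule ccontr)
    assume "z \<noteq> h"
    from DERIV_neg_dec_right[OF hill_solution_DERIV(1)[OF neu(1)[OF V]] z(5)]
    obtain k where k: "0 < k" "\<And>u. 0 < u \<Longrightarrow> u < k \<Longrightarrow> neu V a (z + u) < neu V a z" by auto
    have "neu V a (z + min (k / 2) (h - z)) < neu V a z"
      using k(1) z(2) \<open>z \<noteq> h\<close> by (intro k(2)) (auto simp: min_def)
    moreover have "0 \<le> neu V a (z + min (k / 2) (h - z))"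
      using k(1) z(1,2) by (intro nonneg) (auto simp: min_def)
    ultimately show False using z(3) by simp
  qed
  then show ?thesis
    using z unfolding lowest_ND_def by blast
qed

lemma neu_pos_below_ND:
  assumes "continuous_on UNIV V" "0 < h" "lowest_ND V h a" "l < a" "x \<in> {0..h}"
  shows "0 < neu V l x"
  using neu_pos_of_less[OF assms(1,4,2) _ assms(5)] assms(3) by (simp add: lowest_ND_def)

lemma ND_derivative_neg:
  assumes "continuous_on UNIV V" "0 < h" "lowest_ND V h a"
  shows "neu' V a h < 0"
  using hill_solution_derivative_neg_at_zero[OF assms(1) neu(1)[OF assms(1)] assms(2)] assms(3)
  by (simp add: lowest_ND_def)

text \<open>
  Intermediate values: \<open>neu'\<close> at \<open>h\<close> is nonnegative for \<open>l\<close> below the potential and negative at \<open>a\<close>.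
\<close>

lemma lowest_NN_exists:
  assumes V: "continuous_on UNIV V" and h: "0 < h" and a: "lowest_ND V h a"
  shows "\<exists>c<a. lowest_NN V h c"
proof -
  obtain K where K: "\<And>x. x \<in> {0..h} \<Longrightarrow> \<bar>V x\<bar> \<le> K"
    using continuous_on_Icc_bounded[OF continuous_on_subset[OF V]] by blast
  have "- K \<le> V t" if "t \<in> {0..h}" for t using K[OF that] by simp
  note low = neu_pos_below_potential[OF V this, of h h]
  have low1: "0 < neu V (- K) h" and low2: "0 \<le> neu' V (- K) h" using low h by auto
  have "- K \<le> a"
  proof (rule ccontr)
    assume "\<not> - K \<le> a"
    then have "0 < neu V a h"
      using neu_pos_of_less[OF V, of a "- K" h h] neu_pos_below_potential(1)[OF V, of h "- K"] K h
      by (force simp: abs_le_iff)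
    then show False using a by (simp add: lowest_ND_def)
  qed
  moreover have "continuous_on {- K..a} (\<lambda>l. neu' V l h)"
    using isCont_in_parameter(2)[OF V, of h] h by (intro continuous_at_imp_continuous_on) auto
  ultimately obtain c where c: "- K \<le> c" "c \<le> a" "neu' V c h = 0"
    using IVT2'[of "\<lambda>l. neu' V l h" a 0 "- K"] low2 ND_derivative_neg[OF V h a] by auto
  have "c \<noteq> a" using c(3) ND_derivative_neg[OF V h a] by auto
  with c have "c < a" by simp
  then show ?thesis
    using neu_pos_below_ND[OF V h a] c(3) by (auto simp: lowest_NN_def)
qed

text \<open>
  Positivity of \<open>neu\<close> gives that of \<open>dir\<close> by reduction of order; the sign of the last entry of the
  transfer matrix then follows from its determinant.
\<close>

lemma transfer_signs_up_to_NN: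
  assumes V: "continuous_on UNIV V" and h: "0 < h" and c: "lowest_NN V h c" and l: "l \<le> c"
  shows "0 < neu V l h" "0 \<le> neu' V l h" "0 < dir V l h" "0 < dir' V l h"
    and "l < c \<Longrightarrow> 0 < neu' V l h"
proof -
  have pos: "0 < neu V l x" if "x \<in> {0..h}" for x
    using neu_pos_of_less[OF V _ h, of l c x] c l that
    by (cases "l = c") (auto simp: lowest_NN_def)
  show 1: "0 < neu V l h" using pos h by simp
  show "0 < neu' V l h" if "l < c"
  proof -
    have "neu V l h * neu' V c h < neu' V l h * neu V c h"
      by (rule wronskian_pos[OF neu(1)[OF V] neu(1)[OF V] that h])
        (use neu(2,3)[OF V] c pos in \<open>auto simp: lowest_NN_def\<close>)
    moreover have "0 < neu V c h" "neu' V c h = 0" using c h by (auto simp: lowest_NN_def)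
    ultimately have "0 < neu' V l h * neu V c h" by simp
    with \<open>0 < neu V c h\<close> show ?thesis by (rule zero_less_mult_pos2[rotated])
  qed
  then show 2: "0 \<le> neu' V l h"
    using l c by (cases "l = c") (auto simp: lowest_NN_def)
  show 3: "0 < dir V l h"
    using pos h by (intro dir_pos_of_neu_pos[OF V]) auto
  have "neu V l h * dir' V l h = 1 + neu' V l h * dir V l h"
    using neu_dir_wronskian[OF V, of l h] by simp
  then have "0 < neu V l h * dir' V l h"
    using 2 3 by (simp add: add_pos_nonneg)
  then show "0 < dir' V l h" using 1 by (simp add: zero_less_mult_iff)
qed

text \<open>
  Between the two mixed eigenvalues: with \<open>\<chi> (x) = neu V~ l (h - x)\<close>, where \<open>V~\<close> is the reflected
  potential, \<open>neu V l / \<chi>\<close> is monotone since the Wronskian is constant. So \<open>neu V l\<close> can only be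
  nonnegative at \<open>h\<close> if it is positive before \<open>h\<close>, which is excluded for \<open>l > a\<close>.
\<close>

lemma neu_neg_between:
  assumes V: "continuous_on UNIV V" and h: "0 < h"
    and a: "lowest_ND V h a" and b: "lowest_ND (\<lambda>x. V (h - x)) h b"
    and l: "a < l" "l \<le> b"
  shows "neu V l h < 0"
proof (rule ccontr)
  assume "\<not> neu V l h < 0"
  then have nh: "0 \<le> neu V l h" by simp
  define U where "U = (\<lambda>x. V (h - x))"
  have U: "continuous_on UNIV U"
    unfolding U_def by (rule flip_continuous[OF V])
  have UV: "(\<lambda>x. U (h - x)) = V" by (simp add: U_def)
  define x where "x t = neu U l (h - t)" for t
  define x' where "x' t = - neu' U l (h - t)" for t
  have X: "hill_solution V l x x'"
    using hill_solution_flip[OF neu(1)[OF U], of h l] unfolding UV x_def x'_def .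
  have posx: "0 < x t" if "0 < t" "t \<le> h" for t
  proof (cases "l = b")
    case True
    then show ?thesis
      using b that unfolding x_def lowest_ND_def U_def[symmetric] by simp
  next
    case False
    then show ?thesis
      using neu_pos_below_ND[OF U h b[folded U_def], of l "h - t"] l that unfolding x_def by simp
  qed
  define w where "w = neu' V l h"
  have W: "neu' V l t * x t - neu V l t * x' t = w" for t
  proof -
    have "neu' V l t * x t - neu V l t * x' t = neu' V l h * x h - neu V l h * x' h"
      using wronskian_const[OF neu(1)[OF V] X, of t] wronskian_const[OF neu(1)[OF V] X, of h] by simp
    then show ?thesis by (simp add: w_def x_def x'_def neu(2,3)[OF U])
  qed
  have D: "((\<lambda>t. neu V l t / x t) has_real_derivative w / (x t * x t)) (at t)" if "0 < t" "t \<le> h" for t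
  proof -
    have "((\<lambda>t. neu V l t / x t) has_real_derivative
        (neu' V l t * x t - neu V l t * x' t) / (x t * x t)) (at t)"
      using posx[OF that]
      by (intro DERIV_divide hill_solution_DERIV(1)[OF X] hill_solution_DERIV(1)[OF neu(1)[OF V]]) simp
    then show ?thesis by (simp only: W)
  qed
  have pos: "0 < neu V l t" if t: "0 \<le> t" "t < h" for t
  proof (rule ccontr)
    assume neg: "\<not> 0 < neu V l t"
    then have t1: "neu V l t \<le> 0" by simp
    have t2: "t \<in> {0..h}" using t by simp
    from neu_first_zero[OF V t2 t1]
    obtain z where z: "0 < z" "z \<le> h" "neu V l z = 0" "\<And>s. 0 \<le> s \<Longrightarrow> s < z \<Longrightarrow> 0 < neu V l s"
      "neu' V l z < 0" by blast
    have zh: "z < h" using z(4)[of t] neg t by linarith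
    have "neu' V l z * x z < 0" using posx[of z] z(1,5) zh by (intro mult_neg_pos) auto
    then have "w < 0" using W[of z] z(3) by simp
    have "neu V l h / x h < neu V l z / x z"
    proof (rule DERIV_neg_imp_decreasing[OF zh])
      fix s assume "z \<le> s" "s \<le> h"
      then have "0 < s" "s \<le> h" using z(1) by auto
      with D[OF this] posx[OF this] \<open>w < 0\<close>
      show "\<exists>u. ((\<lambda>t. neu V l t / x t) has_real_derivative u) (at s) \<and> u < 0"
        by (intro exI[of _ "w / (x s * x s)"]) (simp add: divide_neg_pos)
    qed
    then have "neu V l h / x h < 0" by (simp add: z(3))
    then show False using posx[of h] h nh by (simp add: divide_less_0_iff)
  qed
  have "0 < neu V a h"
    using neu_pos_of_less[OF V l(1) h pos] h by simp
  then show False using a by (simp add: lowest_ND_def)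
qed

lemma transfer_signs_between:
  assumes V: "continuous_on UNIV V" and h: "0 < h"
    and a: "lowest_ND V h a" and b: "lowest_ND (\<lambda>x. V (h - x)) h b"
    and l: "a < l" "l \<le> b"
  shows "neu V l h < 0" "neu' V l h < 0" "0 < dir V l h" "0 \<le> dir' V l h"
    and "l < b \<Longrightarrow> 0 < dir' V l h"
proof -
  define U where "U = (\<lambda>x. V (h - x))"
  have U: "continuous_on UNIV U"
    unfolding U_def by (rule flip_continuous[OF V])
  have posU: "0 < neu U l t" if "0 \<le> t" "t < h" for t
    using neu_pos_below_ND[OF U h b[folded U_def], of l t] b l that
    by (cases "l = b") (auto simp: U_def[symmetric] lowest_ND_def)
  show 1: "neu V l h < 0" by (rule neu_neg_between[OF assms])
  have "0 < dir U l h" by (rule dir_pos_of_neu_pos[OF U h posU])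
  then show 2: "0 < dir V l h" by (simp add: flip_transfer[OF V] U_def)
  have "0 \<le> neu U l h"
    using nonneg_at_right_end[OF hill_solution_continuous(1)[OF neu(1)[OF U]] h posU] .
  then show 3: "0 \<le> dir' V l h" by (simp add: flip_transfer[OF V] U_def)
  show "0 < dir' V l h" if "l < b"
    using neu_pos_below_ND[OF U h b[folded U_def] that, of h] h by (simp add: flip_transfer[OF V] U_def)
  have "neu' V l h * dir V l h = neu V l h * dir' V l h - 1"
    using neu_dir_wronskian[OF V, of l h] by simp
  also have "\<dots> < 0" using 1 3 by (smt (verit) mult_nonpos_nonneg)
  finally show "neu' V l h < 0" using 2 by (simp add: mult_less_0_iff)
qed

lemma dir'_pos_below:
  assumes V: "continuous_on UNIV V" and h: "0 < h"
    and b: "lowest_ND (\<lambda>x. V (h - x)) h b" and l: "l < b"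
  shows "0 < dir' V l h"
proof -
  have U: "continuous_on UNIV (\<lambda>x. V (h - x))"
    by (rule flip_continuous[OF V])
  show ?thesis
    using neu_pos_below_ND[OF U h b l, of h] h by (simp add: flip_transfer[OF V])
qed

text \<open>
  The Herglotz property of the two boundary quotients \<open>- neu / dir\<close> and \<open>- neu' / dir'\<close> at \<open>h\<close>:
  they are the logarithmic derivatives at \<open>0\<close> of the solutions with a Dirichlet, respectively
  Neumann, condition at \<open>h\<close>, so the Sturm comparison for the reflected potential applies.
\<close>

lemma boundary_quotients_decreasing:
  assumes V: "continuous_on UNIV V" and h: "0 < h"
    and b: "lowest_ND (\<lambda>x. V (h - x)) h b" and lm: "l < m" "m < b"
  shows "neu V m h * dir V l h < neu V l h * dir V m h"
    and "neu' V m h * dir' V l h < neu' V l h * dir' V m h"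
proof -
  define U where "U = (\<lambda>x. V (h - x))"
  have U: "continuous_on UNIV U"
    unfolding U_def by (rule flip_continuous[OF V])
  note fl = flip_transfer[OF V, of h, folded U_def]
  have pos: "0 < neu U k t" if "k < b" "0 \<le> t" "t \<le> h" for k t
    using neu_pos_below_ND[OF U h b[folded U_def], of k t] that by simp
  have posd: "0 < dir U k t" if "k < b" "0 < t" "t \<le> h" for k t
    using that pos[of k] by (intro dir_pos_of_neu_pos[OF U]) auto
  have "neu U l h * neu' U m h < neu' U l h * neu U m h"
    by (rule wronskian_pos[OF neu(1)[OF U] neu(1)[OF U] lm(1) h])
      (use neu(2,3)[OF U] lm pos in auto)
  then show "neu' V m h * dir' V l h < neu' V l h * dir' V m h" by (simp add: fl mult.commute)
  have "dir U l h * dir' U m h < dir' U l h * dir U m h"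
    by (rule wronskian_pos[OF dir(1)[OF U] dir(1)[OF U] lm(1) h])
      (use dir(2,3)[OF U] lm posd in auto)
  then show "neu V m h * dir V l h < neu V l h * dir V m h" by (simp add: fl mult.commute)
qed

text \<open>
  Formally \<open>K' = V' neu dir\<close>, so \<open>K\<close> grows where \<open>V\<close> does and both solutions are positive. For a
  merely monotone potential the increments of \<open>K\<close> come from the second mean value theorem,
  applied to \<open>(neu' dir')' = (V - l) (neu dir)'\<close>.
\<close>

lemma monotone_potential_increment:
  fixes V :: "real \<Rightarrow> real" and l :: real
  assumes V: "continuous_on UNIV V" and mono: "\<And>x y. s \<le> x \<Longrightarrow> x \<le> y \<Longrightarrow> y \<le> t \<Longrightarrow> V x \<le> V y"
    and st: "s \<le> t"
  defines "g \<equiv> \<lambda>x. neu V l x * dir V l x"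
    and "K \<equiv> \<lambda>x. (V x - l) * (neu V l x * dir V l x) - neu' V l x * dir' V l x"
  shows "\<exists>u\<in>{s..t}. K t - K s = (V t - V s) * g u"
proof -
  define f where "f x = neu' V l x * dir V l x + neu V l x * dir' V l x" for x
  have g: "(g has_real_derivative f x) (at x)" for x
    unfolding g_def f_def
    by (rule derivative_eq_intros hill_solution_DERIV[OF neu(1)[OF V]]
        hill_solution_DERIV[OF dir(1)[OF V]] refl)+ simp
  have fi: "(f has_integral g v - g u) {u..v}" if "u \<le> v" for u v
    by (rule DERIV_imp_has_integral[OF that g])
  obtain u where u: "u \<in> {s..t}"
    "((\<lambda>x. V x * f x) has_integral (V s * integral {s..u} f + V t * integral {u..t} f)) {s..t}"
    using second_mean_value_theorem_full[of f s t V] fi[OF st] st mono by blast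
  have "integral {s..u} f = g u - g s" "integral {u..t} f = g t - g u"
    using fi u(1) by (auto intro!: integral_unique)
  with u(2) have 1: "((\<lambda>x. V x * f x) has_integral V s * (g u - g s) + V t * (g t - g u)) {s..t}"
    by simp
  define p where "p x = neu' V l x * dir' V l x" for x
  have p: "(p has_real_derivative V x * f x - l * f x) (at x)" for x
    unfolding p_def f_def
    by (rule derivative_eq_intros hill_solution_DERIV[OF neu(1)[OF V]]
        hill_solution_DERIV[OF dir(1)[OF V]] refl)+ (simp add: algebra_simps)
  have "((\<lambda>x. V x * f x - l * f x) has_integral p t - p s) {s..t}"
    by (rule DERIV_imp_has_integral[OF st p])
  moreover have "((\<lambda>x. V x * f x - l * f x) has_integral
      (V s * (g u - g s) + V t * (g t - g u)) - l * (g t - g s)) {s..t}"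
    by (intro has_integral_diff 1 has_integral_mult_right fi st)
  ultimately have "p t - p s = (V s * (g u - g s) + V t * (g t - g u)) - l * (g t - g s)"
    by (rule has_integral_unique)
  then have "K t - K s = (V t - V s) * g u"
    unfolding K_def p_def g_def by (simp add: algebra_simps)
  with u(1) show ?thesis by blast
qed

text \<open>
  For a strictly increasing potential the ground state that is free at the bottom of the potential
  has the lower energy. At \<open>l = a\<close> both factors of \<open>g\<close> are positive inside \<open>(0, h)\<close>, so \<open>K\<close> gives
  \<open>dir' V a h > 0\<close>; the reflected Neumann solution has this value at \<open>h\<close>, which excludes \<open>b \<le> a\<close>.
\<close>

lemma ND_less_DN:
  assumes V: "continuous_on UNIV V" and h: "0 < h"
    and a: "lowest_ND V h a" and b: "lowest_ND (\<lambda>x. V (h - x)) h b"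
    and mono: "\<And>x y. 0 \<le> x \<Longrightarrow> x < y \<Longrightarrow> y \<le> h \<Longrightarrow> V x < V y"
  shows "a < b" "0 < dir' V a h"
proof -
  define g where "g x = neu V a x * dir V a x" for x
  define K where "K x = (V x - a) * (neu V a x * dir V a x) - neu' V a x * dir' V a x" for x
  have N: "0 < neu V a x" if "0 \<le> x" "x < h" for x
    using a that by (simp add: lowest_ND_def)
  have g0: "0 < g x" if "0 < x" "x < h" for x
    using N[of x] that dir_pos_of_neu_pos[OF V that(1), of a] N unfolding g_def by force
  have g1: "0 \<le> g x" if "0 \<le> x" "x \<le> h" for x
    using g0[of x] that a by (cases "x = 0 \<or> x = h") (auto simp: g_def lowest_ND_def dir(2)[OF V])
  have mono': "V x \<le> V y" if "0 \<le> x" "x \<le> y" "y \<le> h" for x y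
    using mono[of x y] that by (cases "x = y") auto
  have inc: "\<exists>u\<in>{s..t}. K t - K s = (V t - V s) * g u" if "0 \<le> s" "s \<le> t" "t \<le> h" for s t
    using monotone_potential_increment[OF V _ that(2), of a] mono' that unfolding K_def g_def by simp
  have le: "K s \<le> K t" if st: "0 \<le> s" "s \<le> t" "t \<le> h" for s t
  proof -
    obtain u where "u \<in> {s..t}" "K t - K s = (V t - V s) * g u" using inc[OF st] by blast
    moreover have "0 \<le> V t - V s" using mono'[of s t] st by simp
    ultimately show ?thesis using g1[of u] st by (smt (verit) atLeastAtMost_iff mult_nonneg_nonneg)
  qed
  \<comment> \<open>strictness comes from the middle third, where \<open>g\<close> is positive up to the endpoints\<close>
  have "K (h / 3) < K (2 * h / 3)"
  proof -
    obtain u where u: "u \<in> {h / 3..2 * h / 3}"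
      "K (2 * h / 3) - K (h / 3) = (V (2 * h / 3) - V (h / 3)) * g u"
      using inc[of "h / 3" "2 * h / 3"] h by auto
    have "0 < V (2 * h / 3) - V (h / 3)" using mono[of "h / 3" "2 * h / 3"] h by simp
    moreover have "0 < g u" using u(1) h by (intro g0) auto
    ultimately show ?thesis using u(2) by (smt (verit) mult_pos_pos)
  qed
  moreover have "K 0 \<le> K (h / 3)" "K (2 * h / 3) \<le> K h" using le h by auto
  moreover have "K 0 = 0" by (simp add: K_def dir(2)[OF V] neu(3)[OF V])
  moreover have "K h = - neu' V a h * dir' V a h"
    using a by (simp add: K_def lowest_ND_def)
  ultimately have "0 < - neu' V a h * dir' V a h" by linarith
  then show pos: "0 < dir' V a h"
    using ND_derivative_neg[OF V h a] by (simp add: zero_less_mult_iff mult_less_0_iff)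
  show "a < b"
  proof (rule ccontr)
    assume "\<not> a < b"
    define U where "U = (\<lambda>x. V (h - x))"
    have U: "continuous_on UNIV U"
      unfolding U_def by (rule flip_continuous[OF V])
    have a': "lowest_ND (\<lambda>x. U (h - x)) h a" using a by (simp add: U_def)
    have "neu U a h \<le> 0"
    proof (cases "a = b")
      case True
      then show ?thesis using b by (simp add: U_def lowest_ND_def)
    next
      case False
      then show ?thesis
        using neu_neg_between[OF U h b[folded U_def] a', of a] \<open>\<not> a < b\<close> by simp
    qed
    then show False using pos by (simp add: flip_transfer[OF V] U_def)
  qed
qed

section \<open>Band edges of an even periodic potential\<close>

lemma hill_solution_scale:
  assumes "hill_solution V l y p"
  shows "hill_solution V l (\<lambda>x. c * y x) (\<lambda>x. c * p x)"
  unfolding hill_solution_def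
  by (auto intro!: derivative_eq_intros hill_solution_DERIV[OF assms])

locale even_periodic_potential =
  fixes V :: "real \<Rightarrow> real" and h :: real
  assumes cont: "continuous_on UNIV V" and h: "0 < h"
    and even: "V (- x) = V x" and periodic: "V (x + 2 * h) = V x"
begin

lemma neu_parity: "neu V l (- x) = neu V l x" "neu' V l (- x) = - neu' V l x"
proof -
  have "hill_solution V l (\<lambda>x. neu V l (0 - x)) (\<lambda>x. - neu' V l (0 - x))"
    using hill_solution_flip[OF neu(1)[OF cont, of l], of 0] even by simp
  from hill_solution_unique[OF cont this neu(1)[OF cont], of 0 x]
  show "neu V l (- x) = neu V l x" "neu' V l (- x) = - neu' V l x"
    using neu(3)[OF cont, of l] by auto
qed

lemma dir_parity: "dir V l (- x) = - dir V l x" "dir' V l (- x) = dir' V l x"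
proof -
  have "hill_solution V l (\<lambda>x. dir V l (0 - x)) (\<lambda>x. - dir' V l (0 - x))"
    using hill_solution_flip[OF dir(1)[OF cont, of l], of 0] even by simp
  from hill_solution_scale[OF this, of "- 1"]
  have "hill_solution V l (\<lambda>x. - dir V l (- x)) (\<lambda>x. dir' V l (- x))" by simp
  from hill_solution_unique[OF cont this dir(1)[OF cont], of 0 x]
  show "dir V l (- x) = - dir V l x" "dir' V l (- x) = dir' V l x"
    using dir(2)[OF cont, of l] by auto
qed

text \<open>
  For solutions, the multiplier over a full period is decided by comparing the data at \<open>- h\<close> and
  \<open>h\<close>; for the even and the odd fundamental solution these data differ by signs only.
\<close>

lemma multiplier_from_half_period:
  assumes y: "hill_solution V l y p" and "y h = s * y (- h)" "p h = s * p (- h)"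
  shows "y (x + 2 * h) = s * y x" "p (x + 2 * h) = s * p x"
proof -
  have 1: "hill_solution V l (\<lambda>x. y (x + 2 * h)) (\<lambda>x. p (x + 2 * h))"
    unfolding hill_solution_def
    using hill_solution_DERIV[OF y, of "x + 2 * h" for x] periodic by (auto simp: DERIV_shift[symmetric])
  note 2 = hill_solution_scale[OF y, of s]
  show "y (x + 2 * h) = s * y x" "p (x + 2 * h) = s * p x"
    using hill_solution_unique[OF cont 1 2, of "- h" x] assms(2,3) by auto
qed

lemma complex_hill_solution_expand:
  fixes u u1 :: "real \<Rightarrow> complex"
  assumes "\<And>x. (u has_vector_derivative u1 x) (at x)"
    and "\<And>x. (u1 has_vector_derivative (of_real (V x) - of_real l) * u x) (at x)"
  shows "u x = u 0 * of_real (neu V l x) + u1 0 * of_real (dir V l x)"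
    and "u1 x = u 0 * of_real (neu' V l x) + u1 0 * of_real (dir' V l x)"
proof -
  have "hill_solution V l (\<lambda>x. Re (u x)) (\<lambda>x. Re (u1 x))"
    "hill_solution V l (\<lambda>x. Im (u x)) (\<lambda>x. Im (u1 x))"
    unfolding hill_solution_def
    using has_field_derivative_Re[OF assms(1)] has_field_derivative_Re[OF assms(2)]
      has_field_derivative_Im[OF assms(1)] has_field_derivative_Im[OF assms(2)] by auto
  from hill_solution_expand[OF cont this(1), of x] hill_solution_expand[OF cont this(2), of x]
  show "u x = u 0 * of_real (neu V l x) + u1 0 * of_real (dir V l x)"
    "u1 x = u 0 * of_real (neu' V l x) + u1 0 * of_real (dir' V l x)"
    by (simp_all add: complex_eq_iff)
qed

text \<open>
  An (anti)periodic solution splits into its even and odd parts, and these are separately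
  (anti)periodic; each part survives only if the matching boundary value at \<open>h\<close> vanishes.
\<close>

lemma hill_eigenspaceD:
  fixes s :: real
  assumes u: "u \<in> hill_eigenspace (2 * h) V (of_real s) l"
  obtains A B where "u = (\<lambda>x. A * of_real (neu V l x) + B * of_real (dir V l x))"
    "s = 1 \<Longrightarrow> A * of_real (neu' V l h) = 0" "s = 1 \<Longrightarrow> B * of_real (dir V l h) = 0"
    "s = - 1 \<Longrightarrow> A * of_real (neu V l h) = 0" "s = - 1 \<Longrightarrow> B * of_real (dir' V l h) = 0"
proof -
  obtain u1 where u1: "\<And>x. (u has_vector_derivative u1 x) (at x)"
    "\<And>x. (u1 has_vector_derivative (of_real (V x) - of_real l) * u x) (at x)"
    "\<And>x. u (x + 2 * h) = of_real s * u x"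
    using u unfolding hill_eigenspace_def by blast
  note e = complex_hill_solution_expand[OF u1(1,2)]
  have "((\<lambda>x. x + 2 * h) has_vector_derivative 1) (at (- h))"
    unfolding has_real_derivative_iff_has_vector_derivative[symmetric]
    by (auto intro!: derivative_eq_intros)
  from vector_diff_chain_at[OF this, of u "u1 h"] u1(1)[of h]
  have 1: "((\<lambda>x. u (x + 2 * h)) has_vector_derivative u1 h) (at (- h))"
    by (simp add: o_def)
  have 2: "((\<lambda>x. of_real s * u x) has_vector_derivative of_real s * u1 (- h)) (at (- h))"
    by (intro has_vector_derivative_mult_right u1(1))
  have d: "u1 h = of_real s * u1 (- h)"
    using vector_derivative_unique_at[OF 1 2[folded u1(3)]] .
  have v: "u h = of_real s * u (- h)" using u1(3)[of "- h"] by simp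
  define A where "A = u 0"
  define B where "B = u1 0"
  have v': "A * of_real (neu V l h) + B * of_real (dir V l h) =
      of_real s * (A * of_real (neu V l h) - B * of_real (dir V l h))"
    using v unfolding e(1)[of h] e(1)[of "- h"] by (simp add: neu_parity dir_parity A_def B_def)
  have d': "A * of_real (neu' V l h) + B * of_real (dir' V l h) =
      of_real s * (B * of_real (dir' V l h) - A * of_real (neu' V l h))"
    using d unfolding e(2)[of h] e(2)[of "- h"] by (simp add: neu_parity dir_parity A_def B_def)
  show thesis
  proof (rule that[of A B])
    show "u = (\<lambda>x. A * of_real (neu V l x) + B * of_real (dir V l x))"
      unfolding A_def B_def by (rule ext, rule e(1))
  next
    assume "s = 1"
    with v' d' show "A * of_real (neu' V l h) = 0" "B * of_real (dir V l h) = 0"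
      by (simp_all add: complex_eq_iff)
  next
    assume "s = - 1"
    with v' d' show "A * of_real (neu V l h) = 0" "B * of_real (dir' V l h) = 0"
      by (simp_all add: complex_eq_iff)
  qed
qed

lemma hill_eigenspaceI:
  fixes s :: real
  assumes y: "hill_solution V l y p" and "y h = s * y (- h)" "p h = s * p (- h)"
  shows "(\<lambda>x. c * of_real (y x)) \<in> hill_eigenspace (2 * h) V (of_real s) l"
proof -
  have 1: "((\<lambda>x. c * of_real (y x)) has_vector_derivative c * of_real (p x)) (at x)" for x
    using hill_solution_DERIV(1)[OF y, of x]
    by (auto intro!: derivative_eq_intros simp: has_vector_derivative_complex_iff)
  have 2: "((\<lambda>x. c * of_real (p x)) has_vector_derivative
      (of_real (V x) - of_real l) * (c * of_real (y x))) (at x)" for x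
    using hill_solution_DERIV(2)[OF y, of x]
    by (auto intro!: derivative_eq_intros simp: has_vector_derivative_complex_iff algebra_simps)
  have "c * of_real (y (x + 2 * h)) = of_real s * (c * of_real (y x))" for x
    by (simp add: multiplier_from_half_period(1)[OF assms])
  with 1 2 show ?thesis
    unfolding hill_eigenspace_def
    by (intro CollectI exI[of _ "\<lambda>x. c * of_real (p x)"] allI conjI)
qed

lemma hill_multiplicity_one:
  assumes "hill_eigenspace d V \<sigma> l = range (\<lambda>c x. c * of_real (y x))" "y x0 \<noteq> 0"
  shows "hill_multiplicity d V \<sigma> l = 1" "l \<in> hill_eigenvalues d V \<sigma>"
proof -
  interpret fs: vector_space fun_scale by (rule vector_space_fun_scale)
  define f where "f x = complex_of_real (y x)" for x
  have "f \<noteq> 0" using assms(2) by (auto simp: f_def fun_eq_iff)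
  then have ind: "\<not> fs.dependent {f}" by simp
  have "hill_eigenspace d V \<sigma> l = fs.span {f}"
    unfolding assms(1) fs.span_singleton f_def fun_scale_def ..
  then have "hill_multiplicity d V \<sigma> l = card {f}"
    unfolding hill_multiplicity_def using fs.dim_eq_card_independent[OF ind] by (simp add: fs.dim_span)
  then show "hill_multiplicity d V \<sigma> l = 1" by simp
  have "(\<lambda>x. 1 * of_real (y x)) \<in> hill_eigenspace d V \<sigma> l" unfolding assms(1) by blast
  then show "l \<in> hill_eigenvalues d V \<sigma>"
    using assms(2) unfolding hill_eigenvalues_def
    by (intro CollectI bexI[of _ "\<lambda>x. 1 * of_real (y x)"] exI[of _ x0]) simp_all
qed

lemma periodic_eigenvalueD:
  assumes "l \<in> hill_eigenvalues (2 * h) V 1"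
  shows "neu' V l h = 0 \<or> dir V l h = 0"
proof -
  obtain u where u: "u \<in> hill_eigenspace (2 * h) V (of_real 1) l" "\<exists>x. u x \<noteq> 0"
    using assms by (auto simp: hill_eigenvalues_def)
  from u(1) show ?thesis
    by (rule hill_eigenspaceD) (use u(2) in auto)
qed

lemma antiperiodic_eigenvalueD:
  assumes "l \<in> hill_eigenvalues (2 * h) V (- 1)"
  shows "neu V l h = 0 \<or> dir' V l h = 0"
proof -
  obtain u where u: "u \<in> hill_eigenspace (2 * h) V (of_real (- 1)) l" "\<exists>x. u x \<noteq> 0"
    using assms by (auto simp: hill_eigenvalues_def)
  from u(1) show ?thesis
    by (rule hill_eigenspaceD) (use u(2) in auto)
qed

lemma periodic_eigenvalue_simple:
  assumes "neu' V l h = 0" "dir V l h \<noteq> 0"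
  shows "hill_multiplicity (2 * h) V 1 l = 1" "l \<in> hill_eigenvalues (2 * h) V 1"
proof -
  have "hill_eigenspace (2 * h) V (of_real 1) l = range (\<lambda>c x. c * of_real (neu V l x))"
  proof (intro equalityI subsetI)
    fix u assume "u \<in> hill_eigenspace (2 * h) V (of_real 1) l"
    then show "u \<in> range (\<lambda>c x. c * of_real (neu V l x))"
      by (rule hill_eigenspaceD) (use assms in auto)
  next
    fix u assume "u \<in> range (\<lambda>c x. c * complex_of_real (neu V l x))"
    then show "u \<in> hill_eigenspace (2 * h) V (of_real 1) l"
      using hill_eigenspaceI[OF neu(1)[OF cont], of l 1] assms neu_parity by auto
  qed
  from hill_multiplicity_one[OF this, of 0]
  show "hill_multiplicity (2 * h) V 1 l = 1" "l \<in> hill_eigenvalues (2 * h) V 1"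
    by (auto simp: neu(2)[OF cont])
qed

lemma antiperiodic_eigenvalue_simple:
  assumes "(neu V l h = 0) \<noteq> (dir' V l h = 0)"
  shows "hill_multiplicity (2 * h) V (- 1) l = 1" "l \<in> hill_eigenvalues (2 * h) V (- 1)"
proof -
  have "\<exists>y. (\<exists>x. y x \<noteq> 0) \<and>
      hill_eigenspace (2 * h) V (of_real (- 1)) l = range (\<lambda>c x. c * of_real (y x))"
  proof (cases "neu V l h = 0")
    case True
    have "hill_eigenspace (2 * h) V (of_real (- 1)) l = range (\<lambda>c x. c * of_real (neu V l x))"
    proof (intro equalityI subsetI)
      fix u assume "u \<in> hill_eigenspace (2 * h) V (of_real (- 1)) l"
      then show "u \<in> range (\<lambda>c x. c * of_real (neu V l x))"
        by (rule hill_eigenspaceD) (use assms True in auto)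
    next
      fix u assume "u \<in> range (\<lambda>c x. c * complex_of_real (neu V l x))"
      then show "u \<in> hill_eigenspace (2 * h) V (of_real (- 1)) l"
        using hill_eigenspaceI[OF neu(1)[OF cont], of l "- 1"] True neu_parity by auto
    qed
    moreover have "neu V l 0 \<noteq> 0" by (simp add: neu(2)[OF cont])
    ultimately show ?thesis by blast
  next
    case False
    then have z: "dir' V l h = 0" using assms by simp
    have "hill_eigenspace (2 * h) V (of_real (- 1)) l = range (\<lambda>c x. c * of_real (dir V l x))"
    proof (intro equalityI subsetI)
      fix u assume "u \<in> hill_eigenspace (2 * h) V (of_real (- 1)) l"
      then show "u \<in> range (\<lambda>c x. c * of_real (dir V l x))"
        by (rule hill_eigenspaceD) (use False in auto)
    next
      fix u assume "u \<in> range (\<lambda>c x. c * complex_of_real (dir V l x))"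
      then show "u \<in> hill_eigenspace (2 * h) V (of_real (- 1)) l"
        using hill_eigenspaceI[OF dir(1)[OF cont], of l "- 1"] z dir_parity by auto
    qed
    moreover have "dir V l h \<noteq> 0"
      using neu_dir_wronskian[OF cont, of l h] z by auto
    ultimately show ?thesis by blast
  qed
  then obtain y x where "y x \<noteq> (0::real)"
    "hill_eigenspace (2 * h) V (of_real (- 1)) l = range (\<lambda>c x. c * of_real (y x))" by blast
  from hill_multiplicity_one[OF this(2,1)]
  show "hill_multiplicity (2 * h) V (- 1) l = 1" "l \<in> hill_eigenvalues (2 * h) V (- 1)" by auto
qed

text \<open>
  Below \<open>c\<close> the eigenvalue count is \<open>0\<close> and at \<open>c\<close> it is \<open>1\<close>, so the infimum that defines the lowest
  eigenvalue is attained at \<open>c\<close>. The antiperiodic edges are found in the same way.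
\<close>

lemma band_edge_1:
  assumes c: "lowest_NN V h c"
  shows "band_edge (2 * h) V 1 = c"
proof -
  note signs = transfer_signs_up_to_NN[OF cont h c]
  have ge: "c \<le> l" if "l \<in> hill_eigenvalues (2 * h) V 1" for l
    using periodic_eigenvalueD[OF that] signs(3)[of l] signs(5)[of l] by force
  have m: "hill_multiplicity (2 * h) V 1 c = 1" "c \<in> hill_eigenvalues (2 * h) V 1"
    using periodic_eigenvalue_simple[of c] signs(3)[of c] c by (auto simp: lowest_NN_def)
  have below: "hill_eigenvalues (2 * h) V 1 \<inter> {..l} = {}" if "l < c" for l
    using ge that by force
  have at: "hill_eigenvalues (2 * h) V 1 \<inter> {..c} = {c}"
    using ge m(2) by force
  have "nth_hill_eigenvalue (2 * h) V 1 1 = c"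
    unfolding nth_hill_eigenvalue_def
  proof (rule cInf_eq_minimum)
    show "c \<in> {l. 1 \<le> (\<Sum>\<mu>\<in>hill_eigenvalues (2 * h) V 1 \<inter> {..l}. hill_multiplicity (2 * h) V 1 \<mu>)}"
      using at m(1) by simp
  next
    fix l assume "l \<in> {l. 1 \<le> (\<Sum>\<mu>\<in>hill_eigenvalues (2 * h) V 1 \<inter> {..l}. hill_multiplicity (2 * h) V 1 \<mu>)}"
    then show "c \<le> l" using below[of l] by (cases "l < c") auto
  qed
  then show ?thesis by (simp add: band_edge_def)
qed

lemma band_edges_2_3:
  assumes ef: "e < f"
    and e: "(neu V e h = 0) \<noteq> (dir' V e h = 0)" and f: "(neu V f h = 0) \<noteq> (dir' V f h = 0)"
    and nonzero: "\<And>l. l < f \<Longrightarrow> l \<noteq> e \<Longrightarrow> neu V l h \<noteq> 0 \<and> dir' V l h \<noteq> 0"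
  shows "band_edge (2 * h) V 2 = e" "band_edge (2 * h) V 3 = f"
proof -
  let ?E = "hill_eigenvalues (2 * h) V (- 1)" and ?m = "hill_multiplicity (2 * h) V (- 1)"
  have me: "?m e = 1" "e \<in> ?E" using antiperiodic_eigenvalue_simple[OF e] by auto
  have mf: "?m f = 1" "f \<in> ?E" using antiperiodic_eigenvalue_simple[OF f] by auto
  have cases: "l = e \<or> f \<le> l" if "l \<in> ?E" for l
    using antiperiodic_eigenvalueD[OF that] nonzero[of l] by force
  have b1: "?E \<inter> {..l} = {}" if "l < e" for l using cases that ef by force
  have b2: "?E \<inter> {..l} = {e}" if "e \<le> l" "l < f" for l using cases that me by force
  have b3: "?E \<inter> {..f} = {e, f}" using cases me mf ef by force
  have "nth_hill_eigenvalue (2 * h) V (- 1) 1 = e"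
    unfolding nth_hill_eigenvalue_def
  proof (rule cInf_eq_minimum)
    show "e \<in> {l. 1 \<le> (\<Sum>\<mu>\<in>?E \<inter> {..l}. ?m \<mu>)}"
      using b2[of e] ef me(1) by simp
  next
    fix l assume "l \<in> {l. 1 \<le> (\<Sum>\<mu>\<in>?E \<inter> {..l}. ?m \<mu>)}"
    then show "e \<le> l" using b1[of l] by (cases "l < e") auto
  qed
  then show "band_edge (2 * h) V 2 = e" by (simp add: band_edge_def)
  have "nth_hill_eigenvalue (2 * h) V (- 1) 2 = f"
    unfolding nth_hill_eigenvalue_def
  proof (rule cInf_eq_minimum)
    show "f \<in> {l. 2 \<le> (\<Sum>\<mu>\<in>?E \<inter> {..l}. ?m \<mu>)}"
      using b3 ef me(1) mf(1) by simp
  next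
    fix l assume l: "l \<in> {l. 2 \<le> (\<Sum>\<mu>\<in>?E \<inter> {..l}. ?m \<mu>)}"
    show "f \<le> l"
    proof (rule ccontr)
      assume "\<not> f \<le> l"
      then show False using l b1[of l] b2[of l] me(1) by (cases "l < e") auto
    qed
  qed
  then show "band_edge (2 * h) V 3 = f" by (simp add: band_edge_def)
qed

end

section \<open>Weak derivatives on the line\<close>

subsection \<open>Test functions\<close>

text \<open>
  The functions \<open>exp (- 1 / t) / t ^ m\<close>, extended by \<open>0\<close>, are closed under differentiation up to
  linear combinations; composed with a concave parabola they give bump functions on any interval.
\<close>

definition flat :: "nat \<Rightarrow> real \<Rightarrow> real" where
  "flat m t = (if 0 < t then exp (- inverse t) * inverse t ^ m else 0)"

lemma power_div_fact_le_exp: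
  fixes x :: real
  assumes "0 \<le> x"
  shows "x ^ n / fact n \<le> exp x"
proof -
  have "(\<Sum>k\<in>{n}. inverse (fact k) * x ^ k) \<le> (\<Sum>k. inverse (fact k) * x ^ k)"
    using assms by (intro sum_le_suminf summable_exp) auto
  then show ?thesis by (simp add: exp_def divide_inverse mult.commute)
qed

lemma flat_bound: "\<bar>flat m t\<bar> \<le> fact (m + 2) * t\<^sup>2"
proof (cases "0 < t")
  case True
  define s where "s = inverse t"
  have s: "0 < s" using True by (simp add: s_def)
  have "s ^ (m + 2) \<le> exp s * fact (m + 2)"
    using power_div_fact_le_exp[OF less_imp_le[OF s], of "m + 2"]
    unfolding pos_divide_le_eq[OF fact_gt_zero] .
  then have 1: "s ^ (m + 2) * (exp (- s) * t\<^sup>2) \<le> exp s * fact (m + 2) * (exp (- s) * t\<^sup>2)"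
    by (rule mult_right_mono) simp
  have "exp s * exp (- s) = 1" by (simp add: exp_minus)
  then have 2: "exp s * fact (m + 2) * (exp (- s) * t\<^sup>2) = fact (m + 2) * t\<^sup>2" by algebra
  have 3: "s\<^sup>2 * t\<^sup>2 = 1"
    using True unfolding s_def power_mult_distrib[symmetric] by simp
  have "exp (- s) * s ^ m = s\<^sup>2 * t\<^sup>2 * (exp (- s) * s ^ m)" unfolding 3 by simp
  also have "\<dots> = s ^ (m + 2) * (exp (- s) * t\<^sup>2)"
    unfolding power_add by (simp only: ac_simps)
  also have "\<dots> \<le> fact (m + 2) * t\<^sup>2" using 1 unfolding 2 .
  finally have "exp (- s) * s ^ m \<le> fact (m + 2) * t\<^sup>2" .
  moreover have "\<bar>flat m t\<bar> = exp (- s) * s ^ m"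
    using True s by (simp add: flat_def s_def[symmetric] abs_mult)
  ultimately show ?thesis by simp
qed (simp add: flat_def)

lemma flat_DERIV: "(flat m has_real_derivative flat (m + 2) t - m * flat (m + 1) t) (at t)"
proof -
  consider "0 < t" | "t < 0" | "t = 0" by linarith
  then show ?thesis
  proof cases
    case 1
    have "((\<lambda>t. exp (- inverse t) * inverse t ^ m) has_real_derivative
        exp (- inverse t) * inverse t ^ (m + 2) - m * (exp (- inverse t) * inverse t ^ (m + 1))) (at t)"
    proof (cases m)
      case 0
      then show ?thesis
        using 1 by (auto intro!: derivative_eq_intros simp: power2_eq_square)
    next
      case (Suc k)
      then show ?thesis
        using 1 by (auto intro!: derivative_eq_intros simp: algebra_simps power_add) (cases k; simp)
    qed
    from has_field_derivative_transform_within_open[OF this, of "{0<..}" "flat m"] 1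
    show ?thesis by (simp add: flat_def)
  next
    case 2
    have "((\<lambda>t. 0) has_real_derivative 0) (at t)" by simp
    from has_field_derivative_transform_within_open[OF this, of "{..<0}" "flat m"] 2
    show ?thesis by (simp add: flat_def)
  next
    case 3
    have "((\<lambda>k. (flat m (0 + k) - flat m 0) / k) \<longlongrightarrow> 0) (at 0)"
    proof (rule Lim_null_comparison)
      have "norm ((flat m (0 + k) - flat m 0) / k) \<le> fact (m + 2) * \<bar>k\<bar>" for k
      proof (cases "k = 0")
        case False
        have "\<bar>flat m k\<bar> / \<bar>k\<bar> \<le> fact (m + 2) * k\<^sup>2 / \<bar>k\<bar>"
          by (intro divide_right_mono flat_bound) simp
        also have "\<dots> = fact (m + 2) * \<bar>k\<bar>"
          using False by (cases "0 < k") (simp_all add: power2_eq_square)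
        finally show ?thesis by (simp add: flat_def[of m 0])
      qed simp
      then show "\<forall>\<^sub>F k in at 0. norm ((flat m (0 + k) - flat m 0) / k) \<le> fact (m + 2) * \<bar>k\<bar>"
        by simp
      have "((\<lambda>k::real. fact (m + 2) * \<bar>k\<bar>) \<longlongrightarrow> fact (m + 2) * \<bar>0\<bar>) (at 0)"
        by (intro tendsto_intros)
      then show "((\<lambda>k::real. fact (m + 2) * \<bar>k\<bar>) \<longlongrightarrow> 0) (at 0)" by simp
    qed
    then show ?thesis
      unfolding DERIV_def 3 by (simp add: flat_def)
  qed
qed

inductive bump_class :: "real \<Rightarrow> real \<Rightarrow> real \<Rightarrow> (real \<Rightarrow> real) \<Rightarrow> bool" for a b n where
  base: "bump_class a b n (\<lambda>x. c * (n * (a + b - 2 * x)) ^ k * flat m (n * ((x - a) * (b - x))))"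
| add: "bump_class a b n f \<Longrightarrow> bump_class a b n g \<Longrightarrow> bump_class a b n (\<lambda>x. f x + g x)"

lemma bump_class_DERIV:
  assumes "bump_class a b n f"
  shows "\<exists>f'. bump_class a b n f' \<and> (\<forall>x. (f has_real_derivative f' x) (at x))"
  using assms
proof induction
  case (base c k m)
  define r where "r x = n * (a + b - 2 * x)" for x
  define q where "q x = n * ((x - a) * (b - x))" for x
  have r: "(r has_real_derivative - (2 * n)) (at x)" for x
    unfolding r_def[abs_def] by (auto intro!: derivative_eq_intros)
  have q: "(q has_real_derivative r x) (at x)" for x
    unfolding q_def[abs_def] r_def by (auto intro!: derivative_eq_intros simp: algebra_simps)
  define f' where "f' x = (c * k * (- 2 * n) * r x ^ (k - 1) * flat m (q x)
      + c * r x ^ (k + 1) * flat (m + 2) (q x)) + (- c * m) * r x ^ (k + 1) * flat (m + 1) (q x)" for x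
  have "bump_class a b n f'"
    unfolding f'_def[abs_def] r_def q_def by (intro bump_class.intros)
  moreover have "((\<lambda>x. c * r x ^ k * flat m (q x)) has_real_derivative f' x) (at x)" for x
    by (rule derivative_eq_intros DERIV_chain2[OF flat_DERIV] r q refl)+
      (simp add: f'_def algebra_simps)
  ultimately show ?case unfolding r_def q_def by blast
next
  case (add f g)
  then obtain f' g' where "bump_class a b n f'" "\<forall>x. (f has_real_derivative f' x) (at x)"
    "bump_class a b n g'" "\<forall>x. (g has_real_derivative g' x) (at x)" by blast
  then show ?case
    by (intro exI[of _ "\<lambda>x. f' x + g' x"]) (auto intro: bump_class.add DERIV_add)
qed

definition smooth :: "(real \<Rightarrow> real) \<Rightarrow> bool" where
  "smooth f \<longleftrightarrow> (\<forall>k x. (deriv ^^ k) f field_differentiable at x)"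

lemma bump_class_smooth:
  assumes "bump_class a b n f"
  shows "smooth f"
proof -
  have D: "bump_class a b n (deriv g) \<and> (\<forall>x. g field_differentiable at x)" if g: "bump_class a b n g" for g
  proof -
    obtain g' where g': "bump_class a b n g'" "\<forall>x. (g has_real_derivative g' x) (at x)"
      using bump_class_DERIV[OF g] by blast
    then have "deriv g = g'" by (intro ext DERIV_imp_deriv) simp
    then show ?thesis using g' by (auto simp: field_differentiable_def)
  qed
  have "bump_class a b n ((deriv ^^ k) f)" for k
    by (induction k) (use assms D in auto)
  then show ?thesis unfolding smooth_def using D by blast
qed

lemma smooth_DERIV:
  assumes "smooth f"
  shows "(f has_real_derivative deriv f x) (at x)"
proof -
  have "(deriv ^^ 0) f field_differentiable at x"
    using assms unfolding smooth_def by blast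
  then show ?thesis by (simp add: DERIV_deriv_iff_field_differentiable)
qed

lemma smooth_lincomb:
  assumes "smooth f" "smooth g"
  shows "smooth (\<lambda>x. f x + c * g x)"
proof -
  have "(deriv ^^ k) (\<lambda>x. f x + c * g x) = (\<lambda>x. (deriv ^^ k) f x + c * (deriv ^^ k) g x)" for k
  proof (induction k)
    case (Suc k)
    have "deriv (\<lambda>x. (deriv ^^ k) f x + c * (deriv ^^ k) g x) x =
        deriv ((deriv ^^ k) f) x + c * deriv ((deriv ^^ k) g) x" for x
      using assms unfolding smooth_def
      by (intro DERIV_imp_deriv DERIV_add DERIV_cmult)
        (simp_all add: DERIV_deriv_iff_field_differentiable)
    then show ?case using Suc by auto
  qed simp
  moreover have "(\<lambda>x. (deriv ^^ k) f x + c * (deriv ^^ k) g x) field_differentiable at x" for k x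
    using assms unfolding smooth_def by (intro derivative_intros) auto
  ultimately show ?thesis unfolding smooth_def by simp
qed

lemma smooth_antiderivative:
  assumes "smooth f" "\<And>x. (F has_real_derivative f x) (at x)"
  shows "smooth F"
proof -
  have "deriv F = f" using assms(2) by (intro ext DERIV_imp_deriv)
  then have "(deriv ^^ Suc k) F = (deriv ^^ k) f" for k
    by (simp only: funpow_Suc_right o_apply)
  moreover have "(deriv ^^ 0) F field_differentiable at x" for x
    using assms(2) by (auto simp: field_differentiable_def)
  moreover have "(deriv ^^ k) f field_differentiable at x" for k x
    using assms(1) unfolding smooth_def by blast
  ultimately have "(deriv ^^ k) F field_differentiable at x" for k x
    by (cases k) (simp_all only:)
  then show ?thesis unfolding smooth_def by blast
qed

lemma smooth_continuous: "smooth f \<Longrightarrow> continuous_on S f"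
  by (rule DERIV_continuous_on, rule DERIV_subset[OF _ subset_UNIV], rule smooth_DERIV)

lemma test_functionI:
  assumes "smooth f" "\<And>x. R < \<bar>x\<bar> \<Longrightarrow> f x = 0"
  shows "test_function f"
proof -
  have "{x. f x \<noteq> 0} \<subseteq> {- R..R}" using assms(2) by (force simp: abs_le_iff not_le[symmetric])
  then have "bounded {x. f x \<noteq> 0}" using bounded_subset bounded_closed_interval by blast
  then show ?thesis using assms(1) by (auto simp: test_function_def smooth_def)
qed

lemma test_functionD:
  assumes "test_function f"
  obtains R where "0 < R" "\<And>x. (f has_real_derivative deriv f x) (at x)"
    "continuous_on UNIV f" "continuous_on UNIV (deriv f)"
    "\<And>x. R \<le> \<bar>x\<bar> \<Longrightarrow> f x = 0" "\<And>x. R \<le> \<bar>x\<bar> \<Longrightarrow> deriv f x = 0"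
proof -
  have sm: "smooth f" using assms by (simp add: test_function_def smooth_def)
  have "smooth (deriv f)"
    unfolding smooth_def
  proof (intro allI)
    fix k x
    have "(deriv ^^ Suc k) f field_differentiable at x" using sm unfolding smooth_def by blast
    then show "(deriv ^^ k) (deriv f) field_differentiable at x"
      by (simp only: funpow_Suc_right o_apply)
  qed
  have "bounded {x. f x \<noteq> 0}"
    using assms unfolding test_function_def
    by (meson bounded_subset closure_subset compact_imp_bounded)
  then obtain r where r: "\<And>x. f x \<noteq> 0 \<Longrightarrow> \<bar>x\<bar> \<le> r"
    unfolding bounded_iff by auto
  have z: "f x = 0" if "r < \<bar>x\<bar>" for x using r[of x] that by force
  define R where "R = \<bar>r\<bar> + 1"
  show thesis
  proof (rule that[of R])
    fix x assume x: "R \<le> \<bar>x\<bar>"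
    show "f x = 0" using x by (intro z) (simp add: R_def)
    have "((\<lambda>_. 0) has_real_derivative 0) (at x)" by simp
    moreover have "open {y. r < \<bar>y\<bar>}" by (intro open_Collect_less continuous_intros)
    ultimately have "(f has_real_derivative 0) (at x)"
      by (rule has_field_derivative_transform_within_open) (use x z in \<open>auto simp: R_def\<close>)
    then show "deriv f x = 0" by (rule DERIV_imp_deriv)
  qed (use sm \<open>smooth (deriv f)\<close> in \<open>auto simp: R_def smooth_DERIV smooth_continuous\<close>)
qed

text \<open>
  As \<open>n\<close> grows, the exponent on \<open>(a, b)\<close> tends to \<open>0\<close> and the bump to the indicator of the interval.
\<close>

definition bump :: "real \<Rightarrow> real \<Rightarrow> nat \<Rightarrow> real \<Rightarrow> real" where
  "bump a b n x = flat 0 (real (Suc n) * ((x - a) * (b - x)))"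

lemma bump_smooth: "smooth (bump a b n)"
  using bump_class_smooth[OF bump_class.base[of a b "real (Suc n)" 1 0 0]]
  by (simp add: bump_def[abs_def])

lemma bump_outside: "x \<le> a \<or> b \<le> x \<Longrightarrow> a < b \<Longrightarrow> bump a b n x = 0"
  by (auto simp: bump_def flat_def zero_less_mult_iff)

lemma bump_bounds: "0 \<le> bump a b n x" "bump a b n x \<le> 1"
proof -
  show "0 \<le> bump a b n x" by (simp add: bump_def flat_def)
  define q where "q = real (Suc n) * ((x - a) * (b - x))"
  have "exp (- inverse q) \<le> 1" if "0 < q" using that by simp
  then have "flat 0 q \<le> 1" by (simp add: flat_def)
  then show "bump a b n x \<le> 1" by (simp only: bump_def q_def)
qed

lemma bump_tendsto:
  assumes "a < b"
  shows "(\<lambda>n. bump a b n x) \<longlonglongrightarrow> indicator {a<..<b} x"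
proof (cases "x \<in> {a<..<b}")
  case True
  define s where "s = (x - a) * (b - x)"
  have s: "0 < s" using True by (simp add: s_def)
  have "(\<lambda>n. exp (- (inverse (real (Suc n)) * inverse s))) \<longlonglongrightarrow> exp (- (0 * inverse s))"
    by (intro tendsto_intros LIMSEQ_inverse_real_of_nat)
  moreover have "exp (- (inverse (real (Suc n)) * inverse s)) = bump a b n x" for n
  proof -
    have "0 < real (Suc n) * s" using s by (intro mult_pos_pos) simp_all
    then show ?thesis
      by (simp only: bump_def flat_def s_def[symmetric] if_True power_0 mult_1_right inverse_mult_distrib)
  qed
  ultimately show ?thesis using True by simp
next
  case False
  then show ?thesis using bump_outside[of x a b] assms by auto
qed

subsection \<open>Vanishing weak derivatives\<close>

definition locally_integrable :: "(real \<Rightarrow> complex) \<Rightarrow> bool" where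
  "locally_integrable u \<longleftrightarrow> u \<in> borel_measurable borel \<and>
     (\<forall>a b. integrable lborel (\<lambda>x. indicator {a..b} x *\<^sub>R u x))"

lemma locally_integrableD:
  assumes "locally_integrable u"
  shows "u \<in> borel_measurable borel" "integrable lborel (\<lambda>x. indicator {a..b} x *\<^sub>R u x)"
  using assms by (auto simp: locally_integrable_def)

lemma continuous_imp_locally_integrable:
  assumes "continuous_on UNIV u"
  shows "locally_integrable u"
  unfolding locally_integrable_def
  using borel_integrable_compact[of "{a..b}" u for a b] continuous_on_subset[OF assms]
    borel_measurable_continuous_onI[OF assms] by auto

lemma square_integrable_imp_locally_integrable:
  assumes "square_integrable u"
  shows "locally_integrable u"
  unfolding locally_integrable_def
proof (intro conjI allI)
  show m: "u \<in> borel_measurable borel" using assms by (simp add: square_integrable_def)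
  fix a b :: real
  have "integrable lborel (\<lambda>x. indicator {a..b} x + (norm (u x))\<^sup>2 :: real)"
    using assms by (intro Bochner_Integration.integrable_add) (auto simp: square_integrable_def emeasure_lborel_Icc_eq)
  then show "integrable lborel (\<lambda>x. indicator {a..b} x *\<^sub>R u x)"
  proof (rule Bochner_Integration.integrable_bound)
    have "norm (u x) \<le> 1 + (norm (u x))\<^sup>2" for x
    proof -
      have "2 * norm (u x) * 1 \<le> (norm (u x))\<^sup>2 + 1\<^sup>2" by (rule sum_squares_bound)
      then have "2 * norm (u x) \<le> (norm (u x))\<^sup>2 + 1" by simp
      then show ?thesis using norm_ge_zero[of "u x"] by linarith
    qed
    then show "AE x in lborel. norm (indicator {a..b} x *\<^sub>R u x) \<le>
        norm (indicator {a..b} x + (norm (u x))\<^sup>2)"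
      by (intro AE_I2) (auto simp: indicator_def)
  qed (use m in simp)
qed

lemma locally_integrable_diff:
  assumes "locally_integrable u" "locally_integrable v"
  shows "locally_integrable (\<lambda>x. u x - v x)"
  using assms unfolding locally_integrable_def by (auto simp: scaleR_diff_right)

lemma locally_integrable_mult_bounded:
  fixes g :: "real \<Rightarrow> real"
  assumes u: "locally_integrable u" and g: "g \<in> borel_measurable borel"
    and "\<And>x. \<bar>g x\<bar> \<le> M" "\<And>x. R < \<bar>x\<bar> \<Longrightarrow> g x = 0"
  shows "integrable lborel (\<lambda>x. u x * of_real (g x))"
proof (rule Bochner_Integration.integrable_bound)
  show "integrable lborel (\<lambda>x. M * norm (indicator {- R..R} x *\<^sub>R u x))"
    by (intro integrable_mult_right integrable_norm locally_integrableD(2)[OF u])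
  have "norm (u x * of_real (g x)) \<le> M * norm (indicator {- R..R} x *\<^sub>R u x)" for x
  proof (cases "R < \<bar>x\<bar>")
    case True
    then show ?thesis using assms(3)[of x] assms(4)[of x] by simp
  next
    case False
    then have "x \<in> {- R..R}" by auto
    then show ?thesis
      using mult_right_mono[OF assms(3)[of x], of "norm (u x)"] by (simp add: norm_mult mult.commute)
  qed
  then show "AE x in lborel. norm (u x * of_real (g x)) \<le> norm (M * norm (indicator {- R..R} x *\<^sub>R u x))"
    by (intro AE_I2) (smt (verit) real_norm_def)
qed (use g locally_integrableD(1)[OF u] in simp)

lemma compact_support_bounded:
  fixes g :: "real \<Rightarrow> real"
  assumes "continuous_on UNIV g" "\<And>x. R < \<bar>x\<bar> \<Longrightarrow> g x = 0"
  obtains M where "\<And>x. \<bar>g x\<bar> \<le> M"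
proof -
  obtain M where M: "\<And>x. x \<in> {- R..R} \<Longrightarrow> \<bar>g x\<bar> \<le> M"
    using continuous_on_Icc_bounded[OF continuous_on_subset[OF assms(1)]] by blast
  have "\<bar>g x\<bar> \<le> max M 0" for x
  proof (cases "R < \<bar>x\<bar>")
    case False
    then have "\<bar>g x\<bar> \<le> M" by (intro M) auto
    then show ?thesis by simp
  qed (simp add: assms(2))
  then show thesis by (rule that)
qed

lemma locally_integrable_mult_test:
  fixes g :: "real \<Rightarrow> real"
  assumes u: "locally_integrable u" and g: "continuous_on UNIV g" "\<And>x. R < \<bar>x\<bar> \<Longrightarrow> g x = 0"
  shows "integrable lborel (\<lambda>x. u x * of_real (g x))"
proof -
  obtain M where "\<And>x. \<bar>g x\<bar> \<le> M" using compact_support_bounded[OF g] by blast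
  then show ?thesis
    using locally_integrable_mult_bounded[OF u borel_measurable_continuous_onI[OF g(1)] _ g(2)] by blast
qed

lemma bump_integral_tendsto:
  assumes u: "locally_integrable u" and ab: "a < b"
  shows "(\<lambda>n. LINT x|lborel. u x * of_real (bump a b n x)) \<longlonglongrightarrow>
    (LINT x|lborel. indicator {a<..<b} x *\<^sub>R u x)"
proof (rule integral_dominated_convergence)
  note [measurable] = locally_integrableD(1)[OF u]
  show "(\<lambda>x. indicator {a<..<b} x *\<^sub>R u x) \<in> borel_measurable lborel" by simp
  show "(\<lambda>x. u x * of_real (bump a b n x)) \<in> borel_measurable lborel" for n
    using borel_measurable_continuous_onI[OF smooth_continuous[OF bump_smooth]] by simp
  show "integrable lborel (\<lambda>x. norm (indicator {a..b} x *\<^sub>R u x))"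
    by (intro integrable_norm locally_integrableD(2)[OF u])
  show "AE x in lborel. (\<lambda>n. u x * of_real (bump a b n x)) \<longlonglongrightarrow> indicator {a<..<b} x *\<^sub>R u x"
  proof (intro AE_I2)
    fix x
    have "(\<lambda>n. u x * of_real (bump a b n x)) \<longlonglongrightarrow> u x * of_real (indicator {a<..<b} x)"
      by (intro tendsto_intros bump_tendsto ab)
    then show "(\<lambda>n. u x * of_real (bump a b n x)) \<longlonglongrightarrow> indicator {a<..<b} x *\<^sub>R u x"
      by (simp add: scaleR_conv_of_real mult.commute)
  qed
  show "AE x in lborel. norm (u x * of_real (bump a b n x)) \<le> norm (indicator {a..b} x *\<^sub>R u x)" for n
  proof (intro AE_I2)
    fix x
    show "norm (u x * of_real (bump a b n x)) \<le> norm (indicator {a..b} x *\<^sub>R u x)"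
    proof (cases "x \<in> {a..b}")
      case True
      then show ?thesis
        using bump_bounds[of a b n x] by (simp add: norm_mult mult_left_le)
    next
      case False
      then show ?thesis using bump_outside[of x a b n] ab by auto
    qed
  qed
qed

text \<open>
  Sets over which a given integrable function has integral \<open>0\<close> form a Dynkin system.
\<close>

lemma AE_zero_of_interval_integrals:
  assumes u: "locally_integrable u"
    and zero: "\<And>a b. a < b \<Longrightarrow> (LINT x|lborel. indicator {a<..<b} x *\<^sub>R u x) = 0"
  shows "AE x in lborel. u x = 0"
proof -
  note [measurable] = locally_integrableD(1)[OF u]
  have zero': "(LINT x|lborel. indicator {a<..<b} x *\<^sub>R u x) = 0" for a b :: real
    using zero[of a b] by (cases "a < b") simp_all
  have gen: "sets borel = sigma_sets UNIV (range (\<lambda>(a, b). {a<..<b :: real}))"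
    unfolding borel_eq_box box_real by simp
  have "AE x in lborel. indicator {- real N<..<real N} x *\<^sub>R u x = 0" for N :: nat
  proof (rule sigma_finite_measure.density_zero[OF sigma_finite_lborel])
    define w where "w x = indicator {- real N<..<real N} x *\<^sub>R u x" for x
    have "integrable lborel (\<lambda>x. indicator {- real N<..<real N} x *\<^sub>R
        (indicator {- real N..real N} x *\<^sub>R u x))"
      by (intro integrable_mult_indicator locally_integrableD(2)[OF u]) simp
    moreover have "indicator {- real N<..<real N} x *\<^sub>R (indicator {- real N..real N} x *\<^sub>R u x) = w x" for x
      by (simp add: w_def indicator_def)
    ultimately have w: "integrable lborel w" by simp
    then show "integrable lborel (\<lambda>x. indicator {- real N<..<real N} x *\<^sub>R u x)"
      unfolding w_def .
    have wi: "set_integrable lborel A w" if "A \<in> sets borel" for A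
      unfolding set_integrable_def using that by (intro integrable_mult_indicator w) simp
    fix A :: "real set" assume "A \<in> sets lborel"
    then have A: "A \<in> sigma_sets UNIV (range (\<lambda>(a, b). {a<..<b :: real}))"
      using gen by simp
    have "Int_stable (range (\<lambda>(a, b). {a<..<b :: real}))"
      by (auto simp: Int_stable_def intro!: image_eqI[where x = "(max _ _, min _ _)"])
    moreover have "range (\<lambda>(a, b). {a<..<b :: real}) \<subseteq> Pow UNIV" by simp
    ultimately have "set_lebesgue_integral lborel A w = 0"
      using A
    proof (induction rule: sigma_sets_induct_disjoint)
      case (basic A)
      then obtain a b where A: "A = {a<..<b}" by auto
      have "indicator A x *\<^sub>R w x = indicator {max a (- real N)<..<min b (real N)} x *\<^sub>R u x" for x
        by (auto simp: A w_def indicator_def)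
      then show ?case
        unfolding set_lebesgue_integral_def by (simp only: zero')
    next
      case (compl A)
      have A: "A \<in> sets borel"
        using compl(1) gen by simp
      have "set_lebesgue_integral lborel (A \<union> (UNIV - A)) w =
          set_lebesgue_integral lborel A w + set_lebesgue_integral lborel (UNIV - A) w"
        using A by (intro set_integral_Un wi) auto
      moreover have "set_lebesgue_integral lborel (A \<union> (UNIV - A)) w = 0"
        using zero'[of "- real N" "real N"] by (simp add: set_lebesgue_integral_def w_def)
      ultimately show ?case using compl(2) by simp
    next
      case (union A)
      have A: "A i \<in> sets borel" for i
        using union(2) gen by auto
      have "set_lebesgue_integral lborel (\<Union>i. A i) w = (\<Sum>i. set_lebesgue_integral lborel (A i) w)"
        using union(1) A by (intro lebesgue_integral_countable_add wi)
          (auto simp: disjoint_family_on_def)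
      then show ?case using union(3) by simp
    qed (simp add: set_lebesgue_integral_def)
    then show "set_lebesgue_integral lborel A (\<lambda>x. indicator {- real N<..<real N} x *\<^sub>R u x) = 0"
      unfolding w_def .
  qed
  then have "AE x in lborel. \<forall>N::nat. indicator {- real N<..<real N} x *\<^sub>R u x = 0"
    unfolding AE_all_countable by blast
  then show ?thesis
  proof (rule AE_mp, intro AE_I2 impI)
    fix x assume z: "\<forall>N::nat. indicator {- real N<..<real N} x *\<^sub>R u x = 0"
    obtain N :: nat where "\<bar>x\<bar> < real N" using reals_Archimedean2 by blast
    then have "x \<in> {- real N<..<real N}" by auto
    then show "u x = 0" using z[rule_format, of N] by simp
  qed
qed

text \<open>
  Du Bois-Reymond: subtracting from a bump the multiple of a fixed bump \<open>\<eta>\<close> with the same integral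
  leaves the derivative of a test function, so all bump integrals of \<open>u\<close> are those of a constant.
\<close>

lemma weak_derivative_zero_imp_const:
  assumes u: "locally_integrable u"
    and zero: "\<And>\<phi>. test_function \<phi> \<Longrightarrow> (LINT x|lborel. u x * of_real (deriv \<phi> x)) = 0"
  shows "\<exists>c. AE x in lborel. u x = c"
proof -
  have cl: "locally_integrable (\<lambda>_. c)" for c
    by (intro continuous_imp_locally_integrable continuous_intros)
  have bi: "integrable lborel (\<lambda>x. v x * of_real (bump a b n x))" if "a < b" "locally_integrable v" for v a b n
  proof (rule locally_integrable_mult_test[OF that(2) smooth_continuous[OF bump_smooth]])
    fix x assume "\<bar>a\<bar> + \<bar>b\<bar> < \<bar>x\<bar>"
    then have "x \<le> a \<or> b \<le> x" by linarith
    then show "bump a b n x = 0" using that(1) by (rule bump_outside)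
  qed
  define I where "I a b n = (LINT x|lborel. bump a b n x)" for a b n
  have Ic: "(LINT x|lborel. 1 * complex_of_real (bump a b n x)) = of_real (I a b n)" for a b n
    by (simp add: I_def)
  have Ii: "integrable lborel (bump a b n)" if "a < b" for a b n
    using bi[OF that cl[of 1], of n] by (simp add: complex_of_real_integrable_eq)
  have "(\<lambda>n. complex_of_real (I 0 1 n)) \<longlonglongrightarrow> (LINT x|lborel. indicator {0<..<1::real} x *\<^sub>R 1)"
    using bump_integral_tendsto[OF cl[of 1], of 0 1] unfolding Ic by simp
  moreover have "(LINT x|lborel. indicator {0<..<1::real} x *\<^sub>R (1::complex)) = 1"
    by (simp add: scaleR_conv_of_real)
  ultimately have lim: "(\<lambda>n. complex_of_real (I 0 1 n)) \<longlonglongrightarrow> 1" by simp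
  obtain k where k: "I 0 1 k \<noteq> 0"
  proof (rule ccontr)
    assume "\<not> thesis"
    then have "\<And>n. I 0 1 n = 0" using that by blast
    with lim have "(\<lambda>n. 0 :: complex) \<longlonglongrightarrow> 1" by simp
    then show False by (simp add: LIMSEQ_const_iff)
  qed
  define c where "c = (LINT x|lborel. u x * of_real (bump 0 1 k x)) / of_real (I 0 1 k)"
  have key: "(LINT x|lborel. (u x - c) * of_real (bump a b n x)) = 0" if ab: "a < b" for a b n
  proof -
    define s where "s = - I a b n / I 0 1 k"
    define f where "f x = bump a b n x + s * bump 0 1 k x" for x
    have sf: "smooth f" unfolding f_def by (intro smooth_lincomb bump_smooth)
    obtain F0 where F0: "\<And>x. (F0 has_real_derivative f x) (at x)"
      using continuous_imp_antiderivative[OF smooth_continuous[OF sf]] by blast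
    define A where "A = min a 0"
    define B where "B = max b 1"
    define F where "F x = F0 x - F0 A" for x
    have F: "(F has_real_derivative f x) (at x)" for x
      unfolding F_def[abs_def] using F0 by (auto intro!: derivative_eq_intros)
    have AB: "A \<le> B" using ab by (simp add: A_def B_def)
    have out: "f x = 0" if "x \<le> A \<or> B \<le> x" for x
      using that ab bump_outside[of x a b n] bump_outside[of x 0 1 k] by (auto simp: f_def A_def B_def)
    have "integrable lborel f"
      unfolding f_def using Ii[OF ab] Ii[of 0 1] by simp
    then have "(f has_integral (LINT x|lborel. f x)) UNIV" by (rule has_integral_integral_lborel)
    moreover have "(LINT x|lborel. f x) = 0"
      using Ii[OF ab, of n] Ii[of 0 1 k] k by (simp add: f_def I_def[symmetric] s_def)
    ultimately have i1: "(f has_integral 0) UNIV" by simp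
    have "(f has_integral F B - F A) {A..B}"
      by (rule DERIV_imp_has_integral[OF AB F])
    then have "(f has_integral F B - F A) UNIV"
    proof (rule has_integral_on_superset)
      fix x assume "x \<notin> {A..B}"
      then have "x \<le> A \<or> B \<le> x" by auto
      then show "f x = 0" by (rule out)
    qed simp
    from has_integral_unique[OF i1 this] have FB: "F B = F A" by simp
    have FA: "F A = 0" by (simp add: F_def)
    have const: "F x = F y" if "x \<le> y" "\<And>t. x \<le> t \<Longrightarrow> t \<le> y \<Longrightarrow> f t = 0" for x y
    proof -
      have "(F has_real_derivative 0) (at t)" if "x \<le> t" "t \<le> y" for t
        using F[of t] \<open>\<And>t. x \<le> t \<Longrightarrow> t \<le> y \<Longrightarrow> f t = 0\<close>[OF that] by simp
      from nonneg_derivative_mono[OF \<open>x \<le> y\<close> this] nonneg_derivative_mono[OF \<open>x \<le> y\<close> DERIV_minus[OF this]]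
      show ?thesis by simp
    qed
    have left: "F x = 0" if "x \<le> A" for x
      using const[OF that] out FA by simp
    have right: "F x = 0" if "B \<le> x" for x
      using const[OF that] out FA FB by simp
    have "test_function F"
    proof (rule test_functionI[of _ "\<bar>A\<bar> + \<bar>B\<bar>"])
      show "smooth F" by (rule smooth_antiderivative[OF sf F])
      fix x :: real assume "\<bar>A\<bar> + \<bar>B\<bar> < \<bar>x\<bar>"
      then have "x \<le> A \<or> B \<le> x" by linarith
      then show "F x = 0" using left right by blast
    qed
    from zero[OF this] have "(LINT x|lborel. u x * of_real (f x)) = 0"
      using DERIV_imp_deriv[OF F] by simp
    moreover have "u x * of_real (f x) = u x * of_real (bump a b n x) +
        of_real s * (u x * of_real (bump 0 1 k x))" for x
      by (simp add: f_def algebra_simps)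
    ultimately have "(LINT x|lborel. u x * of_real (bump a b n x)) +
        of_real s * (LINT x|lborel. u x * of_real (bump 0 1 k x)) = 0"
      using bi[OF ab u, of n] bi[OF _ u, of 0 1 k] by simp
    moreover have "of_real s * (LINT x|lborel. u x * of_real (bump 0 1 k x)) = - (c * of_real (I a b n))"
      using k by (simp add: s_def c_def)
    moreover have "(LINT x|lborel. (u x - c) * of_real (bump a b n x)) =
        (LINT x|lborel. u x * of_real (bump a b n x)) - c * of_real (I a b n)"
      using bi[OF ab u, of n] Ii[OF ab, of n] by (simp add: left_diff_distrib I_def)
    ultimately show ?thesis by simp
  qed
  have uc: "locally_integrable (\<lambda>x. u x - c)"
    by (intro locally_integrable_diff u cl)
  have "AE x in lborel. u x - c = 0"
  proof (rule AE_zero_of_interval_integrals[OF uc])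
    fix a b :: real assume ab: "a < b"
    from bump_integral_tendsto[OF uc ab]
    show "(LINT x|lborel. indicator {a<..<b} x *\<^sub>R (u x - c)) = 0"
      unfolding key[OF ab] by (simp add: LIMSEQ_const_iff)
  qed
  then show ?thesis by (intro exI[of _ c]) simp
qed

subsection \<open>Regularity of weak solutions\<close>

definition primitive :: "(real \<Rightarrow> complex) \<Rightarrow> real \<Rightarrow> complex" where
  "primitive v x = (LBINT y=0..x. v y)"

lemma locally_integrable_interval:
  assumes "locally_integrable v"
  shows "interval_lebesgue_integrable lborel (ereal a) (ereal b) v"
proof -
  have "set_integrable lborel {x<..<y} v" for x y
  proof -
    have "set_integrable lborel {x..y} v"
      unfolding set_integrable_def using locally_integrableD(2)[OF assms] .
    then show ?thesis by (rule set_integrable_subset) auto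
  qed
  then show ?thesis
    by (simp add: interval_lebesgue_integrable_def einterval_eq_Icc[symmetric] flip: einterval_eq)
qed

lemma primitive_diff:
  assumes "locally_integrable v"
  shows "primitive v b - primitive v a = (LBINT y=a..b. v y)"
proof -
  have "(LBINT y=0..ereal a. v y) + (LBINT y=ereal a..ereal b. v y) = (LBINT y=0..ereal b. v y)"
  proof (rule interval_integral_sum)
    have *: "min (0::ereal) (min (ereal a) (ereal b)) = ereal (min 0 (min a b))"
      "max (0::ereal) (max (ereal a) (ereal b)) = ereal (max 0 (max a b))"
      by (auto simp: min_def max_def zero_ereal_def)
    show "interval_lebesgue_integrable lborel (min 0 (min (ereal a) (ereal b)))
        (max 0 (max (ereal a) (ereal b))) v"
      unfolding * by (rule locally_integrable_interval[OF assms])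
  qed
  then show ?thesis unfolding primitive_def by (simp add: zero_ereal_def algebra_simps)
qed

lemma primitive_continuous:
  assumes v: "locally_integrable v"
  shows "continuous_on UNIV (primitive v)"
proof -
  have "isCont (primitive v) x" for x
  proof -
    define a where "a = x - 1"
    define b where "b = x + 1"
    have si: "set_integrable lborel {a..z} v" for z
      unfolding set_integrable_def by (rule locally_integrableD(2)[OF v])
    have "v integrable_on {a..b}"
      by (rule set_borel_integral_eq_integral(1)[OF si])
    then have c: "continuous_on {a..b} (\<lambda>z. integral {a..z} v)"
      by (rule indefinite_integral_continuous_1)
    have eq: "primitive v z = primitive v a + integral {a..z} v" if "z \<in> {a..b}" for z
      using primitive_diff[OF v, of z a] interval_integral_eq_integral[OF _ si, of z] that
      by (simp add: algebra_simps)
    have "continuous_on {a..b} (primitive v)"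
      by (rule continuous_on_eq[OF continuous_on_add[OF continuous_on_const c, of "primitive v a"]])
        (rule eq[symmetric])
    moreover have "x \<in> interior {a..b}" by (simp add: a_def b_def)
    ultimately show ?thesis by (rule continuous_on_interior)
  qed
  then show ?thesis by (intro continuous_at_imp_continuous_on) blast
qed

text \<open>
  Fubini's theorem for the kernel of the primitive: integrating \<open>\<phi>'\<close> over the half line beyond \<open>y\<close>
  that points away from \<open>0\<close> gives \<open>- \<phi> y\<close> up to the orientation sign.
\<close>

definition primitive_kernel :: "real \<Rightarrow> real \<Rightarrow> real" where
  "primitive_kernel x y = (if 0 < y \<and> y < x then 1 else if x < y \<and> y < 0 then - 1 else 0)"

lemma primitive_kernel_measurable [measurable]:
  "(\<lambda>(x, y). primitive_kernel x y) \<in> borel_measurable (lborel \<Otimes>\<^sub>M lborel)"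
proof -
  have "(\<lambda>p. primitive_kernel (fst p) (snd p)) \<in> borel_measurable (lborel \<Otimes>\<^sub>M lborel)"
    unfolding primitive_kernel_def by measurable
  then show ?thesis by (simp add: case_prod_beta)
qed

lemma primitive_eq_kernel:
  "primitive v x = (LINT y|lborel. of_real (primitive_kernel x y) * v y)"
proof (cases "0 \<le> x")
  case True
  have "indicat_real {0<..<x} y *\<^sub>R v y = of_real (primitive_kernel x y) * v y" for y
    using True by (auto simp: primitive_kernel_def)
  moreover have "einterval 0 (ereal x) = {0<..<x}"
    by (auto simp: einterval_def zero_ereal_def)
  ultimately show ?thesis
    using True
    by (simp add: primitive_def interval_lebesgue_integral_def set_lebesgue_integral_def)
next
  case False
  have "- (indicat_real {x<..<0} y *\<^sub>R v y) = of_real (primitive_kernel x y) * v y" for y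
    using False by (auto simp: primitive_kernel_def)
  then have "(LINT y|lborel. - (indicat_real {x<..<0} y *\<^sub>R v y)) =
      (LINT y|lborel. of_real (primitive_kernel x y) * v y)" by simp
  moreover have "einterval (ereal x) 0 = {x<..<0}"
    by (auto simp: einterval_def zero_ereal_def)
  ultimately show ?thesis
    using False
    by (simp add: primitive_def interval_lebesgue_integral_def set_lebesgue_integral_def)
qed

lemma has_integral_half_lines:
  assumes phi: "\<And>x. (\<phi> has_real_derivative \<psi> x) (at x)"
    and out: "\<And>x. R \<le> \<bar>x\<bar> \<Longrightarrow> \<phi> x = 0" "\<And>x. R \<le> \<bar>x\<bar> \<Longrightarrow> \<psi> x = 0"
  shows "((\<lambda>x. primitive_kernel x y * \<psi> x) has_integral (if y = 0 then 0 else - \<phi> y)) UNIV"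
proof -
  have ftc: "(\<psi> has_integral \<phi> t - \<phi> s) {s..t}" if "s \<le> t" for s t
    by (rule DERIV_imp_has_integral[OF that phi])
  consider "0 < y" | "y < 0" | "y = 0" by linarith
  then show ?thesis
  proof cases
    case 1
    define T where "T = max R y"
    have "\<phi> T = 0" using 1 by (intro out) (auto simp: T_def)
    then have "(\<psi> has_integral - \<phi> y) {y..T}" using ftc[of y T] by (simp add: T_def)
    then have "((\<lambda>x. primitive_kernel x y * \<psi> x) has_integral - \<phi> y) {y..T}"
      by (rule has_integral_spike_finite[of "{y}", rotated 2]) (use 1 in \<open>auto simp: primitive_kernel_def\<close>)
    then have "((\<lambda>x. primitive_kernel x y * \<psi> x) has_integral - \<phi> y) UNIV"
    proof (rule has_integral_on_superset)
      fix x assume "x \<notin> {y..T}"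
      then have "x < y \<or> R \<le> \<bar>x\<bar>" by (auto simp: T_def)
      then show "primitive_kernel x y * \<psi> x = 0"
        using 1 out(2)[of x] by (auto simp: primitive_kernel_def)
    qed simp
    then show ?thesis using 1 by simp
  next
    case 2
    define T where "T = min (- R) y"
    have "\<phi> T = 0" using 2 by (intro out) (auto simp: T_def)
    then have "(\<psi> has_integral \<phi> y) {T..y}" using ftc[of T y] by (simp add: T_def)
    from has_integral_neg[OF this]
    have "((\<lambda>x. primitive_kernel x y * \<psi> x) has_integral - \<phi> y) {T..y}"
      by (rule has_integral_spike_finite[of "{y}", rotated 2]) (use 2 in \<open>auto simp: primitive_kernel_def\<close>)
    then have "((\<lambda>x. primitive_kernel x y * \<psi> x) has_integral - \<phi> y) UNIV"
    proof (rule has_integral_on_superset)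
      fix x assume "x \<notin> {T..y}"
      then have "y < x \<or> R \<le> \<bar>x\<bar>" by (auto simp: T_def)
      then show "primitive_kernel x y * \<psi> x = 0"
        using 2 out(2)[of x] by (auto simp: primitive_kernel_def)
    qed simp
    then show ?thesis using 2 by simp
  qed (simp add: primitive_kernel_def)
qed

lemma primitive_weak_derivative:
  assumes v: "locally_integrable v"
  shows "weak_derivative (primitive v) v"
  unfolding weak_derivative_def
proof (intro allI impI)
  fix \<phi> assume "test_function \<phi>"
  then obtain R where R: "0 < R" "\<And>x. (\<phi> has_real_derivative deriv \<phi> x) (at x)"
    "continuous_on UNIV \<phi>" "continuous_on UNIV (deriv \<phi>)"
    "\<And>x. R \<le> \<bar>x\<bar> \<Longrightarrow> \<phi> x = 0" "\<And>x. R \<le> \<bar>x\<bar> \<Longrightarrow> deriv \<phi> x = 0"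
    using test_functionD by blast
  define \<psi> where "\<psi> = deriv \<phi>"
  have psi: "continuous_on UNIV \<psi>" "\<And>x. R \<le> \<bar>x\<bar> \<Longrightarrow> \<psi> x = 0"
    using R by (simp_all add: \<psi>_def)
  obtain M where M: "\<And>x. \<bar>\<psi> x\<bar> \<le> M"
    using compact_support_bounded[OF psi(1), of R] psi(2) by force
  have M0: "0 \<le> M" using M[of 0] by simp
  note [measurable] = locally_integrableD(1)[OF v] borel_measurable_continuous_onI[OF psi(1)]
  define f where "f x y = of_real (primitive_kernel x y * \<psi> x) * v y" for x y
  define V where "V y = indicator {- R..R} y *\<^sub>R v y" for y
  have V: "integrable lborel V"
    unfolding V_def[abs_def] by (rule locally_integrableD(2)[OF v])
  note [measurable] = borel_measurable_integrable[OF V]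
  define G where "G x = indicator {- R..R} x * M" for x :: real
  have G: "integrable lborel G"
    unfolding G_def[abs_def] by (simp add: emeasure_lborel_Icc_eq)
  note [measurable] = borel_measurable_integrable[OF G]
  have "integrable (lborel \<Otimes>\<^sub>M lborel) (\<lambda>(x, y). G x *\<^sub>R V y)"
  proof (rule lborel_pair.Fubini_integrable)
    show "(\<lambda>(x, y). G x *\<^sub>R V y) \<in> borel_measurable (lborel \<Otimes>\<^sub>M lborel)" by measurable
    have "(\<integral>y. norm (case (x, y) of (x, y) \<Rightarrow> G x *\<^sub>R V y) \<partial>lborel) = \<bar>G x\<bar> * (\<integral>y. norm (V y) \<partial>lborel)" for x
      by simp
    then show "integrable lborel (\<lambda>x. \<integral>y. norm (case (x, y) of (x, y) \<Rightarrow> G x *\<^sub>R V y) \<partial>lborel)"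
      using G by simp
    show "AE x in lborel. integrable lborel (\<lambda>y. case (x, y) of (x, y) \<Rightarrow> G x *\<^sub>R V y)"
      using V by simp
  qed
  then have "integrable (lborel \<Otimes>\<^sub>M lborel) (\<lambda>(x, y). f x y)"
  proof (rule Bochner_Integration.integrable_bound)
    show "(\<lambda>(x, y). f x y) \<in> borel_measurable (lborel \<Otimes>\<^sub>M lborel)"
      unfolding f_def by measurable
    have "norm (f x y) \<le> norm (G x *\<^sub>R V y)" for x y
    proof (cases "R \<le> \<bar>x\<bar>")
      case True
      then show ?thesis by (simp add: f_def psi)
    next
      case False
      then have x: "x \<in> {- R..R}" by auto
      show ?thesis
      proof (cases "y \<in> {- R..R}")
        case True
        have "\<bar>primitive_kernel x y\<bar> * \<bar>\<psi> x\<bar> \<le> 1 * M"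
          by (intro mult_mono M) (auto simp: primitive_kernel_def)
        then have "\<bar>primitive_kernel x y\<bar> * \<bar>\<psi> x\<bar> * norm (v y) \<le> 1 * M * norm (v y)"
          by (intro mult_right_mono) auto
        then show ?thesis
          using x True M0 by (simp add: f_def G_def V_def norm_mult abs_mult)
      next
        case False
        then have "primitive_kernel x y = 0"
          using x by (auto simp: primitive_kernel_def)
        then show ?thesis by (simp add: f_def)
      qed
    qed
    then show "AE p in lborel \<Otimes>\<^sub>M lborel. norm (case p of (x, y) \<Rightarrow> f x y) \<le>
        norm (case p of (x, y) \<Rightarrow> G x *\<^sub>R V y)"
      by (intro AE_I2) (auto split: prod.split)
  qed
  then have fub: "(\<integral>y. (\<integral>x. f x y \<partial>lborel) \<partial>lborel) = (\<integral>x. (\<integral>y. f x y \<partial>lborel) \<partial>lborel)"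
    by (rule lborel_pair.Fubini_integral)
  have 1: "(\<integral>y. f x y \<partial>lborel) = primitive v x * of_real (\<psi> x)" for x
  proof -
    have "f x y = of_real (\<psi> x) * (of_real (primitive_kernel x y) * v y)" for y
      by (simp add: f_def ac_simps)
    then show ?thesis by (simp add: primitive_eq_kernel mult.commute)
  qed
  have 2: "(\<integral>x. f x y \<partial>lborel) = - (v y * of_real (\<phi> y))" if "y \<noteq> 0" for y
  proof -
    have i: "integrable lborel (\<lambda>x. primitive_kernel x y * \<psi> x)"
    proof (rule Bochner_Integration.integrable_bound[OF G])
      have "(\<lambda>x. primitive_kernel x y) \<in> borel_measurable borel"
        unfolding primitive_kernel_def by measurable
      then show "(\<lambda>x. primitive_kernel x y * \<psi> x) \<in> borel_measurable lborel" by simp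
      have "norm (primitive_kernel x y * \<psi> x) \<le> norm (G x)" for x
      proof (cases "R \<le> \<bar>x\<bar>")
        case False
        have "\<bar>primitive_kernel x y\<bar> * \<bar>\<psi> x\<bar> \<le> 1 * M"
          by (intro mult_mono M) (auto simp: primitive_kernel_def)
        moreover have "x \<in> {- R..R}" using False by auto
        ultimately show ?thesis using M0 by (simp add: G_def abs_mult)
      qed (simp add: psi)
      then show "AE x in lborel. norm (primitive_kernel x y * \<psi> x) \<le> norm (G x)"
        by (intro AE_I2)
    qed
    have "(\<integral>x. primitive_kernel x y * \<psi> x \<partial>lborel) = - \<phi> y"
      using has_integral_unique[OF has_integral_integral_lborel[OF i]
          has_integral_half_lines[of \<phi> \<psi> R y]] R(2,5,6) that by (simp add: \<psi>_def)
    moreover have "(\<integral>x. f x y \<partial>lborel) = of_real (\<integral>x. primitive_kernel x y * \<psi> x \<partial>lborel) * v y"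
      unfolding f_def integral_mult_left_zero integral_complex_of_real ..
    ultimately show ?thesis by (simp add: mult.commute)
  qed
  have m1: "(\<lambda>y. - (v y * of_real (\<phi> y))) \<in> borel_measurable lborel"
    using borel_measurable_continuous_onI[OF R(3)] by simp
  have "(\<integral>y. (\<integral>x. f x y \<partial>lborel) \<partial>lborel) = (\<integral>y. - (v y * of_real (\<phi> y)) \<partial>lborel)"
  proof (rule integral_cong_AE)
    have "(\<lambda>(y, x). f x y) \<in> borel_measurable (lborel \<Otimes>\<^sub>M lborel)"
      using primitive_kernel_measurable unfolding f_def primitive_kernel_def by measurable
    then show "(\<lambda>y. \<integral>x. f x y \<partial>lborel) \<in> borel_measurable lborel"
      by (rule lborel.borel_measurable_lebesgue_integral)
    have "AE y in lborel. y \<noteq> (0::real)" by (rule AE_lborel_singleton)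
    then show "AE y in lborel. (\<integral>x. f x y \<partial>lborel) = - (v y * of_real (\<phi> y))"
      by (rule AE_mp) (intro AE_I2 impI 2)
  qed (rule m1)
  then show "(LINT x|lborel. primitive v x * of_real (deriv \<phi> x)) = - (LINT x|lborel. v x * of_real (\<phi> x))"
    using fub by (simp add: 1 \<psi>_def[symmetric])
qed

text \<open>
  Both \<open>u\<close> and \<open>primitive v\<close> have the weak derivative \<open>v\<close>.
\<close>

lemma weak_derivative_imp_primitive:
  assumes u: "locally_integrable u" and v: "locally_integrable v" and w: "weak_derivative u v"
  shows "\<exists>c. AE x in lborel. u x = c + primitive v x"
proof -
  have P: "locally_integrable (primitive v)"
    by (intro continuous_imp_locally_integrable primitive_continuous v)
  have "\<exists>c. AE x in lborel. u x - primitive v x = c"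
  proof (rule weak_derivative_zero_imp_const)
    show "locally_integrable (\<lambda>x. u x - primitive v x)" by (intro locally_integrable_diff u P)
    fix \<phi> assume t: "test_function \<phi>"
    then obtain R where R: "0 < R" "\<And>x. (\<phi> has_real_derivative deriv \<phi> x) (at x)"
      "continuous_on UNIV \<phi>" "continuous_on UNIV (deriv \<phi>)"
      "\<And>x. R \<le> \<bar>x\<bar> \<Longrightarrow> \<phi> x = 0" "\<And>x. R \<le> \<bar>x\<bar> \<Longrightarrow> deriv \<phi> x = 0"
      using test_functionD by blast
    have i: "integrable lborel (\<lambda>x. z x * of_real (deriv \<phi> x))" if "locally_integrable z" for z
      by (rule locally_integrable_mult_test[OF that R(4), of R]) (simp add: R(6))
    have "(LINT x|lborel. u x * of_real (deriv \<phi> x)) = - (LINT x|lborel. v x * of_real (\<phi> x))"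
      "(LINT x|lborel. primitive v x * of_real (deriv \<phi> x)) = - (LINT x|lborel. v x * of_real (\<phi> x))"
      using w primitive_weak_derivative[OF v] t unfolding weak_derivative_def by blast+
    then show "(LINT x|lborel. (u x - primitive v x) * of_real (deriv \<phi> x)) = 0"
      using i[OF u] i[OF P] by (simp add: left_diff_distrib)
  qed
  then obtain c where "AE x in lborel. u x - primitive v x = c" by blast
  then show ?thesis
    by (intro exI[of _ c]) (auto elim!: eventually_mono simp: algebra_simps)
qed

lemma continuous_imp_vector_antiderivative:
  fixes f :: "real \<Rightarrow> complex"
  assumes "continuous_on UNIV f"
  obtains F where "\<And>x. (F has_vector_derivative f x) (at x)"
proof -
  have "\<exists>F. \<forall>x::real. -\<infinity> < ereal x \<longrightarrow> ereal x < \<infinity> \<longrightarrow> (F has_vector_derivative f x) (at x)"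
    by (rule einterval_antiderivative)
      (use assms in \<open>auto simp: continuous_on_eq_continuous_at\<close>)
  then show thesis using that by auto
qed

text \<open>
  On either side of \<open>0\<close> the primitive only sees the values of \<open>v\<close> there, so one continuous
  representative per side suffices.
\<close>

lemma primitive_DERIV:
  assumes v: "locally_integrable v" and f: "continuous_on UNIV f" and S: "open S" "x \<in> S"
    and S0: "\<And>y z. y \<in> S \<Longrightarrow> z \<in> S \<Longrightarrow> y \<le> z \<Longrightarrow> {y..z} \<subseteq> S"
    and ae: "AE y in lborel. y \<in> S \<longrightarrow> v y = f y"
  shows "(primitive v has_vector_derivative f x) (at x)"
proof -
  obtain F where F: "\<And>x. (F has_vector_derivative f x) (at x)"
    using continuous_imp_vector_antiderivative[OF f] by blast
  have mv: "v \<in> borel_measurable lborel" "f \<in> borel_measurable lborel"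
    using locally_integrableD(1)[OF v] borel_measurable_continuous_onI[OF f] by auto
  have le: "primitive v z - primitive v y = F z - F y" if "y \<in> S" "z \<in> S" "y \<le> z" for y z
  proof -
    have "(LBINT t=ereal y..ereal z. v t) = (LBINT t=ereal y..ereal z. f t)"
    proof (rule interval_integral_cong_AE)
      show "AE t\<in>einterval (min (ereal y) (ereal z)) (max (ereal y) (ereal z)) in lborel. v t = f t"
        using ae
      proof (rule AE_mp, intro AE_I2 impI)
        fix t assume t: "t \<in> S \<longrightarrow> v t = f t"
          "t \<in> einterval (min (ereal y) (ereal z)) (max (ereal y) (ereal z))"
        then have "t \<in> {y..z}" using \<open>y \<le> z\<close> by (simp add: einterval_def min_def max_def)
        then have "t \<in> S" using S0[OF \<open>y \<in> S\<close> \<open>z \<in> S\<close> \<open>y \<le> z\<close>] by blast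
        then show "v t = f t" using t by blast
      qed
    qed (use mv in auto)
    also have "\<dots> = F z - F y"
      using \<open>y \<le> z\<close> F
      by (intro interval_integral_FTC_finite continuous_on_subset[OF f])
        (auto intro: has_vector_derivative_at_within)
    finally show ?thesis using primitive_diff[OF v] by simp
  qed
  have eq: "primitive v y = F y + (primitive v x - F x)" if "y \<in> S" for y
    using le[OF that S(2)] le[OF S(2) that] by (cases "y \<le> x") (auto simp: algebra_simps)
  have "((\<lambda>y. F y + (primitive v x - F x)) has_vector_derivative f x) (at x)"
    using has_vector_derivative_add[OF F[of x] has_vector_derivative_const[of "primitive v x - F x"]]
    by simp
  then show ?thesis
    by (rule has_vector_derivative_transform_within_open[OF _ S]) (simp add: eq)
qed

section \<open>Eigenfunctions of the interface problem\<close>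

text \<open>
  Classical form of the eigenvalue problem: \<open>u\<close> is continuously differentiable on the whole line, and
  the second derivative is left open at \<open>0\<close>, where the potential jumps.
\<close>

definition interface_eigenfunction ::
    "(real \<Rightarrow> real) \<Rightarrow> real \<Rightarrow> real \<Rightarrow> (real \<Rightarrow> complex) \<Rightarrow> (real \<Rightarrow> complex) \<Rightarrow> bool" where
  "interface_eigenfunction V \<alpha> l u u1 \<longleftrightarrow>
     (\<forall>x. (u has_vector_derivative u1 x) (at x)) \<and> continuous_on UNIV u1 \<and>
     (\<forall>x>0. (u1 has_vector_derivative of_real (V x + \<alpha> - l) * u x) (at x)) \<and>
     (\<forall>x<0. (u1 has_vector_derivative of_real (V x - l) * u x) (at x)) \<and>
     square_integrable u \<and> square_integrable u1 \<and> (\<exists>x. u x \<noteq> 0)"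

lemma square_integrable_AE_continuous:
  assumes u: "square_integrable u" and v: "continuous_on UNIV v" and ae: "AE x in lborel. u x = v x"
  shows "square_integrable v"
proof -
  have m: "v \<in> borel_measurable lborel" using borel_measurable_continuous_onI[OF v] by simp
  moreover have "integrable lborel (\<lambda>x. (norm (v x))\<^sup>2)"
  proof (rule integrable_cong_AE[THEN iffD1])
    show "integrable lborel (\<lambda>x. (norm (u x))\<^sup>2)" using u by (simp add: square_integrable_def)
    show "AE x in lborel. (norm (u x))\<^sup>2 = (norm (v x))\<^sup>2" using ae by (auto elim: eventually_mono)
  qed (use u m in \<open>auto simp: square_integrable_def\<close>)
  ultimately show ?thesis by (simp add: square_integrable_def)
qed

lemma schroedinger_eigenvalue_imp_classical:
  assumes V: "continuous_on UNIV V"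
    and ev: "schroedinger_eigenvalue (interface_potential V \<alpha>) l"
  shows "\<exists>u u1. interface_eigenfunction V \<alpha> l u u1"
proof -
  obtain w w1 w2 where w: "square_integrable w" "square_integrable w1" "square_integrable w2"
    "weak_derivative w w1" "weak_derivative w1 w2" "\<not> (AE x in lborel. w x = 0)"
    "AE x in lborel. - w2 x + of_real (interface_potential V \<alpha> x) * w x = of_real l * w x"
    using ev unfolding schroedinger_eigenvalue_def sobolev_H2_def by blast
  note li = w(1-3)[THEN square_integrable_imp_locally_integrable]
  obtain c c1 where c: "AE x in lborel. w x = c + primitive w1 x"
    and c1: "AE x in lborel. w1 x = c1 + primitive w2 x"
    using weak_derivative_imp_primitive[OF li(1,2) w(4)] weak_derivative_imp_primitive[OF li(2,3) w(5)]
    by blast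
  define u where "u x = c + primitive w1 x" for x
  define u1 where "u1 x = c1 + primitive w2 x" for x
  have cu: "continuous_on UNIV u" and cu1: "continuous_on UNIV u1"
    unfolding u_def[abs_def] u1_def[abs_def]
    by (intro continuous_intros primitive_continuous li)+
  have au: "AE x in lborel. w x = u x" and au1: "AE x in lborel. w1 x = u1 x"
    using c c1 by (simp_all add: u_def u1_def)
  have "(primitive w1 has_vector_derivative u1 x) (at x)" for x
    by (rule primitive_DERIV[OF li(2) cu1, of UNIV]) (use au1 in auto)
  then have du: "(u has_vector_derivative u1 x) (at x)" for x
    unfolding u_def[abs_def] using has_vector_derivative_add[OF has_vector_derivative_const[of c]]
    by fastforce
  have ae: "AE x in lborel. w2 x = of_real (interface_potential V \<alpha> x - l) * u x"
    using w(7) au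
  proof eventually_elim
    case (elim x)
    then show ?case by (simp add: algebra_simps)
  qed
  have pos: "(primitive w2 has_vector_derivative of_real (V x + \<alpha> - l) * u x) (at x)" if "0 < x" for x
  proof (rule primitive_DERIV[OF li(3), of _ "{0<..}"])
    show "continuous_on UNIV (\<lambda>x. of_real (V x + \<alpha> - l) * u x)" by (intro continuous_intros V cu)
    show "AE y in lborel. y \<in> {0<..} \<longrightarrow> w2 y = of_real (V y + \<alpha> - l) * u y"
      using ae by eventually_elim (simp add: interface_potential_def)
  qed (use that in auto)
  have neg: "(primitive w2 has_vector_derivative of_real (V x - l) * u x) (at x)" if "x < 0" for x
  proof (rule primitive_DERIV[OF li(3), of _ "{..<0}"])
    show "continuous_on UNIV (\<lambda>x. of_real (V x - l) * u x)" by (intro continuous_intros V cu)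
    show "AE y in lborel. y \<in> {..<0} \<longrightarrow> w2 y = of_real (V y - l) * u y"
      using ae by eventually_elim (simp add: interface_potential_def)
  qed (use that in auto)
  have add: "(u1 has_vector_derivative D) (at x)" if "(primitive w2 has_vector_derivative D) (at x)" for D x
    unfolding u1_def[abs_def] using has_vector_derivative_add[OF has_vector_derivative_const[of c1] that]
    by simp
  have "\<exists>x. u x \<noteq> 0"
  proof (rule ccontr)
    assume "\<not> ?thesis"
    then have "AE x in lborel. w x = 0" using au by simp
    then show False using w(6) by contradiction
  qed
  moreover have "square_integrable u" "square_integrable u1"
    by (rule square_integrable_AE_continuous[OF w(1) cu au],
        rule square_integrable_AE_continuous[OF w(2) cu1 au1])
  ultimately have "interface_eigenfunction V \<alpha> l u u1"
    unfolding interface_eigenfunction_def using du cu1 pos neg add by simp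
  then show ?thesis by blast
qed

text \<open>
  Integration by parts, with an exceptional point for the jump of the potential.
\<close>

lemma classical_weak_derivative:
  assumes f: "continuous_on UNIV f" and d: "\<And>x. x \<noteq> 0 \<Longrightarrow> (f has_vector_derivative f' x) (at x)"
    and li: "locally_integrable f'"
  shows "weak_derivative f f'"
  unfolding weak_derivative_def
proof (intro allI impI)
  fix \<phi> assume "test_function \<phi>"
  then obtain R where R: "0 < R" "\<And>x. (\<phi> has_real_derivative deriv \<phi> x) (at x)"
    "continuous_on UNIV \<phi>" "continuous_on UNIV (deriv \<phi>)"
    "\<And>x. R \<le> \<bar>x\<bar> \<Longrightarrow> \<phi> x = 0" "\<And>x. R \<le> \<bar>x\<bar> \<Longrightarrow> deriv \<phi> x = 0"
    using test_functionD by blast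
  have i1: "integrable lborel (\<lambda>x. f x * of_real (deriv \<phi> x))"
    by (rule locally_integrable_mult_test[OF continuous_imp_locally_integrable[OF f] R(4), of R])
      (simp add: R(6))
  have i2: "integrable lborel (\<lambda>x. f' x * of_real (\<phi> x))"
    by (rule locally_integrable_mult_test[OF li R(3), of R]) (simp add: R(5))
  define g where "g x = f x * of_real (deriv \<phi> x) + f' x * of_real (\<phi> x)" for x
  have "integrable lborel g" unfolding g_def[abs_def] using i1 i2 by simp
  then have 1: "(g has_integral (LINT x|lborel. g x)) UNIV" by (rule has_integral_integral_lborel)
  have "(g has_integral f R * of_real (\<phi> R) - f (- R) * of_real (\<phi> (- R))) {- R..R}"
  proof (rule fundamental_theorem_of_calculus_interior_strong[where S = "{0}"])
    fix x assume "x \<in> {- R<..<R} - {0}"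
    then have "x \<noteq> 0" by simp
    have "((\<lambda>x. complex_of_real (\<phi> x)) has_vector_derivative of_real (deriv \<phi> x)) (at x)"
      using R(2)[of x] by (simp add: has_vector_derivative_complex_iff)
    from has_vector_derivative_mult[OF d[OF \<open>x \<noteq> 0\<close>] this]
    show "((\<lambda>x. f x * of_real (\<phi> x)) has_vector_derivative g x) (at x)"
      by (simp add: g_def)
  next
    show "continuous_on {- R..R} (\<lambda>x. f x * of_real (\<phi> x))"
      by (intro continuous_intros continuous_on_subset[OF f] continuous_on_subset[OF R(3)]) auto
  qed (use R(1) in auto)
  then have "(g has_integral 0) {- R..R}" using R(1) by (simp add: R(5))
  then have "(g has_integral 0) UNIV"
  proof (rule has_integral_on_superset)
    fix x assume "x \<notin> {- R..R}"
    then have "R \<le> \<bar>x\<bar>" by auto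
    then show "g x = 0" by (simp add: g_def R(5,6))
  qed simp
  with 1 have "(LINT x|lborel. g x) = 0" by (rule has_integral_unique)
  then show "(LINT x|lborel. f x * of_real (deriv \<phi> x)) = - (LINT x|lborel. f' x * of_real (\<phi> x))"
    using i1 i2 by (simp add: g_def eq_neg_iff_add_eq_0)
qed

lemma continuous_AE_zero:
  fixes u :: "real \<Rightarrow> complex"
  assumes u: "continuous_on UNIV u" and ae: "AE x in lborel. u x = 0"
  shows "u x = 0"
proof (rule ccontr)
  assume "u x \<noteq> 0"
  moreover have "open {x. u x \<noteq> 0}" by (intro open_Collect_neq u continuous_intros)
  ultimately obtain e where e: "0 < e" "ball x e \<subseteq> {x. u x \<noteq> 0}"
    unfolding open_contains_ball by blast
  from ae obtain N where "{x \<in> space lborel. \<not> u x = 0} \<subseteq> N" "emeasure lborel N = 0" "N \<in> sets lborel"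
    by (rule AE_E)
  then have N: "N \<in> null_sets lborel" "{x. u x \<noteq> 0} \<subseteq> N" by (auto simp: null_sets_def)
  have "{x - e<..<x + e} \<subseteq> N" using e(2) N(2) by (auto simp: subset_eq dist_real_def)
  then have "emeasure lborel {x - e<..<x + e} \<le> emeasure lborel N"
    using N(1) by (intro emeasure_mono) auto
  also have "\<dots> = 0" using N(1) by auto
  finally show False using e(1) by simp
qed

lemma classical_imp_schroedinger_eigenvalue:
  assumes V: "continuous_on UNIV V" and K: "\<And>x. \<bar>V x\<bar> \<le> K"
    and u: "interface_eigenfunction V \<alpha> l u u1"
  shows "schroedinger_eigenvalue (interface_potential V \<alpha>) l"
proof -
  note u = u[unfolded interface_eigenfunction_def]
  define u2 where "u2 x = of_real (interface_potential V \<alpha> x - l) * u x" for x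
  have cu: "continuous_on UNIV u"
    using u by (intro continuous_at_imp_continuous_on ballI has_vector_derivative_continuous) blast
  note [measurable] = borel_measurable_continuous_onI[OF cu] borel_measurable_continuous_onI[OF V]
  have m2: "u2 \<in> borel_measurable borel"
    unfolding u2_def[abs_def] interface_potential_def by measurable
  define C where "C = K + \<bar>\<alpha>\<bar> + \<bar>l\<bar>"
  have C: "\<bar>interface_potential V \<alpha> x - l\<bar> \<le> C" for x
    using K[of x] by (auto simp: interface_potential_def C_def)
  have "integrable lborel (\<lambda>x. (norm (u2 x))\<^sup>2)"
  proof (rule Bochner_Integration.integrable_bound)
    show "integrable lborel (\<lambda>x. C\<^sup>2 * (norm (u x))\<^sup>2)"
      using u by (simp add: square_integrable_def)
    have "(norm (u2 x))\<^sup>2 \<le> C\<^sup>2 * (norm (u x))\<^sup>2" for x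
    proof -
      have "\<bar>interface_potential V \<alpha> x - l\<bar> * norm (u x) \<le> C * norm (u x)"
        by (intro mult_right_mono C) simp
      then have "norm (u2 x) \<le> C * norm (u x)"
        unfolding u2_def norm_mult norm_of_real .
      then have "(norm (u2 x))\<^sup>2 \<le> (C * norm (u x))\<^sup>2"
        by (intro power_mono) simp_all
      then show ?thesis by (simp add: power_mult_distrib)
    qed
    then show "AE x in lborel. norm ((norm (u2 x))\<^sup>2) \<le> norm (C\<^sup>2 * (norm (u x))\<^sup>2)"
      by (intro AE_I2) simp
  qed (use m2 in simp)
  then have s2: "square_integrable u2" using m2 by (simp add: square_integrable_def)
  have "weak_derivative u u1"
    by (rule classical_weak_derivative[OF cu _ continuous_imp_locally_integrable]) (use u in auto)
  moreover have "weak_derivative u1 u2"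
  proof (rule classical_weak_derivative[OF _ _ square_integrable_imp_locally_integrable[OF s2]])
    fix x :: real assume "x \<noteq> 0"
    then show "(u1 has_vector_derivative u2 x) (at x)"
      using u by (cases "0 < x") (auto simp: u2_def interface_potential_def)
  qed (use u in blast)
  ultimately have "sobolev_H2 u u2"
    using u s2 unfolding sobolev_H2_def by blast
  moreover have "\<not> (AE x in lborel. u x = 0)"
    using continuous_AE_zero[OF cu] u by blast
  moreover have "AE x in lborel. - u2 x + of_real (interface_potential V \<alpha> x) * u x = of_real l * u x"
    by (intro AE_I2) (simp add: u2_def algebra_simps)
  ultimately show ?thesis
    unfolding schroedinger_eigenvalue_def by blast
qed

lemma DERIV_glue_at_zero:
  fixes f g :: "real \<Rightarrow> real"
  assumes f: "(f has_real_derivative D) (at 0)" and g: "(g has_real_derivative D) (at 0)" and "f 0 = g 0"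
  shows "((\<lambda>x. if 0 \<le> x then f x else g x) has_real_derivative D) (at 0)"
  unfolding has_field_derivative_iff
proof (rule filterlim_split_at)
  let ?q = "\<lambda>y. ((if 0 \<le> y then f y else g y) - (if 0 \<le> (0::real) then f 0 else g 0)) / (y - 0)"
  have "((\<lambda>y. (g y - g 0) / (y - 0)) \<longlongrightarrow> D) (at_left 0)"
    by (rule tendsto_mono[OF at_le g[unfolded has_field_derivative_iff]]) simp
  moreover have "\<forall>\<^sub>F y in at_left 0. (g y - g 0) / (y - 0) = ?q y"
    unfolding eventually_at_left_field by (rule exI[of _ "- 1"]) (simp add: assms(3))
  ultimately show "(?q \<longlongrightarrow> D) (at_left 0)"
    by (rule Lim_transform_eventually)
  have "((\<lambda>y. (f y - f 0) / (y - 0)) \<longlongrightarrow> D) (at_right 0)"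
    by (rule tendsto_mono[OF at_le f[unfolded has_field_derivative_iff]]) simp
  moreover have "\<forall>\<^sub>F y in at_right 0. (f y - f 0) / (y - 0) = ?q y"
    unfolding eventually_at_right_field by (rule exI[of _ 1]) simp
  ultimately show "(?q \<longlongrightarrow> D) (at_right 0)"
    by (rule Lim_transform_eventually)
qed

subsection \<open>Decaying Floquet solutions\<close>

text \<open>
  With \<open>exp (k p) = 1 / r\<close> for some \<open>r\<close> between \<open>\<bar>\<rho>\<bar>\<close> and \<open>1\<close>, the function \<open>\<bar>g x\<bar> exp (k x)\<close> does not
  grow from one period to the next.
\<close>

lemma geometric_imp_exponential_decay:
  fixes g :: "real \<Rightarrow> real"
  assumes g: "continuous_on UNIV g" and p: "0 < p" and \<rho>: "\<bar>\<rho>\<bar> < 1"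
    and per: "\<And>x. g (x + p) = \<rho> * g x"
  shows "\<exists>C k. 0 < k \<and> (\<forall>x\<ge>0. \<bar>g x\<bar> \<le> C * exp (- k * x))"
proof -
  \<comment> \<open>positive even for \<open>\<rho> = 0\<close>, so that the logarithm is meaningful\<close>
  define r where "r = max \<bar>\<rho>\<bar> (1 / 2)"
  have r: "0 < r" "r < 1" "\<bar>\<rho>\<bar> \<le> r" using \<rho> by (auto simp: r_def)
  define k where "k = - ln r / p"
  have k: "0 < k" using r p by (simp add: k_def divide_neg_pos)
  have kp: "exp (k * p) = inverse r" using p r by (simp add: k_def exp_minus)
  define G where "G x = \<bar>g x\<bar> * exp (k * x)" for x
  have step: "G (x + p) \<le> G x" for x
  proof -
    have "G (x + p) = (\<bar>\<rho>\<bar> * inverse r) * G x"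
      by (simp add: G_def per abs_mult distrib_left exp_add kp)
    also have "\<dots> \<le> 1 * G x"
      using r by (intro mult_right_mono) (auto simp: G_def field_simps)
    finally show ?thesis by simp
  qed
  have "continuous_on {0..p} G"
    unfolding G_def[abs_def] by (intro continuous_intros continuous_on_subset[OF g]) auto
  then obtain M where M: "\<And>x. x \<in> {0..p} \<Longrightarrow> \<bar>G x\<bar> \<le> M"
    using continuous_on_Icc_bounded by blast
  have all: "G (x + real n * p) \<le> M" if "x \<in> {0..p}" for x n
  proof (induction n)
    case 0
    then show ?case using M[OF that] by simp
  next
    case (Suc n)
    have "G (x + real (Suc n) * p) = G ((x + real n * p) + p)" by (simp add: algebra_simps)
    also have "\<dots> \<le> G (x + real n * p)" by (rule step)
    finally show ?case using Suc by simp
  qed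
  have "\<bar>g x\<bar> \<le> M * exp (- k * x)" if "0 \<le> x" for x
  proof -
    define n where "n = nat \<lfloor>x / p\<rfloor>"
    have n: "real n = of_int \<lfloor>x / p\<rfloor>" using that p by (simp add: n_def)
    have "real n \<le> x / p" "x / p \<le> real n + 1" unfolding n by linarith+
    then have "real n * p \<le> x" "x \<le> (real n + 1) * p"
      using p by (simp_all add: pos_le_divide_eq pos_divide_le_eq)
    then have "x - real n * p \<in> {0..p}" by (simp add: algebra_simps)
    from all[OF this, of n] have "G x \<le> M" by simp
    have "\<bar>g x\<bar> = G x * exp (- k * x)"
      by (simp add: G_def mult.assoc exp_minus)
    also have "\<dots> \<le> M * exp (- k * x)" using \<open>G x \<le> M\<close> by (intro mult_right_mono) auto
    finally show ?thesis .
  qed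
  with k show ?thesis by blast
qed

lemma integrable_exp_minus_abs:
  fixes k :: real
  assumes "0 < k"
  shows "integrable lborel (\<lambda>x::real. exp (- k * \<bar>x\<bar>))"
proof -
  define e where "e x = indicator {0..} x * exp (- k * x)" for x :: real
  have "(\<integral>\<^sup>+x. ennreal (exp (- k * x)) * indicator {0..} x \<partial>lborel) = ennreal (0 - (- exp (- k * 0) / k))"
  proof (rule nn_integral_FTC_atLeast)
    show "((\<lambda>x. - exp (- k * x) / k) has_real_derivative exp (- k * x)) (at x)" for x
      using assms by (auto intro!: derivative_eq_intros)
    have "((\<lambda>x. exp (- (k * x))) \<longlongrightarrow> 0) at_top"
      using assms by (intro filterlim_compose[OF exp_at_bot] filterlim_compose[OF filterlim_uminus_at_bot_at_top]
          filterlim_tendsto_pos_mult_at_top[OF tendsto_const] filterlim_ident)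
    from tendsto_mult_right_zero[OF this, of "- inverse k"]
    show "((\<lambda>x. - exp (- k * x) / k) \<longlongrightarrow> 0) at_top" by (simp add: divide_inverse mult.commute)
  qed auto
  moreover have "ennreal (e x) = ennreal (exp (- k * x)) * indicator {0..} x" for x
    by (simp add: e_def indicator_def)
  ultimately have "(\<integral>\<^sup>+x. ennreal (e x) \<partial>lborel) < \<infinity>"
    by simp
  then have e: "integrable lborel e"
    by (intro integrableI_nonneg) (auto simp: e_def[abs_def])
  have "integrable lborel (\<lambda>x. e (0 + (- 1) * x))"
    by (subst lborel_integrable_real_affine_iff) (use e in auto)
  with e have "integrable lborel (\<lambda>x. e x + e (- x))" by simp
  then show ?thesis
  proof (rule Bochner_Integration.integrable_bound)
    show "AE x in lborel. norm (exp (- k * \<bar>x\<bar>)) \<le> norm (e x + e (- x))"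
      by (intro AE_I2) (auto simp: e_def indicator_def abs_if)
  qed simp
qed

lemma exponential_decay_imp_square_integrable:
  fixes f :: "real \<Rightarrow> complex"
  assumes f: "f \<in> borel_measurable borel" and k: "0 < k" and b: "\<And>x. norm (f x) \<le> C * exp (- k * \<bar>x\<bar>)"
  shows "square_integrable f"
proof -
  have "integrable lborel (\<lambda>x::real. C\<^sup>2 * exp (- (2 * k) * \<bar>x\<bar>))"
    using integrable_exp_minus_abs[of "2 * k"] k by (intro integrable_mult_right) simp
  then have "integrable lborel (\<lambda>x. (norm (f x))\<^sup>2)"
  proof (rule Bochner_Integration.integrable_bound)
    have "(norm (f x))\<^sup>2 \<le> C\<^sup>2 * exp (- (2 * k) * \<bar>x\<bar>)" for x
    proof -
      have "(norm (f x))\<^sup>2 \<le> (C * exp (- k * \<bar>x\<bar>))\<^sup>2" by (intro power_mono b) simp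
      also have "\<dots> = C\<^sup>2 * exp (- (2 * k) * \<bar>x\<bar>)"
        by (simp add: power_mult_distrib exp_double[symmetric] flip: mult.assoc)
      finally show ?thesis .
    qed
    then show "AE x in lborel. norm ((norm (f x))\<^sup>2) \<le> norm (C\<^sup>2 * exp (- (2 * k) * \<bar>x\<bar>))"
      by (intro AE_I2) simp
  qed (use f in simp)
  then show ?thesis using f by (simp add: square_integrable_def)
qed

text \<open>
  Slopes \<open>m\<close> at \<open>0\<close> for which \<open>neu + m dir\<close> decays at infinity. The first condition makes it a Floquet
  solution: its values and its derivatives at \<open>h\<close> and \<open>- h\<close> are then in the same ratio
  \<open>(neu + m dir) / (neu - m dir)\<close>. The second condition makes the modulus of this multiplier less
  than \<open>1\<close>.
\<close>

definition decaying_slope :: "(real \<Rightarrow> real) \<Rightarrow> real \<Rightarrow> real \<Rightarrow> real \<Rightarrow> bool" where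
  "decaying_slope V h l m \<longleftrightarrow>
     m\<^sup>2 * (dir V l h * dir' V l h) = neu V l h * neu' V l h \<and> m * neu V l h * dir V l h < 0"

context even_periodic_potential
begin

lemma potential_bounded: "\<exists>K. \<forall>x. \<bar>V x\<bar> \<le> K"
proof -
  obtain K where K: "\<And>x. x \<in> {0..2 * h} \<Longrightarrow> \<bar>V x\<bar> \<le> K"
    using continuous_on_Icc_bounded[OF continuous_on_subset[OF cont]] by blast
  have shift: "V (x + real n * (2 * h)) = V x" for x n
  proof (induction n)
    case (Suc n)
    have "x + real (Suc n) * (2 * h) = (x + real n * (2 * h)) + 2 * h" by (simp add: algebra_simps)
    then show ?case using Suc periodic[of "x + real n * (2 * h)"] by (simp only:)
  qed simp
  have "\<bar>V x\<bar> \<le> K" if "0 \<le> x" for x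
  proof -
    define n where "n = nat \<lfloor>x / (2 * h)\<rfloor>"
    have n: "real n = of_int \<lfloor>x / (2 * h)\<rfloor>" using that h by (simp add: n_def)
    have "real n \<le> x / (2 * h)" "x / (2 * h) \<le> real n + 1" unfolding n by linarith+
    then have "real n * (2 * h) \<le> x" "x \<le> (real n + 1) * (2 * h)"
      using h by (simp_all add: pos_le_divide_eq pos_divide_le_eq)
    then have "x - real n * (2 * h) \<in> {0..2 * h}" by (simp add: algebra_simps)
    then have "\<bar>V (x - real n * (2 * h))\<bar> \<le> K" by (rule K)
    then show ?thesis using shift[of "x - real n * (2 * h)" n] by simp
  qed
  then have "\<bar>V x\<bar> \<le> K" for x
    using even[of x] by (cases "0 \<le> x") (metis, metis le_minus_iff minus_zero nle_le)
  then show ?thesis by blast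
qed

lemma decaying_slope_imp_decay:
  assumes m: "decaying_slope V h l m"
  shows "\<exists>C k. 0 < k \<and> (\<forall>x\<ge>0. \<bar>neu V l x + m * dir V l x\<bar> \<le> C * exp (- k * x) \<and>
    \<bar>neu' V l x + m * dir' V l x\<bar> \<le> C * exp (- k * x))"
proof -
  define w where "w x = neu V l x + m * dir V l x" for x
  define w' where "w' x = neu' V l x + m * dir' V l x" for x
  have w: "hill_solution V l w w'"
    unfolding w_def[abs_def] w'_def[abs_def] by (rule hill_solution_slope[OF cont])
  define N where "N = neu V l h"
  define N' where "N' = neu' V l h"
  define D where "D = dir V l h"
  define D' where "D' = dir' V l h"
  have eq: "m\<^sup>2 * (D * D') = N * N'" and sgn: "m * N * D < 0"
    using m by (simp_all add: decaying_slope_def N_def N'_def D_def D'_def)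
  have diff: "(N + m * D)\<^sup>2 < (N - m * D)\<^sup>2"
    using sgn by (simp add: power2_eq_square algebra_simps)
  then have nz: "N - m * D \<noteq> 0" using zero_le_power2[of "N + m * D"] by auto
  define \<rho> where "\<rho> = (N + m * D) / (N - m * D)"
  have "\<bar>N + m * D\<bar> < \<bar>N - m * D\<bar>" using diff by (simp add: abs_square_less_1 power2_less_imp_less power_strict_mono abs_le_square_iff not_le[symmetric])
  then have r: "\<bar>\<rho>\<bar> < 1" using nz by (simp add: \<rho>_def abs_divide)
  have "(N' + m * D') * (N - m * D) = (N + m * D) * (m * D' - N')"
    using eq by (simp add: power2_eq_square algebra_simps)
  then have p2: "N' + m * D' = \<rho> * (m * D' - N')"
    using nz by (simp add: \<rho>_def field_simps)
  have "w h = \<rho> * w (- h)"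
    using nz by (simp add: w_def neu_parity dir_parity \<rho>_def N_def[symmetric] D_def[symmetric])
  moreover have "w' h = \<rho> * w' (- h)"
    using p2 by (simp add: w'_def neu_parity dir_parity N'_def[symmetric] D'_def[symmetric])
  ultimately have mult: "w (x + 2 * h) = \<rho> * w x" "w' (x + 2 * h) = \<rho> * w' x" for x
    using multiplier_from_half_period[OF w] by blast+
  have h2: "0 < 2 * h" using h by simp
  obtain C1 k1 where 1: "0 < k1" "\<And>x. 0 \<le> x \<Longrightarrow> \<bar>w x\<bar> \<le> C1 * exp (- k1 * x)"
    using geometric_imp_exponential_decay[OF hill_solution_continuous(1)[OF w] h2 r mult(1)] by blast
  obtain C2 k2 where 2: "0 < k2" "\<And>x. 0 \<le> x \<Longrightarrow> \<bar>w' x\<bar> \<le> C2 * exp (- k2 * x)"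
    using geometric_imp_exponential_decay[OF hill_solution_continuous(2)[OF w] h2 r mult(2)] by blast
  have "0 \<le> C1" "0 \<le> C2"
    using 1(2)[of 0] 2(2)[of 0] by (simp_all add: order_trans[OF abs_ge_zero])
  have mono: "c * exp (- k * x) \<le> max C1 C2 * exp (- min k1 k2 * x)"
    if "0 \<le> x" "0 \<le> c" "c \<le> max C1 C2" "min k1 k2 \<le> k" for c k x
    using that by (intro mult_mono) (auto intro!: mult_right_mono)
  have "\<bar>w x\<bar> \<le> max C1 C2 * exp (- min k1 k2 * x) \<and> \<bar>w' x\<bar> \<le> max C1 C2 * exp (- min k1 k2 * x)"
    if "0 \<le> x" for x
    using 1(2)[OF that] 2(2)[OF that] mono[OF that \<open>0 \<le> C1\<close>, of k1] mono[OF that \<open>0 \<le> C2\<close>, of k2]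
    by simp
  then show ?thesis
    using 1(1) 2(1) unfolding w_def w'_def by (intro exI[of _ "max C1 C2"] exI[of _ "min k1 k2"]) simp
qed

lemma half_line_wronskian:
  fixes u u1 :: "real \<Rightarrow> complex"
  assumes u: "\<And>x. 0 < x \<Longrightarrow> (u has_vector_derivative u1 x) (at x)"
    "\<And>x. 0 < x \<Longrightarrow> (u1 has_vector_derivative of_real (V x - l) * u x) (at x)"
    and c: "continuous_on {0..} u" "continuous_on {0..} u1"
    and y: "hill_solution V l y p" and x: "0 \<le> x"
  shows "u x * of_real (p x) - u1 x * of_real (y x) = u 0 * of_real (p 0) - u1 0 * of_real (y 0)"
proof (rule has_derivative_zero_unique_strong_convex[where S = "{0..}" and K = "{0::real}" and x = x])
  have y': "((\<lambda>x. complex_of_real (y x)) has_vector_derivative of_real (p x)) (at x)"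
    "((\<lambda>x. complex_of_real (p x)) has_vector_derivative of_real ((V x - l) * y x)) (at x)" for x
    using hill_solution_DERIV[OF y, of x] by (simp_all add: has_vector_derivative_complex_iff)
  show "continuous_on {0..} (\<lambda>x. u x * of_real (p x) - u1 x * of_real (y x))"
    by (intro continuous_intros c hill_solution_continuous[OF y])
  fix t :: real assume "t \<in> {0..} - {0}"
  then have "((\<lambda>x. u x * of_real (p x) - u1 x * of_real (y x)) has_vector_derivative 0) (at t)"
    using has_vector_derivative_diff[OF has_vector_derivative_mult[OF u(1) y'(2)]
        has_vector_derivative_mult[OF u(2) y'(1)], of t] by (simp add: algebra_simps)
  then show "((\<lambda>x. u x * of_real (p x) - u1 x * of_real (y x)) has_derivative (\<lambda>h. 0)) (at t within {0..})"
    by (simp add: has_vector_derivative_def has_derivative_at_withinI)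
qed (use x in auto)

text \<open>
  The Wronskian of a square integrable solution and the decaying one is constant and integrable on
  the half line, hence zero.
\<close>

lemma square_integrable_slope:
  fixes u u1 :: "real \<Rightarrow> complex"
  assumes u: "\<And>x. 0 < x \<Longrightarrow> (u has_vector_derivative u1 x) (at x)"
    "\<And>x. 0 < x \<Longrightarrow> (u1 has_vector_derivative of_real (V x - l) * u x) (at x)"
    and c: "continuous_on UNIV u" "continuous_on UNIV u1"
    and L2: "square_integrable u" "square_integrable u1"
    and m: "decaying_slope V h l m"
  shows "u1 0 = of_real m * u 0"
proof -
  define w where "w x = neu V l x + m * dir V l x" for x
  define w' where "w' x = neu' V l x + m * dir' V l x" for x
  have w: "hill_solution V l w w'"
    unfolding w_def[abs_def] w'_def[abs_def] by (rule hill_solution_slope[OF cont])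
  have w0: "w 0 = 1" "w' 0 = m"
    by (simp_all add: w_def w'_def neu(2,3)[OF cont] dir(2,3)[OF cont])
  obtain C k where k: "0 < k" "\<And>x. 0 \<le> x \<Longrightarrow> \<bar>w x\<bar> \<le> C * exp (- k * x)"
    "\<And>x. 0 \<le> x \<Longrightarrow> \<bar>w' x\<bar> \<le> C * exp (- k * x)"
    using decaying_slope_imp_decay[OF m] unfolding w_def w'_def by blast
  define E where "E x = (norm (u x))\<^sup>2 + (norm (u1 x))\<^sup>2 + 2 * (C\<^sup>2 * exp (- (2 * k) * \<bar>x\<bar>))" for x
  have E: "integrable lborel E"
    unfolding E_def[abs_def] using L2 integrable_exp_minus_abs[of "2 * k"] k(1)
    by (intro Bochner_Integration.integrable_add integrable_mult_right) (auto simp: square_integrable_def)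
  define K where "K = u 0 * of_real m - u1 0"
  have const: "u x * of_real (w' x) - u1 x * of_real (w x) = K" if "0 \<le> x" for x
    using half_line_wronskian[OF u _ _ w that] continuous_on_subset[OF c(1)] continuous_on_subset[OF c(2)]
    by (simp add: K_def w0)
  have bound: "norm K \<le> E x" if x: "0 \<le> x" for x
  proof -
    have sq: "a\<^sup>2 \<le> C\<^sup>2 * exp (- (2 * k) * \<bar>x\<bar>)" if "\<bar>a\<bar> \<le> C * exp (- k * x)" for a
    proof -
      have "\<bar>a\<bar>\<^sup>2 \<le> (C * exp (- k * x))\<^sup>2" by (intro power_mono that) simp
      also have "\<dots> = C\<^sup>2 * exp (- (2 * k) * \<bar>x\<bar>)"
        using x by (simp add: power_mult_distrib exp_double[symmetric] flip: mult.assoc)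
      finally show ?thesis by simp
    qed
    have "norm K \<le> norm (u x) * \<bar>w' x\<bar> + norm (u1 x) * \<bar>w x\<bar>"
      unfolding const[OF x, symmetric]
      by (rule order_trans[OF norm_triangle_ineq4]) (simp add: norm_mult)
    also have "\<dots> \<le> ((norm (u x))\<^sup>2 + \<bar>w' x\<bar>\<^sup>2) + ((norm (u1 x))\<^sup>2 + \<bar>w x\<bar>\<^sup>2)"
    proof -
      have ab: "a * b \<le> a\<^sup>2 + b\<^sup>2" if "0 \<le> a" "0 \<le> b" for a b :: real
        using sum_squares_bound[of a b] mult_nonneg_nonneg[OF that] by linarith
      show ?thesis
        using ab[of "norm (u x)" "\<bar>w' x\<bar>"] ab[of "norm (u1 x)" "\<bar>w x\<bar>"] by simp
    qed
    also have "\<dots> \<le> E x"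
      using sq[OF k(2)[OF x]] sq[OF k(3)[OF x]] by (simp add: E_def)
    finally show ?thesis .
  qed
  have "K = 0"
  proof (rule ccontr)
    assume "K \<noteq> 0"
    have "integrable lborel (\<lambda>x::real. indicator {0..} x * norm K)"
    proof (rule Bochner_Integration.integrable_bound[OF E])
      have "norm (indicator {0..} x * norm K) \<le> norm (E x)" for x :: real
      proof (cases "0 \<le> x")
        case True
        then show ?thesis using bound[OF True] by simp
      qed simp
      then show "AE x in lborel. norm (indicator {0..} x * norm K) \<le> norm (E x)" by (intro AE_I2)
    qed simp
    then have "integrable lborel (\<lambda>x::real. indicator {0..} x * norm K / norm K)"
      by (rule integrable_divide)
    then have "integrable lborel (indicator {0..} :: real \<Rightarrow> real)"
      using \<open>K \<noteq> 0\<close> by simp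
    then have "emeasure lborel {0::real..} < \<infinity>"
      by (simp add: integrable_indicator_iff)
    moreover have "emeasure lborel {0::real..} = \<infinity>"
    proof (rule ccontr)
      assume fin: "emeasure lborel {0::real..} \<noteq> \<infinity>"
      define M where "M = measure lborel {0::real..}"
      have M0: "0 \<le> M" by (simp add: M_def)
      have "ennreal (M + 1) = emeasure lborel {0..M + 1}" using M0 by simp
      also have "\<dots> \<le> emeasure lborel {0::real..}" by (intro emeasure_mono) auto
      also have "\<dots> = ennreal M" using fin by (simp add: M_def emeasure_eq_ennreal_measure)
      finally show False using M0 by simp
    qed
    ultimately show False by simp
  qed
  then show ?thesis by (simp add: K_def mult.commute)
qed

end

text \<open>
  Continuity of the solution and its derivative at the interface forces the two logarithmic
  derivatives to agree; by parity the one on the left is \<open>- mL\<close>. Conversely, the two decaying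
  solutions with value \<open>1\<close> at \<open>0\<close> then fit together to an eigenfunction.
\<close>

lemma (in even_periodic_potential) schroedinger_eigenvalue_iff_matching:
  assumes mL: "decaying_slope V h l mL" and mR: "decaying_slope V h (l - \<alpha>) mR"
  shows "schroedinger_eigenvalue (interface_potential V \<alpha>) l \<longleftrightarrow> mR = - mL"
proof
  assume "schroedinger_eigenvalue (interface_potential V \<alpha>) l"
  then obtain u u1 where "interface_eigenfunction V \<alpha> l u u1"
    using schroedinger_eigenvalue_imp_classical[OF cont] by blast
  note u = this[unfolded interface_eigenfunction_def]
  have cu: "continuous_on UNIV u"
    using u by (intro continuous_at_imp_continuous_on ballI has_vector_derivative_continuous) blast
  have cu1: "continuous_on UNIV u1" using u by blast
  define v where "v x = u (- x)" for x
  define v1 where "v1 x = - u1 (- x)" for x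
  have cv: "continuous_on UNIV v" and cv1: "continuous_on UNIV v1"
    unfolding v_def[abs_def] v1_def[abs_def]
    by (intro continuous_intros continuous_on_compose2[OF cu] continuous_on_compose2[OF cu1]; simp)+
  have refl: "((\<lambda>x. f (- x)) has_vector_derivative - D) (at x)"
    if "(f has_vector_derivative D) (at (- x))" for f :: "real \<Rightarrow> complex" and D x
  proof -
    have "((\<lambda>x. - x) has_vector_derivative - 1) (at x)" for x :: real
      unfolding has_real_derivative_iff_has_vector_derivative[symmetric]
      by (auto intro!: derivative_eq_intros)
    from vector_diff_chain_at[OF this that] show ?thesis by (simp add: o_def)
  qed
  have R: "0 < x \<Longrightarrow> (u has_vector_derivative u1 x) (at x)"
    "0 < x \<Longrightarrow> (u1 has_vector_derivative of_real (V x - (l - \<alpha>)) * u x) (at x)" for x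
    using u by (auto simp: algebra_simps)
  have L1: "(v has_vector_derivative v1 x) (at x)" if "0 < x" for x
    using refl[of u "u1 (- x)" x] u by (simp add: v_def[abs_def] v1_def)
  have L2: "(v1 has_vector_derivative of_real (V x - l) * v x) (at x)" if "0 < x" for x
  proof -
    have "(u1 has_vector_derivative of_real (V (- x) - l) * u (- x)) (at (- x))" using u that by simp
    from has_vector_derivative_minus[OF refl[OF this]] show ?thesis
      by (simp add: v1_def[abs_def] v_def even)
  qed
  have sq: "square_integrable (\<lambda>x. f (- x))" if f: "square_integrable f" for f
  proof -
    have "integrable lborel (\<lambda>x. (\<lambda>x. (norm (f x))\<^sup>2) (0 + (- 1) * x))"
      by (subst lborel_integrable_real_affine_iff) (use f in \<open>auto simp: square_integrable_def\<close>)
    moreover have "(\<lambda>x. f (- x)) \<in> borel_measurable borel"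
    proof -
      have [measurable]: "f \<in> borel_measurable borel" using f by (simp add: square_integrable_def)
      show ?thesis by measurable
    qed
    ultimately show ?thesis by (simp add: square_integrable_def)
  qed
  have sv1: "square_integrable v1"
    using sq[of u1] u by (simp add: v1_def[abs_def] square_integrable_def)
  have sv: "square_integrable v" using sq[of u] u by (simp add: v_def[abs_def])
  have r: "u1 0 = of_real mR * u 0"
    by (rule square_integrable_slope[OF R cu cu1 _ _ mR]) (use u in auto)
  have l: "v1 0 = of_real mL * v 0"
    by (rule square_integrable_slope[OF L1 L2 cv cv1 sv sv1 mL])
  have "u 0 \<noteq> 0"
  proof
    assume "u 0 = 0"
    then have u0: "u 0 = 0" "u1 0 = 0" and v0: "v 0 = 0" "v1 0 = 0"
      using r by (simp_all add: v_def v1_def)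
    have zero: "f x = 0" if f: "\<And>x. 0 < x \<Longrightarrow> (f has_vector_derivative f1 x) (at x)"
      "\<And>x. 0 < x \<Longrightarrow> (f1 has_vector_derivative of_real (V x - k) * f x) (at x)"
      "continuous_on {0..} f" "continuous_on {0..} f1" "f 0 = 0" "f1 0 = 0" "0 \<le> x" for f f1 :: "real \<Rightarrow> complex" and k x
    proof -
      have "f x * of_real (neu' V k x) - f1 x * of_real (neu V k x) = 0"
        "f x * of_real (dir' V k x) - f1 x * of_real (dir V k x) = 0"
        using half_line_wronskian[OF f(1-4) neu(1)[OF cont] f(7)]
          half_line_wronskian[OF f(1-4) dir(1)[OF cont] f(7)] f(5,6) by simp_all
      moreover have "of_real (neu V k x) * of_real (dir' V k x) -
          of_real (neu' V k x) * of_real (dir V k x) = (1 :: complex)"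
        using neu_dir_wronskian[OF cont, of k x] by (metis of_real_1 of_real_diff of_real_mult)
      ultimately show ?thesis by algebra
    qed
    have "u x = 0" for x
    proof (cases "0 \<le> x")
      case True
      then show ?thesis
        using zero[OF R _ _ u0] continuous_on_subset[OF cu] continuous_on_subset[OF cu1] by blast
    next
      case False
      then have "v (- x) = 0"
        using zero[OF L1 L2 _ _ v0, of "- x"] continuous_on_subset[OF cv] continuous_on_subset[OF cv1]
        by simp
      then show ?thesis by (simp add: v_def)
    qed
    then show False using u by blast
  qed
  moreover have "of_real (mR + mL) * u 0 = 0"
  proof -
    have l': "of_real mL * u 0 = - u1 0" using l by (simp add: v_def v1_def)
    have "of_real (mR + mL) * u 0 = of_real mR * u 0 + of_real mL * u 0" by (simp add: distrib_right)
    then show ?thesis unfolding l' r[symmetric] by simp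
  qed
  ultimately have "of_real (mR + mL) = (0 :: complex)" by simp
  then show "mR = - mL" unfolding of_real_eq_0_iff by simp
next
  assume match: "mR = - mL"
  define y where "y k m x = neu V k x + m * dir V k x" for k m x
  define p where "p k m x = neu' V k x + m * dir' V k x" for k m x
  have yp: "hill_solution V k (y k m) (p k m)" for k m
    unfolding y_def[abs_def] p_def[abs_def] by (rule hill_solution_slope[OF cont])
  have y0: "y k m 0 = 1" "p k m 0 = m" for k m
    by (simp_all add: y_def p_def neu(2,3)[OF cont] dir(2,3)[OF cont])
  have yl: "(y k m has_real_derivative p k m x) (at x)"
    "(p k m has_real_derivative (V x - k) * y k m x) (at x)" for k m x
    using hill_solution_DERIV[OF yp] by blast+
  have yr: "((\<lambda>x. y k m (- x)) has_real_derivative - p k m (- x)) (at x)"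
    "((\<lambda>x. - p k m (- x)) has_real_derivative (V x - k) * y k m (- x)) (at x)" for k m x
    using hill_solution_flip[OF yp, of 0 k m] unfolding hill_solution_def by (simp_all add: even)
  define w where "w x = (if 0 \<le> x then y (l - \<alpha>) mR x else y l mL (- x))" for x
  define w1 where "w1 x = (if 0 \<le> x then p (l - \<alpha>) mR x else - p l mL (- x))" for x
  have dw: "(w has_real_derivative w1 x) (at x)" for x
  proof -
    consider "0 < x" | "x < 0" | "x = 0" by linarith
    then show ?thesis
    proof cases
      case 1
      show ?thesis
        by (rule has_field_derivative_transform_within_open[of "y (l - \<alpha>) mR" _ _ "{0<..}"])
          (use 1 yl(1)[of "l - \<alpha>" mR x] in \<open>auto simp: w_def w1_def\<close>)
    next
      case 2
      show ?thesis
        by (rule has_field_derivative_transform_within_open[of "\<lambda>x. y l mL (- x)" _ _ "{..<0}"])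
          (use 2 yr(1)[of l mL x] in \<open>auto simp: w_def w1_def\<close>)
    next
      case 3
      show ?thesis
        unfolding w_def[abs_def] 3
        using DERIV_glue_at_zero[of "y (l - \<alpha>) mR" mR "\<lambda>x. y l mL (- x)"] yl(1)[of "l - \<alpha>" mR 0] yr(1)[of l mL 0]
        by (simp add: y0 w1_def match)
    qed
  qed
  have d1: "(w1 has_real_derivative (V x + \<alpha> - l) * w x) (at x)" if "0 < x" for x
    by (rule has_field_derivative_transform_within_open[of "p (l - \<alpha>) mR" _ _ "{0<..}"])
      (use that yl(2)[of "l - \<alpha>" mR x] in \<open>auto simp: w_def w1_def algebra_simps\<close>)
  have d2: "(w1 has_real_derivative (V x - l) * w x) (at x)" if "x < 0" for x
    by (rule has_field_derivative_transform_within_open[of "\<lambda>x. - p l mL (- x)" _ _ "{..<0}"])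
      (use that yr(2)[of l mL x] in \<open>auto simp: w_def w1_def\<close>)
  have cw: "continuous_on UNIV w" using dw by (rule DERIV_continuous_on)
  have cw1: "continuous_on UNIV w1"
  proof -
    have "continuous_on ({0..} \<union> {..0}) (\<lambda>x. if 0 \<le> x then p (l - \<alpha>) mR x else - p l mL (- x))"
      by (rule continuous_on_If)
        (auto simp: y0 match intro!: continuous_intros hill_solution_continuous(2)[OF yp]
          continuous_on_compose2[OF hill_solution_continuous(2)[OF yp]])
    moreover have "{0::real..} \<union> {..0} = UNIV" by auto
    ultimately show ?thesis by (simp add: w1_def[abs_def])
  qed
  obtain C1 k1 where 1: "0 < k1" "\<And>x. 0 \<le> x \<Longrightarrow> \<bar>y (l - \<alpha>) mR x\<bar> \<le> C1 * exp (- k1 * x)"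
    "\<And>x. 0 \<le> x \<Longrightarrow> \<bar>p (l - \<alpha>) mR x\<bar> \<le> C1 * exp (- k1 * x)"
    using decaying_slope_imp_decay[OF mR] unfolding y_def p_def by blast
  obtain C2 k2 where 2: "0 < k2" "\<And>x. 0 \<le> x \<Longrightarrow> \<bar>y l mL x\<bar> \<le> C2 * exp (- k2 * x)"
    "\<And>x. 0 \<le> x \<Longrightarrow> \<bar>p l mL x\<bar> \<le> C2 * exp (- k2 * x)"
    using decaying_slope_imp_decay[OF mL] unfolding y_def p_def by blast
  define C where "C = max C1 C2"
  define k where "k = min k1 k2"
  have C: "0 \<le> C1" "0 \<le> C2"
    using 1(2)[of 0] 2(2)[of 0] by (simp_all add: y0)
  have mono: "c * exp (- q * x) \<le> C * exp (- k * x)" if "0 \<le> x" "0 \<le> c" "c \<le> C" "k \<le> q" for c q x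
    using that by (intro mult_mono) (auto intro!: mult_right_mono)
  have bound: "\<bar>w x\<bar> \<le> C * exp (- k * \<bar>x\<bar>) \<and> \<bar>w1 x\<bar> \<le> C * exp (- k * \<bar>x\<bar>)" for x
  proof (cases "0 \<le> x")
    case True
    then show ?thesis
      using 1(2,3)[OF True] mono[OF True C(1), of k1] by (simp add: w_def w1_def C_def k_def)
  next
    case False
    then have "0 \<le> - x" by simp
    then show ?thesis
      using 2(2,3)[OF \<open>0 \<le> - x\<close>] mono[OF \<open>0 \<le> - x\<close> C(2), of k2] False
      by (simp add: w_def w1_def C_def k_def)
  qed
  have k: "0 < k" using 1(1) 2(1) by (simp add: k_def)
  have "interface_eigenfunction V \<alpha> l (\<lambda>x. of_real (w x)) (\<lambda>x. of_real (w1 x))"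
    unfolding interface_eigenfunction_def
  proof (intro conjI allI impI)
    show "((\<lambda>x. complex_of_real (w x)) has_vector_derivative of_real (w1 x)) (at x)" for x
      using dw[of x] by (simp add: has_vector_derivative_complex_iff)
    show "continuous_on UNIV (\<lambda>x. complex_of_real (w1 x))" by (intro continuous_intros cw1)
    show "((\<lambda>x. complex_of_real (w1 x)) has_vector_derivative of_real (V x + \<alpha> - l) * of_real (w x)) (at x)"
      if "0 < x" for x
      using d1[OF that] by (simp add: has_vector_derivative_complex_iff)
    show "((\<lambda>x. complex_of_real (w1 x)) has_vector_derivative of_real (V x - l) * of_real (w x)) (at x)"
      if "x < 0" for x
      using d2[OF that] by (simp add: has_vector_derivative_complex_iff)
    show "square_integrable (\<lambda>x. complex_of_real (w x))"
      by (rule exponential_decay_imp_square_integrable[OF _ k, of _ C])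
        (use bound borel_measurable_continuous_onI[OF cw] in auto)
    show "square_integrable (\<lambda>x. complex_of_real (w1 x))"
      by (rule exponential_decay_imp_square_integrable[OF _ k, of _ C])
        (use bound borel_measurable_continuous_onI[OF cw1] in auto)
    show "\<exists>x. complex_of_real (w x) \<noteq> 0"
      by (rule exI[of _ 0]) (simp add: w_def y0)
  qed
  moreover obtain K where K: "\<And>x. \<bar>V x\<bar> \<le> K"
    using potential_bounded by blast
  ultimately show "schroedinger_eigenvalue (interface_potential V \<alpha>) l"
    using classical_imp_schroedinger_eigenvalue[OF cont K] by blast
qed

section \<open>Matching across the interface\<close>

text \<open>
  The square of the slope at \<open>0\<close> of the decaying solutions.
\<close>

definition slope_square :: "(real \<Rightarrow> real) \<Rightarrow> real \<Rightarrow> real \<Rightarrow> real" where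
  "slope_square V h l = (neu V l h * neu' V l h) / (dir V l h * dir' V l h)"

lemma decaying_slopeI:
  assumes "0 < slope_square V h l" and "s * neu V l h * dir V l h < 0" and "\<bar>s\<bar> = 1"
  shows "decaying_slope V h l (s * sqrt (slope_square V h l))"
proof -
  have nz: "dir V l h * dir' V l h \<noteq> 0" using assms(1) by (auto simp: slope_square_def)
  have "s\<^sup>2 = 1" using assms(3) by (metis one_power2 power2_abs)
  then have "(s * sqrt (slope_square V h l))\<^sup>2 = slope_square V h l"
    using assms(1) by (simp add: power_mult_distrib)
  then have "(s * sqrt (slope_square V h l))\<^sup>2 * (dir V l h * dir' V l h) = neu V l h * neu' V l h"
    using nz by (simp add: slope_square_def)
  moreover have "s * sqrt (slope_square V h l) * neu V l h * dir V l h < 0"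
  proof -
    have "0 < sqrt (slope_square V h l)" using assms(1) by simp
    from mult_pos_neg[OF this assms(2)]
    have "sqrt (slope_square V h l) * (s * neu V l h * dir V l h) < 0" .
    then show ?thesis by (simp only: ac_simps)
  qed
  ultimately show ?thesis unfolding decaying_slope_def by blast
qed

lemma product_less_of_quotients_less:
  fixes a1 :: real
  assumes "0 < d1" "0 < d2" "0 < d1'" "0 < d2'" "0 < a1" "0 < a2" "0 < b1" "0 < b2"
    and "a2 * d1 < a1 * d2" "b2 * d1' < b1 * d2'"
  shows "(a2 * b2) / (d2 * d2') < (a1 * b1) / (d1 * d1')"
proof -
  have "a2 / d2 < a1 / d1" "b2 / d2' < b1 / d1'"
    using assms by (simp_all add: divide_less_eq less_divide_eq field_simps)
  then have "(a2 / d2) * (b2 / d2') < (a1 / d1) * (b1 / d1')"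
    using assms by (intro mult_strict_mono) auto
  then show ?thesis by (simp add: times_divide_times_eq)
qed

context even_periodic_potential
begin

lemma slope_below_band:
  assumes c: "lowest_NN V h c" and l: "l < c"
  shows "0 < slope_square V h l" "decaying_slope V h l (- sqrt (slope_square V h l))"
proof -
  note s = transfer_signs_up_to_NN[OF cont h c less_imp_le[OF l]]
  have s5: "0 < neu' V l h" using s(5) l by blast
  show 1: "0 < slope_square V h l" using s(1,3,4) s5 by (simp add: slope_square_def)
  show "decaying_slope V h l (- sqrt (slope_square V h l))"
    using decaying_slopeI[OF 1, of "- 1"] s(1,3) by (simp add: zero_less_mult_iff)
qed

lemma slope_between_ND_DN:
  assumes a: "lowest_ND V h a" and b: "lowest_ND (\<lambda>x. V (h - x)) h b" and l: "a < l" "l < b"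
  shows "0 < slope_square V h l" "decaying_slope V h l (sqrt (slope_square V h l))"
proof -
  note s = transfer_signs_between[OF cont h a b l(1) less_imp_le[OF l(2)]]
  have s5: "0 < dir' V l h" using s(5) l by blast
  show 1: "0 < slope_square V h l"
    using s(1-3) s5 by (simp add: slope_square_def mult_neg_neg zero_less_divide_iff)
  show "decaying_slope V h l (sqrt (slope_square V h l))"
    using decaying_slopeI[OF 1, of 1] s(1,3) by (simp add: mult_neg_pos)
qed

lemma transfer_signs_between_DN_ND:
  assumes a: "lowest_ND V h a" and b: "lowest_ND (\<lambda>x. V (h - x)) h b" and l: "b < l" "l \<le> a"
  shows "dir' V l h < 0" "neu' V l h < 0" "0 < dir V l h" and "l < a \<Longrightarrow> 0 < neu V l h"
proof -
  define U where "U = (\<lambda>x. V (h - x))"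
  have U: "continuous_on UNIV U"
    unfolding U_def by (rule flip_continuous[OF cont])
  have a': "lowest_ND (\<lambda>x. U (h - x)) h a" using a by (simp add: U_def)
  note s = transfer_signs_between[OF U h b[folded U_def] a' l]
  note fl = flip_transfer[OF cont, of h, folded U_def]
  show "dir' V l h < 0" "neu' V l h < 0" "0 < dir V l h" using s(1-3) by (simp_all add: fl)
  show "0 < neu V l h" if "l < a" using s(5)[OF that] by (simp add: fl)
qed

lemma slope_between_DN_ND:
  assumes a: "lowest_ND V h a" and b: "lowest_ND (\<lambda>x. V (h - x)) h b" and l: "b < l" "l < a"
  shows "0 < slope_square V h l" "decaying_slope V h l (- sqrt (slope_square V h l))"
proof -
  note s = transfer_signs_between_DN_ND[OF a b l(1) less_imp_le[OF l(2)]]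
  have s4: "0 < neu V l h" using s(4) l by blast
  show 1: "0 < slope_square V h l"
    using s(1-3) s4 by (simp add: slope_square_def zero_less_divide_iff mult_pos_neg mult_neg_pos)
  show "decaying_slope V h l (- sqrt (slope_square V h l))"
    using decaying_slopeI[OF 1, of "- 1"] s(3) s4 by (simp add: zero_less_mult_iff)
qed

text \<open>
  Existence: after clearing denominators the equation has opposite signs at the two ends of the
  admissible interval, since at each end a vanishing boundary value removes one of the two terms.
  Uniqueness: both boundary quotients decrease, so \<open>slope_square\<close> increases in the gap above the first band, where
  they are negative, and decreases below the spectrum, where they are positive.
\<close>

lemma unique_matching_energy:
  assumes a: "lowest_ND V h a" and b: "lowest_ND (\<lambda>x. V (h - x)) h b" and c: "lowest_NN V h c"
    and ab: "a < b" and a': "0 < dir' V a h" and \<beta>: "a - c < \<beta>" "0 < \<beta>"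
  shows "\<exists>!x. (a < x \<and> x < b \<and> x - \<beta> < c) \<and> slope_square V h x = slope_square V h (x - \<beta>)"
proof (rule ex_ex1I)
  define F where "F x = (neu V x h * neu' V x h) * (dir V (x - \<beta>) h * dir' V (x - \<beta>) h)
    - (neu V (x - \<beta>) h * neu' V (x - \<beta>) h) * (dir V x h * dir' V x h)" for x
  note gap = transfer_signs_between[OF cont h a b]
  note low = transfer_signs_up_to_NN[OF cont h c]
  \<comment> \<open>right end of the admissible interval\<close>
  define e where "e = min b (c + \<beta>)"
  have e: "a < e" "e \<le> b" "e - \<beta> \<le> c" using ab \<beta> by (auto simp: e_def)
  have "F a < 0"
  proof -
    have y: "a - \<beta> < c" using \<beta> by simp
    have "0 < dir V a h"
      by (rule dir_pos_of_neu_pos[OF cont h]) (use a in \<open>simp add: lowest_ND_def\<close>)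
    moreover have "neu V a h = 0" using a by (simp add: lowest_ND_def)
    moreover have "0 < neu V (a - \<beta>) h" "0 < neu' V (a - \<beta>) h"
      using low(1)[OF less_imp_le[OF y]] low(5)[OF less_imp_le[OF y] y] by auto
    ultimately show ?thesis using a' by (simp add: F_def)
  qed
  moreover have "0 < F e"
  proof -
    have z0: "neu V (e - \<beta>) h * neu' V (e - \<beta>) h * (dir V e h * dir' V e h) = 0"
    proof (cases "b \<le> c + \<beta>")
      case True
      then have "e = b" by (simp add: e_def)
      moreover have "dir' V b h = 0" using b flip_transfer(1)[OF cont, of h b] by (simp add: lowest_ND_def)
      ultimately show ?thesis by simp
    next
      case False
      then have "e - \<beta> = c" by (simp add: e_def)
      moreover have "neu' V c h = 0" using c by (simp add: lowest_NN_def)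
      ultimately show ?thesis by simp
    qed
    have p1: "0 < neu V e h * neu' V e h"
      using gap(1,2)[OF e(1,2)] by (rule mult_neg_neg)
    have p2: "0 < dir V (e - \<beta>) h * dir' V (e - \<beta>) h"
      using low(3,4)[OF e(3)] by (rule mult_pos_pos)
    show ?thesis unfolding F_def z0 using mult_pos_pos[OF p1 p2] by simp
  qed
  moreover have "continuous_on {a..e} F"
  proof -
    have cf: "continuous_on S (\<lambda>l. neu V l h)" "continuous_on S (\<lambda>l. neu' V l h)"
      "continuous_on S (\<lambda>l. dir V l h)" "continuous_on S (\<lambda>l. dir' V l h)" for S
      using isCont_in_parameter[OF cont less_imp_le[OF h]]
      by (auto intro: continuous_at_imp_continuous_on)
    have "continuous_on S (\<lambda>l. neu V (l - \<beta>) h)" "continuous_on S (\<lambda>l. neu' V (l - \<beta>) h)"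
      "continuous_on S (\<lambda>l. dir V (l - \<beta>) h)" "continuous_on S (\<lambda>l. dir' V (l - \<beta>) h)" for S
      by (rule continuous_on_compose2[OF cf(1)[of UNIV]] continuous_on_compose2[OF cf(2)[of UNIV]]
          continuous_on_compose2[OF cf(3)[of UNIV]] continuous_on_compose2[OF cf(4)[of UNIV]];
          auto intro!: continuous_intros)+
    then show ?thesis unfolding F_def[abs_def] by (intro continuous_intros cf)
  qed
  ultimately obtain x where x: "a \<le> x" "x \<le> e" "F x = 0"
    using IVT'[of F a 0 e] e(1) by auto
  then have "x \<noteq> a" "x \<noteq> e" using \<open>F a < 0\<close> \<open>0 < F e\<close> by auto
  with x e have x': "a < x" "x < b" "x - \<beta> < c" by auto
  have "dir V x h * dir' V x h \<noteq> 0" "dir V (x - \<beta>) h * dir' V (x - \<beta>) h \<noteq> 0"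
    using slope_between_ND_DN(1)[OF a b x'(1,2)] slope_below_band(1)[OF c x'(3)]
    unfolding slope_square_def by auto
  then have "slope_square V h x = slope_square V h (x - \<beta>)"
    using x(3) unfolding slope_square_def F_def by (simp add: frac_eq_eq)
  with x' show "\<exists>x. (a < x \<and> x < b \<and> x - \<beta> < c) \<and> slope_square V h x = slope_square V h (x - \<beta>)"
    by blast
next
  have no: False if x: "a < x" "x - \<beta> < c" "slope_square V h x = slope_square V h (x - \<beta>)"
    and z: "z < b" "z - \<beta> < c" "slope_square V h z = slope_square V h (z - \<beta>)" and xz: "x < z" for x z
  proof -
    have b1: "x < b" "a < z" using xz z x by auto
    have cb: "c < b"
    proof (rule ccontr)
      assume "\<not> c < b"
      then have "0 < dir' V b h" using transfer_signs_up_to_NN(4)[OF cont h c] by simp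
      then show False using b flip_transfer(1)[OF cont, of h b] by (simp add: lowest_ND_def)
    qed
    note sx = transfer_signs_between[OF cont h a b x(1) less_imp_le[OF b1(1)]]
    note sz = transfer_signs_between[OF cont h a b b1(2) less_imp_le[OF z(1)]]
    note tx = transfer_signs_up_to_NN[OF cont h c less_imp_le[OF x(2)]]
    note tz = transfer_signs_up_to_NN[OF cont h c less_imp_le[OF z(2)]]
    note q = boundary_quotients_decreasing[OF cont h b xz z(1)]
    have lt: "x - \<beta> < z - \<beta>" "z - \<beta> < b" using xz z(2) cb by auto
    note q' = boundary_quotients_decreasing[OF cont h b lt]
    have "(- neu V x h * - neu' V x h) / (dir V x h * dir' V x h)
        < (- neu V z h * - neu' V z h) / (dir V z h * dir' V z h)"
      by (rule product_less_of_quotients_less)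
        (use sx(1-3) sx(5)[OF b1(1)] sz(1-3) sz(5)[OF z(1)] q in auto)
    then have "slope_square V h x < slope_square V h z" by (simp add: slope_square_def)
    moreover have "slope_square V h (z - \<beta>) < slope_square V h (x - \<beta>)"
      unfolding slope_square_def
      by (rule product_less_of_quotients_less)
        (use tx(1,3,4) tx(5)[OF x(2)] tz(1,3,4) tz(5)[OF z(2)] q' in auto)
    ultimately show False using x(3) z(3) by simp
  qed
  fix x z
  assume "(a < x \<and> x < b \<and> x - \<beta> < c) \<and> slope_square V h x = slope_square V h (x - \<beta>)"
    and "(a < z \<and> z < b \<and> z - \<beta> < c) \<and> slope_square V h z = slope_square V h (z - \<beta>)"
  then show "x = z" using no[of x z] no[of z x] by (meson linorder_neqE)
qed

text \<open>
  For both signs of \<open>\<alpha>\<close> one of the two energies, \<open>x\<close>, lies in the first gap and the other one is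
  \<open>x - \<bar>\<alpha>\<bar>\<close>; only their roles as \<open>l\<close> and \<open>l - \<alpha>\<close> are exchanged.
\<close>

lemma eigenvalues_increasing:
  assumes mono: "\<And>x y. 0 \<le> x \<Longrightarrow> x < y \<Longrightarrow> y \<le> h \<Longrightarrow> V x < V y"
    and \<alpha>: "\<bar>\<alpha>\<bar> > band_edge (2 * h) V 2 - band_edge (2 * h) V 1"
  shows "\<alpha> > 0 \<Longrightarrow> \<exists>!l. (band_edge (2 * h) V 2 < l \<and> l < band_edge (2 * h) V 3 \<and>
      l - \<alpha> < band_edge (2 * h) V 1) \<and> schroedinger_eigenvalue (interface_potential V \<alpha>) l"
    and "\<alpha> < 0 \<Longrightarrow> \<exists>!l. (band_edge (2 * h) V 2 < l - \<alpha> \<and> l - \<alpha> < band_edge (2 * h) V 3 \<and>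
      l < band_edge (2 * h) V 1) \<and> schroedinger_eigenvalue (interface_potential V \<alpha>) l"
proof -
  have U: "continuous_on UNIV (\<lambda>x. V (h - x))"
    by (rule flip_continuous[OF cont])
  obtain a b where a: "lowest_ND V h a" and b: "lowest_ND (\<lambda>x. V (h - x)) h b"
    using lowest_ND_exists[OF cont h] lowest_ND_exists[OF U h] by blast
  obtain c where c: "lowest_NN V h c" using lowest_NN_exists[OF cont h a] by blast
  have ab: "a < b" "0 < dir' V a h"
    using ND_less_DN[OF cont h a b mono] by blast+
  note signs = transfer_signs_between[OF cont h a b]
  have zeros: "neu V a h = 0" "dir' V b h = 0"
    using a b flip_transfer(1)[OF cont, of h b] by (simp_all add: lowest_ND_def)
  have "neu V l h \<noteq> 0 \<and> dir' V l h \<noteq> 0" if "l < b" "l \<noteq> a" for l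
  proof (cases "l < a")
    case True
    then show ?thesis
      using neu_pos_below_ND[OF cont h a True, of h] dir'_pos_below[OF cont h b that(1)] h by simp
  next
    case False
    then have "a < l" "l \<le> b" using that by auto
    from signs(1,5)[OF this] that(1) show ?thesis by auto
  qed
  moreover have "neu V b h \<noteq> 0" using signs(1)[of b] ab(1) by auto
  ultimately have edges: "band_edge (2 * h) V 1 = c" "band_edge (2 * h) V 2 = a" "band_edge (2 * h) V 3 = b"
    using band_edge_1[OF c] band_edges_2_3[OF ab(1)] zeros ab(2) by auto
  note up = slope_between_ND_DN[OF a b] and low = slope_below_band[OF c]
  have U1: "\<exists>!x. (a < x \<and> x < b \<and> x - \<bar>\<alpha>\<bar> < c) \<and> slope_square V h x = slope_square V h (x - \<bar>\<alpha>\<bar>)"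
    if "\<alpha> \<noteq> 0"
    using unique_matching_energy[OF a b c ab, of "\<bar>\<alpha>\<bar>"] \<alpha> that unfolding edges by simp
  have ev1: "schroedinger_eigenvalue (interface_potential V \<alpha>) l \<longleftrightarrow>
      slope_square V h l = slope_square V h (l - \<alpha>)" if "a < l" "l < b" "l - \<alpha> < c" for l
    using schroedinger_eigenvalue_iff_matching[OF up(2)[OF that(1,2)] low(2)[OF that(3)]] by auto
  have ev2: "schroedinger_eigenvalue (interface_potential V \<alpha>) l \<longleftrightarrow>
      slope_square V h (l - \<alpha>) = slope_square V h l" if "a < l - \<alpha>" "l - \<alpha> < b" "l < c" for l
    using schroedinger_eigenvalue_iff_matching[OF low(2)[OF that(3)] up(2)[OF that(1,2)]] by simp
  {
    assume pos: "\<alpha> > 0"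
    then have "\<exists>!x. (a < x \<and> x < b \<and> x - \<alpha> < c) \<and> slope_square V h x = slope_square V h (x - \<alpha>)"
      using U1 by simp
    then show "\<exists>!l. (band_edge (2 * h) V 2 < l \<and> l < band_edge (2 * h) V 3 \<and>
        l - \<alpha> < band_edge (2 * h) V 1) \<and> schroedinger_eigenvalue (interface_potential V \<alpha>) l"
      unfolding edges using ev1 by (simp cong: conj_cong)
  next
    assume neg: "\<alpha> < 0"
    then have "\<exists>!x. (a < x \<and> x < b \<and> x + \<alpha> < c) \<and> slope_square V h x = slope_square V h (x + \<alpha>)"
      using U1 by simp
    then obtain x where x: "a < x" "x < b" "x + \<alpha> < c" "slope_square V h x = slope_square V h (x + \<alpha>)"
      and un: "\<And>z. a < z \<Longrightarrow> z < b \<Longrightarrow> z + \<alpha> < c \<Longrightarrow> slope_square V h z = slope_square V h (z + \<alpha>) \<Longrightarrow> z = x"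
      by blast
    show "\<exists>!l. (band_edge (2 * h) V 2 < l - \<alpha> \<and> l - \<alpha> < band_edge (2 * h) V 3 \<and>
        l < band_edge (2 * h) V 1) \<and> schroedinger_eigenvalue (interface_potential V \<alpha>) l"
      unfolding edges
    proof (rule ex1I[of _ "x + \<alpha>"])
      show "(a < x + \<alpha> - \<alpha> \<and> x + \<alpha> - \<alpha> < b \<and> x + \<alpha> < c) \<and>
          schroedinger_eigenvalue (interface_potential V \<alpha>) (x + \<alpha>)"
        using ev2[of "x + \<alpha>"] x by simp
      fix l assume l: "(a < l - \<alpha> \<and> l - \<alpha> < b \<and> l < c) \<and>
          schroedinger_eigenvalue (interface_potential V \<alpha>) l"
      then have "l - \<alpha> = x" using ev2[of l] by (intro un) auto
      then show "l = x + \<alpha>" by simp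
    qed
  }
qed

text \<open>
  Both slopes are negative square roots here, so they cannot be opposite.
\<close>

lemma no_eigenvalues_decreasing:
  assumes anti: "\<And>x y. 0 \<le> x \<Longrightarrow> x < y \<Longrightarrow> y \<le> h \<Longrightarrow> V y < V x"
  shows "band_edge (2 * h) V 2 < l \<Longrightarrow> l < band_edge (2 * h) V 3 \<Longrightarrow> l - \<alpha> < band_edge (2 * h) V 1 \<Longrightarrow>
      \<not> schroedinger_eigenvalue (interface_potential V \<alpha>) l"
    and "band_edge (2 * h) V 2 < l - \<alpha> \<Longrightarrow> l - \<alpha> < band_edge (2 * h) V 3 \<Longrightarrow> l < band_edge (2 * h) V 1 \<Longrightarrow>
      \<not> schroedinger_eigenvalue (interface_potential V \<alpha>) l"
proof -
  define U where "U = (\<lambda>x. V (h - x))"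
  have U: "continuous_on UNIV U"
    unfolding U_def by (rule flip_continuous[OF cont])
  obtain a b where a: "lowest_ND V h a" and bU: "lowest_ND U h b"
    using lowest_ND_exists[OF cont h] lowest_ND_exists[OF U h] by blast
  have b: "lowest_ND (\<lambda>x. V (h - x)) h b" using bU by (simp add: U_def)
  have aU: "lowest_ND (\<lambda>x. U (h - x)) h a" using a by (simp add: U_def)
  obtain c where c: "lowest_NN V h c" using lowest_NN_exists[OF cont h a] by blast
  have monoU: "U x < U y" if "0 \<le> x" "x < y" "y \<le> h" for x y
    unfolding U_def using anti[of "h - y" "h - x"] that by simp
  have ba: "b < a" "0 < dir' U b h" using ND_less_DN[OF U h bU aU monoU] by blast+
  then have nb: "0 < neu V b h" by (simp add: flip_transfer[OF cont] U_def)
  note signs = transfer_signs_between_DN_ND[OF a b]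
  have zeros: "neu V a h = 0" "dir' V b h = 0"
    using a b flip_transfer(1)[OF cont, of h b] by (simp_all add: lowest_ND_def)
  have "neu V l h \<noteq> 0 \<and> dir' V l h \<noteq> 0" if "l < a" "l \<noteq> b" for l
  proof (cases "l < b")
    case True
    then show ?thesis
      using neu_pos_below_ND[OF cont h a that(1), of h] dir'_pos_below[OF cont h b True] h by simp
  next
    case False
    then have "b < l" "l \<le> a" using that by auto
    from signs(1,4)[OF this] that(1) show ?thesis by auto
  qed
  moreover have "dir' V a h \<noteq> 0" using signs(1)[of a] ba(1) by auto
  ultimately have edges: "band_edge (2 * h) V 1 = c" "band_edge (2 * h) V 2 = b" "band_edge (2 * h) V 3 = a"
    using band_edge_1[OF c] band_edges_2_3[OF ba(1)] zeros nb by auto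
  note up = slope_between_DN_ND[OF a b] and low = slope_below_band[OF c]
  have no: "- sqrt s \<noteq> - (- sqrt t)" if "0 < s" "0 < t" for s t
    using that by (smt (verit) real_sqrt_gt_0_iff)
  {
    assume "band_edge (2 * h) V 2 < l" "l < band_edge (2 * h) V 3" "l - \<alpha> < band_edge (2 * h) V 1"
    then have *: "b < l" "l < a" "l - \<alpha> < c" unfolding edges by blast+
    show "\<not> schroedinger_eigenvalue (interface_potential V \<alpha>) l"
      using schroedinger_eigenvalue_iff_matching[OF up(2)[OF *(1,2)] low(2)[OF *(3)]]
        no[OF low(1)[OF *(3)] up(1)[OF *(1,2)]] by blast
  next
    assume "band_edge (2 * h) V 2 < l - \<alpha>" "l - \<alpha> < band_edge (2 * h) V 3" "l < band_edge (2 * h) V 1"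
    then have *: "b < l - \<alpha>" "l - \<alpha> < a" "l < c" unfolding edges by blast+
    show "\<not> schroedinger_eigenvalue (interface_potential V \<alpha>) l"
      using schroedinger_eigenvalue_iff_matching[OF low(2)[OF *(3)] up(2)[OF *(1,2)]]
        no[OF up(1)[OF *(1,2)] low(1)[OF *(3)]] by blast
  }
qed

end

lemma mem_shift_set: "l \<in> shift_set G \<alpha> \<longleftrightarrow> l - \<alpha> \<in> G"
  by (auto simp: shift_set_def intro!: exI[of _ "l - \<alpha>"])

theorem corollary3p6:
  fixes d \<alpha> :: real and V0 :: "real \<Rightarrow> real"
  assumes "d > 0"
    and "continuous_on UNIV V0"
    and "\<And>x. V0 (- x) = V0 x"
    and "\<And>x. V0 (x + d) = V0 x"
    and "\<bar>\<alpha>\<bar> > band_edge d V0 2 - band_edge d V0 1"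
  defines "V \<equiv> interface_potential V0 \<alpha>"
    and "G \<equiv> spectral_gap d V0"
  shows "(strict_mono_on {0..d/2} V0 \<longrightarrow>
            (\<alpha> > 0 \<longrightarrow> (\<exists>!l. l \<in> G 1 \<inter> shift_set (G 0) \<alpha> \<and> schroedinger_eigenvalue V l)) \<and>
            (\<alpha> < 0 \<longrightarrow> (\<exists>!l. l \<in> G 0 \<inter> shift_set (G 1) \<alpha> \<and> schroedinger_eigenvalue V l))) \<and>
         (strict_antimono_on {0..d/2} V0 \<longrightarrow>
            (\<alpha> > 0 \<longrightarrow> \<not> (\<exists>l. l \<in> G 1 \<inter> shift_set (G 0) \<alpha> \<and> schroedinger_eigenvalue V l)) \<and>
            (\<alpha> < 0 \<longrightarrow> \<not> (\<exists>l. l \<in> G 0 \<inter> shift_set (G 1) \<alpha> \<and> schroedinger_eigenvalue V l)))"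
proof -
  interpret even_periodic_potential V0 "d / 2"
    by unfold_locales (use assms(1-4) in simp_all)
  have d: "2 * (d / 2) = d" by simp
  have G0: "l \<in> G 0 \<longleftrightarrow> l < band_edge d V0 1" for l
    by (simp add: G_def spectral_gap_def)
  have G1: "l \<in> G 1 \<longleftrightarrow> band_edge d V0 2 < l \<and> l < band_edge d V0 3" for l
    by (simp add: G_def spectral_gap_def)
  have 1: "l \<in> G 1 \<inter> shift_set (G 0) \<alpha> \<longleftrightarrow>
      band_edge d V0 2 < l \<and> l < band_edge d V0 3 \<and> l - \<alpha> < band_edge d V0 1" for l
    unfolding Int_iff mem_shift_set G0 G1 by blast
  have 2: "l \<in> G 0 \<inter> shift_set (G 1) \<alpha> \<longleftrightarrow>
      band_edge d V0 2 < l - \<alpha> \<and> l - \<alpha> < band_edge d V0 3 \<and> l < band_edge d V0 1" for l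
    unfolding Int_iff mem_shift_set G0 G1 by blast
  show ?thesis
    unfolding 1 2 V_def
  proof (intro conjI impI)
    assume "strict_mono_on {0..d/2} V0"
    then have mono: "V0 x < V0 y" if "0 \<le> x" "x < y" "y \<le> d / 2" for x y
      using that by (auto simp: strict_mono_on_def)
    note inc = eigenvalues_increasing[OF mono, of \<alpha>, unfolded d, OF _ _ _ assms(5)]
    show "\<alpha> > 0 \<Longrightarrow> \<exists>!l. (band_edge d V0 2 < l \<and> l < band_edge d V0 3 \<and> l - \<alpha> < band_edge d V0 1) \<and>
        schroedinger_eigenvalue (interface_potential V0 \<alpha>) l" by (rule inc(1))
    show "\<alpha> < 0 \<Longrightarrow> \<exists>!l. (band_edge d V0 2 < l - \<alpha> \<and> l - \<alpha> < band_edge d V0 3 \<and> l < band_edge d V0 1) \<and>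
        schroedinger_eigenvalue (interface_potential V0 \<alpha>) l" by (rule inc(2))
  next
    assume anti: "strict_antimono_on {0..d/2} V0"
    have anti': "V0 y < V0 x" if "0 \<le> x" "x < y" "y \<le> d / 2" for x y
      using monotone_onD[OF anti, of x y] that by auto
    note dec = no_eigenvalues_decreasing[OF anti', of _ \<alpha>, unfolded d]
    show "\<not> (\<exists>l. (band_edge d V0 2 < l \<and> l < band_edge d V0 3 \<and> l - \<alpha> < band_edge d V0 1) \<and>
        schroedinger_eigenvalue (interface_potential V0 \<alpha>) l)" using dec(1) by blast
    show "\<not> (\<exists>l. (band_edge d V0 2 < l - \<alpha> \<and> l - \<alpha> < band_edge d V0 3 \<and> l < band_edge d V0 1) \<and>
        schroedinger_eigenvalue (interface_potential V0 \<alpha>) l)" using dec(2) by blast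
  qed
qed

end
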